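(* The following (formalized Priess-Crampe \& Ribenboim fixed point theorem) is provable in $\mathsf{RCA}_0$: if $\mathcal X$ is a coded complete separable metric space which is an ultrametric space and is spherically complete, and $f\colon\mathcal X\to\mathcal X$ is a coded continuous function which is strictly contracting, then $f$ has a unique fixed point, i.e. there is a unique point $x_*\in\mathcal X$ with $f(x_* )=x_*$.
   Context: $\mathsf{RCA}_0$ is the usual base system of second-order arithmetic ($\Sigma^0_1$-induction and $\Delta^0_1$-comprehension). A (code for a) complete separable metric space $\mathcal X=\widehat X$ is a nonempty set $X\subseteq\mathbb N$ with a sequence of reals $d\colon X\times X\to\mathbb R$ such that $d(a,a)=0$, $d(a,b)=d(b,a)\ge 0$ and $d(a,b)+d(b,c)\ge d(a,c)$. A point of $\mathcal X$ is a sequence $x=\langle x_i\rangle_{i\in\mathbb N}$ of elements of $X$ with $d(x_i,x_j)\le 2^{-i}$ for all $i\le j$; $d(x,y)=\lim_n d(x_n,y_n)$, and $x=y$ means $d(x,y)=0$. Continuous functions are coded in the standard way of reverse mathematics (Simpson, Definition II.6.1); equivalently over $\mathsf{RCA}_0$, by a code assigning uniformly to each rational open ball of the codomain a code (as a union of rational open balls) for its open preimage. $\mathcal X$ is an ultrametric space if $d(x,y)\le\max\{d(x,z),d(z,y)\}$ for all $x,y,z\in\mathcal X$. For $x\in\mathcal X$ and a real $\rho>0$, $\overline B_\rho(x)$ denotes the class of $y\in\mathcal X$ with $d(x,y)\le\rho$. For such (codes of) closed balls in an ultrametric space, write $\overline B_\rho(x)\preceq\overline B_\delta(y)$ if $\max\{d(x,y),\rho\}\le\delta$.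 $\mathcal X$ is spherically complete if for every sequence $\langle\overline B_{\rho_i}(x_i)\rangle_{i\in\mathbb N}$ of closed balls with $\overline B_{\rho_{i+1}}(x_{i+1})\preceq\overline B_{\rho_i}(x_i)$ for all $i$, there is a point $x\in\bigcap_{i\in\mathbb N}\overline B_{\rho_i}(x_i)$. $f\colon\mathcal X\to\mathcal X$ is strictly contracting if $d(f(x),f(y))<d(x,y)$ for all $x\ne y$ in $\mathcal X$. *)

theory Defs
  imports Main
begin

section \<open>Second-order arithmetic\<close>

text \<open>
  The language \<open>L\<^sub>2\<close>, with de Bruijn indices. Number variables and set variables are
  indexed separately: \<open>AllN\<close> binds number index \<open>0\<close>, \<open>AllS\<close> binds set index \<open>0\<close>.
  Set variables are the only set terms, and equality of sets is not primitive.
\<close>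

datatype tm = Var nat | Zero | One | Add tm tm | Mul tm tm

datatype fm =
    Falsum
  | Eq tm tm
  | Less tm tm
  | Mem tm nat
  | Imp fm fm
  | AllN fm
  | AllS fm

abbreviation Neg :: "fm \<Rightarrow> fm" where "Neg p \<equiv> Imp p Falsum"
abbreviation And :: "fm \<Rightarrow> fm \<Rightarrow> fm" where "And p q \<equiv> Neg (Imp p (Neg q))"
abbreviation Or :: "fm \<Rightarrow> fm \<Rightarrow> fm" where "Or p q \<equiv> Imp (Neg p) q"
abbreviation Iff :: "fm \<Rightarrow> fm \<Rightarrow> fm" where "Iff p q \<equiv> And (Imp p q) (Imp q p)"
abbreviation ExN :: "fm \<Rightarrow> fm" where "ExN p \<equiv> Neg (AllN (Neg p))"
abbreviation ExS :: "fm \<Rightarrow> fm" where "ExS p \<equiv> Neg (AllS (Neg p))"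

primrec tsub :: "(nat \<Rightarrow> tm) \<Rightarrow> tm \<Rightarrow> tm" where
  "tsub \<sigma> (Var i) = \<sigma> i"
| "tsub \<sigma> Zero = Zero"
| "tsub \<sigma> One = One"
| "tsub \<sigma> (Add s t) = Add (tsub \<sigma> s) (tsub \<sigma> t)"
| "tsub \<sigma> (Mul s t) = Mul (tsub \<sigma> s) (tsub \<sigma> t)"

definition tshift :: "tm \<Rightarrow> tm" where
  "tshift = tsub (\<lambda>i. Var (Suc i))"

definition upN :: "(nat \<Rightarrow> tm) \<Rightarrow> nat \<Rightarrow> tm" where
  "upN \<sigma> = case_nat (Var 0) (\<lambda>i. tshift (\<sigma> i))"

definition upS :: "(nat \<Rightarrow> nat) \<Rightarrow> nat \<Rightarrow> nat" where
  "upS \<tau> = case_nat 0 (\<lambda>i. Suc (\<tau> i))"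

text \<open>Simultaneous substitution of terms for number variables and renaming of set variables.\<close>

primrec fsub :: "(nat \<Rightarrow> tm) \<Rightarrow> (nat \<Rightarrow> nat) \<Rightarrow> fm \<Rightarrow> fm" where
  "fsub \<sigma> \<tau> Falsum = Falsum"
| "fsub \<sigma> \<tau> (Eq s t) = Eq (tsub \<sigma> s) (tsub \<sigma> t)"
| "fsub \<sigma> \<tau> (Less s t) = Less (tsub \<sigma> s) (tsub \<sigma> t)"
| "fsub \<sigma> \<tau> (Mem t X) = Mem (tsub \<sigma> t) (\<tau> X)"
| "fsub \<sigma> \<tau> (Imp p q) = Imp (fsub \<sigma> \<tau> p) (fsub \<sigma> \<tau> q)"
| "fsub \<sigma> \<tau> (AllN p) = AllN (fsub (upN \<sigma>) \<tau> p)"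
| "fsub \<sigma> \<tau> (AllS p) = AllS (fsub \<sigma> (upS \<tau>) p)"

definition instN :: "tm \<Rightarrow> fm \<Rightarrow> fm" where
  "instN t = fsub (case_nat t Var) id"

definition instS :: "nat \<Rightarrow> fm \<Rightarrow> fm" where
  "instS X = fsub Var (case_nat X id)"

definition shiftN :: "fm \<Rightarrow> fm" where
  "shiftN = fsub (\<lambda>i. Var (Suc i)) id"

definition shiftS :: "fm \<Rightarrow> fm" where
  "shiftS = fsub Var Suc"

primrec tm_closed :: "nat \<Rightarrow> tm \<Rightarrow> bool" where
  "tm_closed n (Var i) = (i < n)"
| "tm_closed n Zero = True"
| "tm_closed n One = True"
| "tm_closed n (Add s t) = (tm_closed n s \<and> tm_closed n t)"
| "tm_closed n (Mul s t) = (tm_closed n s \<and> tm_closed n t)"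

text \<open>All free number (set) indices are below \<open>n\<close> (below \<open>m\<close>).\<close>

primrec fm_closed :: "nat \<Rightarrow> nat \<Rightarrow> fm \<Rightarrow> bool" where
  "fm_closed n m Falsum = True"
| "fm_closed n m (Eq s t) = (tm_closed n s \<and> tm_closed n t)"
| "fm_closed n m (Less s t) = (tm_closed n s \<and> tm_closed n t)"
| "fm_closed n m (Mem t X) = (tm_closed n t \<and> X < m)"
| "fm_closed n m (Imp p q) = (fm_closed n m p \<and> fm_closed n m q)"
| "fm_closed n m (AllN p) = fm_closed (Suc n) m p"
| "fm_closed n m (AllS p) = fm_closed n (Suc m) p"

text \<open>Natural deduction for classical two-sorted first-order logic with equality on numbers.\<close>

inductive proves :: "fm set \<Rightarrow> fm \<Rightarrow> bool" (infix "\<turnstile>" 40) where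
  Assm: "p \<in> \<Gamma> \<Longrightarrow> \<Gamma> \<turnstile> p"
| ImpI: "insert p \<Gamma> \<turnstile> q \<Longrightarrow> \<Gamma> \<turnstile> Imp p q"
| ImpE: "\<Gamma> \<turnstile> Imp p q \<Longrightarrow> \<Gamma> \<turnstile> p \<Longrightarrow> \<Gamma> \<turnstile> q"
| Raa: "insert (Neg p) \<Gamma> \<turnstile> Falsum \<Longrightarrow> \<Gamma> \<turnstile> p"
| AllNI: "shiftN ` \<Gamma> \<turnstile> p \<Longrightarrow> \<Gamma> \<turnstile> AllN p"
| AllNE: "\<Gamma> \<turnstile> AllN p \<Longrightarrow> \<Gamma> \<turnstile> instN t p"
| AllSI: "shiftS ` \<Gamma> \<turnstile> p \<Longrightarrow> \<Gamma> \<turnstile> AllS p"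
| AllSE: "\<Gamma> \<turnstile> AllS p \<Longrightarrow> \<Gamma> \<turnstile> instS X p"
| EqRefl: "\<Gamma> \<turnstile> Eq t t"
| EqSubst: "\<Gamma> \<turnstile> Eq s t \<Longrightarrow> \<Gamma> \<turnstile> instN s p \<Longrightarrow> \<Gamma> \<turnstile> instN t p"


section \<open>The axioms of \<open>RCA\<^sub>0\<close>\<close>

text \<open>\<open>\<Sigma>\<^sup>0\<^sub>0\<close> formulas; set parameters are allowed, and the bound does not mention the bound variable.\<close>

inductive bounded :: "fm \<Rightarrow> bool" where
  "bounded Falsum"
| "bounded (Eq s t)"
| "bounded (Less s t)"
| "bounded (Mem t X)"
| "bounded p \<Longrightarrow> bounded q \<Longrightarrow> bounded (Imp p q)"
| "bounded p \<Longrightarrow> bounded (AllN (Imp (Less (Var 0) (tshift t)) p))"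
| "bounded p \<Longrightarrow> bounded (ExN (And (Less (Var 0) (tshift t)) p))"

definition Sigma01 :: "fm \<Rightarrow> bool" where
  "Sigma01 p \<longleftrightarrow> (\<exists>q. bounded q \<and> p = ExN q)"

definition Pi01 :: "fm \<Rightarrow> bool" where
  "Pi01 p \<longleftrightarrow> (\<exists>q. bounded q \<and> p = AllN q)"

text \<open>In the two schemes, number index \<open>0\<close> of \<open>p\<close> and \<open>q\<close> is the induction or comprehension
  variable and all other free variables are parameters.\<close>

definition induction_axiom :: "fm \<Rightarrow> fm" where
  "induction_axiom p =
     Imp (And (instN Zero p)
              (AllN (Imp p (fsub (case_nat (Add (Var 0) One) (\<lambda>i. Var (Suc i))) id p))))
         (AllN p)"

definition comprehension_axiom :: "fm \<Rightarrow> fm \<Rightarrow> fm" where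
  "comprehension_axiom p q =
     Imp (AllN (Iff p q)) (ExS (AllN (Iff (Mem (Var 0) 0) (shiftS p))))"

inductive_set rca0_open :: "fm set" where
  "Neg (Eq (Add (Var 0) One) Zero) \<in> rca0_open"
| "Imp (Eq (Add (Var 0) One) (Add (Var 1) One)) (Eq (Var 0) (Var 1)) \<in> rca0_open"
| "Eq (Add (Var 0) Zero) (Var 0) \<in> rca0_open"
| "Eq (Add (Var 0) (Add (Var 1) One)) (Add (Add (Var 0) (Var 1)) One) \<in> rca0_open"
| "Eq (Mul (Var 0) Zero) Zero \<in> rca0_open"
| "Eq (Mul (Var 0) (Add (Var 1) One)) (Add (Mul (Var 0) (Var 1)) (Var 0)) \<in> rca0_open"
| "Neg (Less (Var 0) Zero) \<in> rca0_open"
| "Iff (Less (Var 0) (Add (Var 1) One)) (Or (Less (Var 0) (Var 1)) (Eq (Var 0) (Var 1)))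
     \<in> rca0_open"
| "Sigma01 p \<Longrightarrow> induction_axiom p \<in> rca0_open"
| "Sigma01 p \<Longrightarrow> Pi01 q \<Longrightarrow> comprehension_axiom p q \<in> rca0_open"

definition RCA0 :: "fm set" where
  "RCA0 = {(AllN ^^ n) ((AllS ^^ m) p) | n m p. p \<in> rca0_open \<and> fm_closed n m p}"


section \<open>Writing \<open>L\<^sub>2\<close> formulas with HOL binders\<close>

text \<open>
  A level formula is an \<open>L\<^sub>2\<close> formula waiting to be told under how many number and set
  quantifiers it is placed; a level term (set variable) waits for the number of number (set)
  quantifiers. The quantifiers below, placed at depth \<open>n\<close>, hand their body the variable bound at
  level \<open>n\<close>, which at depth \<open>k > n\<close> has de Bruijn index \<open>k - Suc n\<close>. A closed formula is read off
  at depth \<open>0, 0\<close>.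
\<close>

type_synonym lterm = "nat \<Rightarrow> tm"
type_synonym lset = "nat \<Rightarrow> nat"
type_synonym lform = "nat \<Rightarrow> nat \<Rightarrow> fm"

definition sentence :: "lform \<Rightarrow> fm" where
  "sentence P = P 0 0"

definition l_zero :: lterm ("\<^bold>0") where "\<^bold>0 = (\<lambda>n. Zero)"
definition l_one :: lterm ("\<^bold>1") where "\<^bold>1 = (\<lambda>n. One)"
definition l_add :: "lterm \<Rightarrow> lterm \<Rightarrow> lterm" (infixl "\<^bold>+" 65) where
  "s \<^bold>+ t = (\<lambda>n. Add (s n) (t n))"
definition l_mul :: "lterm \<Rightarrow> lterm \<Rightarrow> lterm" (infixl "\<^bold>\<cdot>" 70) where
  "s \<^bold>\<cdot> t = (\<lambda>n. Mul (s n) (t n))"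

definition l_eq :: "lterm \<Rightarrow> lterm \<Rightarrow> lform" (infix "\<^bold>=" 50) where
  "(s \<^bold>= t) = (\<lambda>n m. Eq (s n) (t n))"
definition l_less :: "lterm \<Rightarrow> lterm \<Rightarrow> lform" (infix "\<^bold><" 50) where
  "(s \<^bold>< t) = (\<lambda>n m. Less (s n) (t n))"
definition l_mem :: "lterm \<Rightarrow> lset \<Rightarrow> lform" (infix "\<^bold>\<in>" 50) where
  "(t \<^bold>\<in> X) = (\<lambda>n m. Mem (t n) (X m))"
definition l_not :: "lform \<Rightarrow> lform" ("\<^bold>\<not> _" [40] 40) where
  "(\<^bold>\<not> P) = (\<lambda>n m. Neg (P n m))"
definition l_and :: "lform \<Rightarrow> lform \<Rightarrow> lform" (infixr "\<^bold>\<and>" 35) where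
  "(P \<^bold>\<and> Q) = (\<lambda>n m. And (P n m) (Q n m))"
definition l_or :: "lform \<Rightarrow> lform \<Rightarrow> lform" (infixr "\<^bold>\<or>" 30) where
  "(P \<^bold>\<or> Q) = (\<lambda>n m. Or (P n m) (Q n m))"
definition l_imp :: "lform \<Rightarrow> lform \<Rightarrow> lform" (infixr "\<^bold>\<longrightarrow>" 25) where
  "(P \<^bold>\<longrightarrow> Q) = (\<lambda>n m. Imp (P n m) (Q n m))"
definition l_allN :: "(lterm \<Rightarrow> lform) \<Rightarrow> lform" (binder "\<^bold>\<forall>" 10) where
  "l_allN P = (\<lambda>n m. AllN (P (\<lambda>k. Var (k - Suc n)) (Suc n) m))"
definition l_exN :: "(lterm \<Rightarrow> lform) \<Rightarrow> lform" (binder "\<^bold>\<exists>" 10) where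
  "l_exN P = (\<lambda>n m. ExN (P (\<lambda>k. Var (k - Suc n)) (Suc n) m))"
definition l_allS :: "(lset \<Rightarrow> lform) \<Rightarrow> lform" (binder "\<^bold>\<forall>\<^sub>S" 10) where
  "l_allS P = (\<lambda>n m. AllS (P (\<lambda>k. k - Suc m) n (Suc m)))"
definition l_exS :: "(lset \<Rightarrow> lform) \<Rightarrow> lform" (binder "\<^bold>\<exists>\<^sub>S" 10) where
  "l_exS P = (\<lambda>n m. ExS (P (\<lambda>k. k - Suc m) n (Suc m)))"

definition l_le :: "lterm \<Rightarrow> lterm \<Rightarrow> lform" (infix "\<^bold>\<le>" 50) where
  "(s \<^bold>\<le> t) = (s \<^bold>< t \<^bold>\<or> s \<^bold>= t)"


section \<open>Pairs and functions\<close>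

definition pr :: "lterm \<Rightarrow> lterm \<Rightarrow> lterm" where
  "pr s t = (s \<^bold>+ t) \<^bold>\<cdot> (s \<^bold>+ t) \<^bold>+ s"

text \<open>Domains and codomains are given by formulas with one distinguished argument.\<close>

type_synonym lclass = "lterm \<Rightarrow> lform"

definition numbers :: lclass where
  "numbers = (\<lambda>x. x \<^bold>= x)"

definition elements :: "lset \<Rightarrow> lclass" where
  "elements X = (\<lambda>x. x \<^bold>\<in> X)"

definition pairs :: "lclass \<Rightarrow> lclass \<Rightarrow> lclass" where
  "pairs A B = (\<lambda>z. \<^bold>\<exists>a b. A a \<^bold>\<and> B b \<^bold>\<and> z \<^bold>= pr a b)"

definition is_fun :: "lclass \<Rightarrow> lclass \<Rightarrow> lset \<Rightarrow> lform" where
  "is_fun A B F =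
     ((\<^bold>\<forall>z. z \<^bold>\<in> F \<^bold>\<longrightarrow> pairs A B z) \<^bold>\<and>
      (\<^bold>\<forall>a. A a \<^bold>\<longrightarrow> (\<^bold>\<exists>b. pr a b \<^bold>\<in> F \<^bold>\<and> (\<^bold>\<forall>c. pr a c \<^bold>\<in> F \<^bold>\<longrightarrow> c \<^bold>= b))))"

text \<open>\<open>S i v\<close> says that \<open>v\<close> is the \<open>i\<close>-th term of the sequence \<open>S\<close>.\<close>

type_synonym lseq = "lterm \<Rightarrow> lterm \<Rightarrow> lform"

definition seq :: "lset \<Rightarrow> lseq" where
  "seq F = (\<lambda>i v. pr i v \<^bold>\<in> F)"

definition section_seq :: "lset \<Rightarrow> lterm \<Rightarrow> lseq" where
  "section_seq F c = (\<lambda>i v. pr (pr c i) v \<^bold>\<in> F)"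


section \<open>Rational numbers\<close>

text \<open>The number \<open>fraction a b c\<close> with \<open>c > 0\<close> codes the fraction \<open>(a - b) / c\<close>; a rational number is
  the least code of a fraction.\<close>

definition fraction :: "lterm \<Rightarrow> lterm \<Rightarrow> lterm \<Rightarrow> lterm" where
  "fraction a b c = pr (pr a b) c"

definition frac_le :: "lterm \<Rightarrow> lterm \<Rightarrow> lform" where
  "frac_le p q =
     (\<^bold>\<exists>a b c a' b' c'. \<^bold>0 \<^bold>< c \<^bold>\<and> \<^bold>0 \<^bold>< c' \<^bold>\<and> p \<^bold>= fraction a b c \<^bold>\<and> q \<^bold>= fraction a' b' c' \<^bold>\<and>
        a \<^bold>\<cdot> c' \<^bold>+ b' \<^bold>\<cdot> c \<^bold>\<le> a' \<^bold>\<cdot> c \<^bold>+ b \<^bold>\<cdot> c')"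

definition frac_eq :: "lterm \<Rightarrow> lterm \<Rightarrow> lform" where
  "frac_eq p q = (frac_le p q \<^bold>\<and> frac_le q p)"

definition rat :: lclass where
  "rat q = ((\<^bold>\<exists>a b c. \<^bold>0 \<^bold>< c \<^bold>\<and> q \<^bold>= fraction a b c) \<^bold>\<and> (\<^bold>\<forall>p. p \<^bold>< q \<^bold>\<longrightarrow> \<^bold>\<not> frac_eq p q))"

text \<open>The least code of \<open>0\<close>.\<close>

definition rat_zero :: lterm where
  "rat_zero = fraction \<^bold>0 \<^bold>0 \<^bold>1"

definition pos_rat :: lclass where
  "pos_rat q = (rat q \<^bold>\<and> \<^bold>\<not> frac_le q rat_zero)"

text \<open>\<open>r = p + q\<close>\<close>

definition rat_add :: "lterm \<Rightarrow> lterm \<Rightarrow> lterm \<Rightarrow> lform" where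
  "rat_add p q r =
     (rat r \<^bold>\<and> (\<^bold>\<exists>a b c a' b' c'. \<^bold>0 \<^bold>< c \<^bold>\<and> \<^bold>0 \<^bold>< c' \<^bold>\<and> p \<^bold>= fraction a b c \<^bold>\<and> q \<^bold>= fraction a' b' c' \<^bold>\<and>
        frac_eq r (fraction (a \<^bold>\<cdot> c' \<^bold>+ a' \<^bold>\<cdot> c) (b \<^bold>\<cdot> c' \<^bold>+ b' \<^bold>\<cdot> c) (c \<^bold>\<cdot> c'))))"

text \<open>\<open>e = 2\<^sup>k\<close>, the exponential function being given by primitive recursion\<close>

definition pow2 :: "lterm \<Rightarrow> lterm \<Rightarrow> lform" where
  "pow2 k e =
     (\<^bold>\<exists>\<^sub>S E. is_fun numbers numbers E \<^bold>\<and> seq E \<^bold>0 \<^bold>1 \<^bold>\<and>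
        (\<^bold>\<forall>i v. seq E i v \<^bold>\<longrightarrow> seq E (i \<^bold>+ \<^bold>1) (v \<^bold>+ v)) \<^bold>\<and> seq E k e)"

text \<open>\<open>q = 2\<^sup>-\<^sup>k\<close>\<close>

definition half_pow :: "lterm \<Rightarrow> lterm \<Rightarrow> lform" where
  "half_pow k q = (rat q \<^bold>\<and> (\<^bold>\<exists>e. pow2 k e \<^bold>\<and> frac_eq q (fraction \<^bold>1 \<^bold>0 e)))"


section \<open>Real numbers\<close>

text \<open>A real number is a sequence of rationals with \<open>\<bar>q\<^sub>i - q\<^sub>j\<bar> \<le> 2\<^sup>-\<^sup>i\<close> for \<open>i \<le> j\<close>. Operations on
  reals act on sequences presented by formulas, so that \<open>d(x,y)\<close> and the like are available as
  expressions.\<close>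

definition fast_cauchy :: "lseq \<Rightarrow> lform" where
  "fast_cauchy R =
     (\<^bold>\<forall>i j p q. i \<^bold>\<le> j \<^bold>\<and> R i p \<^bold>\<and> R j q \<^bold>\<longrightarrow>
        (\<^bold>\<exists>e u v. half_pow i e \<^bold>\<and> rat_add p e u \<^bold>\<and> rat_add q e v \<^bold>\<and> frac_le p v \<^bold>\<and> frac_le q u))"

text \<open>\<open>R \<le> S\<close> iff \<open>R\<^sub>k \<le> S\<^sub>k + 2\<^sup>-\<^sup>k + 2\<^sup>-\<^sup>k\<close> for all \<open>k\<close>\<close>

definition real_le :: "lseq \<Rightarrow> lseq \<Rightarrow> lform" where
  "real_le R S =
     (\<^bold>\<forall>k p q. R k p \<^bold>\<and> S k q \<^bold>\<longrightarrow>
        (\<^bold>\<exists>e u v. half_pow k e \<^bold>\<and> rat_add q e u \<^bold>\<and> rat_add u e v \<^bold>\<and> frac_le p v))"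

definition real_less :: "lseq \<Rightarrow> lseq \<Rightarrow> lform" where
  "real_less R S = (\<^bold>\<not> real_le S R)"

definition real_eq :: "lseq \<Rightarrow> lseq \<Rightarrow> lform" where
  "real_eq R S = (real_le R S \<^bold>\<and> real_le S R)"

definition real_of_rat :: "lterm \<Rightarrow> lseq" where
  "real_of_rat r = (\<lambda>k q. q \<^bold>= r)"

definition real_zero :: lseq where
  "real_zero = real_of_rat rat_zero"

text \<open>The shift by one keeps the sum fast Cauchy.\<close>

definition real_add :: "lseq \<Rightarrow> lseq \<Rightarrow> lseq" where
  "real_add R S = (\<lambda>k r. \<^bold>\<exists>p q. R (k \<^bold>+ \<^bold>1) p \<^bold>\<and> S (k \<^bold>+ \<^bold>1) q \<^bold>\<and> rat_add p q r)"

definition real_max :: "lseq \<Rightarrow> lseq \<Rightarrow> lseq" where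
  "real_max R S =
     (\<lambda>k r. \<^bold>\<exists>p q. R k p \<^bold>\<and> S k q \<^bold>\<and> ((frac_le p q \<^bold>\<and> r \<^bold>= q) \<^bold>\<or> (frac_le q p \<^bold>\<and> r \<^bold>= p)))"


section \<open>Complete separable metric spaces\<close>

definition dist_code :: "lset \<Rightarrow> lterm \<Rightarrow> lterm \<Rightarrow> lseq" where
  "dist_code D a b = section_seq D (pr a b)"

definition csm_space :: "lset \<Rightarrow> lset \<Rightarrow> lform" where
  "csm_space X D =
     ((\<^bold>\<exists>a. a \<^bold>\<in> X) \<^bold>\<and>
      is_fun (pairs (pairs (elements X) (elements X)) numbers) rat D \<^bold>\<and>
      (\<^bold>\<forall>a b. a \<^bold>\<in> X \<^bold>\<and> b \<^bold>\<in> X \<^bold>\<longrightarrow> fast_cauchy (dist_code D a b)) \<^bold>\<and>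
      (\<^bold>\<forall>a. a \<^bold>\<in> X \<^bold>\<longrightarrow> real_eq (dist_code D a a) real_zero) \<^bold>\<and>
      (\<^bold>\<forall>a b. a \<^bold>\<in> X \<^bold>\<and> b \<^bold>\<in> X \<^bold>\<longrightarrow>
         real_eq (dist_code D a b) (dist_code D b a) \<^bold>\<and> real_le real_zero (dist_code D a b)) \<^bold>\<and>
      (\<^bold>\<forall>a b c. a \<^bold>\<in> X \<^bold>\<and> b \<^bold>\<in> X \<^bold>\<and> c \<^bold>\<in> X \<^bold>\<longrightarrow>
         real_le (dist_code D a c) (real_add (dist_code D a b) (dist_code D b c))))"

definition converges_fast :: "lset \<Rightarrow> lseq \<Rightarrow> lform" where
  "converges_fast D x =
     (\<^bold>\<forall>i j a b e. i \<^bold>\<le> j \<^bold>\<and> x i a \<^bold>\<and> x j b \<^bold>\<and> half_pow i e \<^bold>\<longrightarrow>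
        real_le (dist_code D a b) (real_of_rat e))"

definition point :: "lset \<Rightarrow> lset \<Rightarrow> lset \<Rightarrow> lform" where
  "point X D x = (is_fun numbers (elements X) x \<^bold>\<and> converges_fast D (seq x))"

definition const_point :: "lterm \<Rightarrow> lseq" where
  "const_point a = (\<lambda>i v. v \<^bold>= a)"

text \<open>The real \<open>d(x,y) = lim\<^sub>n d(x\<^sub>n,y\<^sub>n)\<close>. Since \<open>d(x\<^sub>n,y\<^sub>n)\<close> is within \<open>2 \<cdot> 2\<^sup>-\<^sup>n\<close> of the limit, the
  \<open>(k+2)\<close>-th rational approximations to \<open>d(x\<^sub>k\<^sub>+\<^sub>2,y\<^sub>k\<^sub>+\<^sub>2)\<close> converge to it and satisfy the
  Cauchy condition for reals (\<open>2\<^sup>-\<^sup>k (1/4 + 1/8 + 1/2) \<le> 2\<^sup>-\<^sup>k\<close>).\<close>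

definition point_dist :: "lset \<Rightarrow> lseq \<Rightarrow> lseq \<Rightarrow> lseq" where
  "point_dist D x y =
     (\<lambda>k q. \<^bold>\<exists>a b. x (k \<^bold>+ \<^bold>1 \<^bold>+ \<^bold>1) a \<^bold>\<and> y (k \<^bold>+ \<^bold>1 \<^bold>+ \<^bold>1) b \<^bold>\<and> dist_code D a b (k \<^bold>+ \<^bold>1 \<^bold>+ \<^bold>1) q)"

definition point_eq :: "lset \<Rightarrow> lset \<Rightarrow> lset \<Rightarrow> lform" where
  "point_eq D x y = real_eq (point_dist D (seq x) (seq y)) real_zero"


section \<open>Ultrametric spaces and spherical completeness\<close>

definition ultrametric :: "lset \<Rightarrow> lset \<Rightarrow> lform" where
  "ultrametric X D =
     (\<^bold>\<forall>\<^sub>S x y z. point X D x \<^bold>\<and> point X D y \<^bold>\<and> point X D z \<^bold>\<longrightarrow>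
        real_le (point_dist D (seq x) (seq y))
                (real_max (point_dist D (seq x) (seq z)) (point_dist D (seq z) (seq y))))"

text \<open>A sequence of closed balls is given by sequences \<open>C\<close> of centres and \<open>R\<close> of positive
  radii, the \<open>i\<close>-th of which are coded by the \<open>i\<close>-th sections.\<close>

definition ball_seq :: "lset \<Rightarrow> lset \<Rightarrow> lset \<Rightarrow> lset \<Rightarrow> lform" where
  "ball_seq X D C R =
     (is_fun (pairs numbers numbers) (elements X) C \<^bold>\<and>
      (\<^bold>\<forall>i. converges_fast D (section_seq C i)) \<^bold>\<and>
      is_fun (pairs numbers numbers) rat R \<^bold>\<and>
      (\<^bold>\<forall>i. fast_cauchy (section_seq R i) \<^bold>\<and> real_less real_zero (section_seq R i)))"

text \<open>The ball with centre \<open>x\<close> and radius \<open>r\<close> precedes the one with centre \<open>y\<close> and radius \<open>s\<close>.\<close>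

definition ball_prec :: "lset \<Rightarrow> lseq \<Rightarrow> lseq \<Rightarrow> lseq \<Rightarrow> lseq \<Rightarrow> lform" where
  "ball_prec D x r y s = real_le (real_max (point_dist D x y) r) s"

definition in_ball :: "lset \<Rightarrow> lseq \<Rightarrow> lseq \<Rightarrow> lseq \<Rightarrow> lform" where
  "in_ball D y x r = real_le (point_dist D x y) r"

definition spherically_complete :: "lset \<Rightarrow> lset \<Rightarrow> lform" where
  "spherically_complete X D =
     (\<^bold>\<forall>\<^sub>S C R. ball_seq X D C R \<^bold>\<and>
        (\<^bold>\<forall>i. ball_prec D (section_seq C (i \<^bold>+ \<^bold>1)) (section_seq R (i \<^bold>+ \<^bold>1))
                         (section_seq C i) (section_seq R i)) \<^bold>\<longrightarrow>
        (\<^bold>\<exists>\<^sub>S x. point X D x \<^bold>\<and> (\<^bold>\<forall>i. in_ball D (seq x) (section_seq C i) (section_seq R i))))"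


section \<open>Continuous functions\<close>

text \<open>\<open>(a,r) F (b,s)\<close> in Simpson's notation: some \<open>(n,a,r,b,s)\<close> belongs to \<open>F\<close>.\<close>

definition code_rel :: "lset \<Rightarrow> lterm \<Rightarrow> lterm \<Rightarrow> lterm \<Rightarrow> lterm \<Rightarrow> lform" where
  "code_rel F a r b s = (\<^bold>\<exists>n. pr (pr (pr (pr n a) r) b) s \<^bold>\<in> F)"

text \<open>\<open>(a',r') < (a,r)\<close>, that is, \<open>d(a,a') + r' < r\<close>\<close>

definition ball_less :: "lset \<Rightarrow> lterm \<Rightarrow> lterm \<Rightarrow> lterm \<Rightarrow> lterm \<Rightarrow> lform" where
  "ball_less D a' r' a r =
     real_less (real_add (dist_code D a a') (real_of_rat r')) (real_of_rat r)"

text \<open>A code of a continuous partial function from the space to itself.\<close>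

definition continuous_code :: "lset \<Rightarrow> lset \<Rightarrow> lset \<Rightarrow> lform" where
  "continuous_code X D F =
     ((\<^bold>\<forall>z. z \<^bold>\<in> F \<^bold>\<longrightarrow>
         pairs (pairs (pairs (pairs numbers (elements X)) pos_rat) (elements X)) pos_rat z) \<^bold>\<and>
      (\<^bold>\<forall>a r b s b' s'. code_rel F a r b s \<^bold>\<and> code_rel F a r b' s' \<^bold>\<longrightarrow>
         real_le (dist_code D b b') (real_add (real_of_rat s) (real_of_rat s'))) \<^bold>\<and>
      (\<^bold>\<forall>a r b s a' r'. code_rel F a r b s \<^bold>\<and> a' \<^bold>\<in> X \<^bold>\<and> pos_rat r' \<^bold>\<and> ball_less D a' r' a r \<^bold>\<longrightarrow>
         code_rel F a' r' b s) \<^bold>\<and>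
      (\<^bold>\<forall>a r b s b' s'. code_rel F a r b s \<^bold>\<and> b' \<^bold>\<in> X \<^bold>\<and> pos_rat s' \<^bold>\<and> ball_less D b s b' s' \<^bold>\<longrightarrow>
         code_rel F a r b' s'))"

definition in_domain :: "lset \<Rightarrow> lset \<Rightarrow> lset \<Rightarrow> lform" where
  "in_domain D F x =
     (\<^bold>\<forall>e. pos_rat e \<^bold>\<longrightarrow>
        (\<^bold>\<exists>a r b s. code_rel F a r b s \<^bold>\<and>
           real_less (point_dist D (seq x) (const_point a)) (real_of_rat r) \<^bold>\<and>
           real_less (real_of_rat s) (real_of_rat e)))"

definition total_function :: "lset \<Rightarrow> lset \<Rightarrow> lset \<Rightarrow> lform" where
  "total_function X D F = (\<^bold>\<forall>\<^sub>S x. point X D x \<^bold>\<longrightarrow> in_domain D F x)"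

text \<open>\<open>y = f(x)\<close>, where \<open>F\<close> is a code of \<open>f\<close> and \<open>x\<close> is in its domain\<close>

definition is_value :: "lset \<Rightarrow> lset \<Rightarrow> lset \<Rightarrow> lset \<Rightarrow> lset \<Rightarrow> lform" where
  "is_value X D F x y =
     (point X D y \<^bold>\<and>
      (\<^bold>\<forall>a r b s. code_rel F a r b s \<^bold>\<and>
         real_less (point_dist D (seq x) (const_point a)) (real_of_rat r) \<^bold>\<longrightarrow>
         real_le (point_dist D (seq y) (const_point b)) (real_of_rat s)))"

definition strictly_contracting :: "lset \<Rightarrow> lset \<Rightarrow> lset \<Rightarrow> lform" where
  "strictly_contracting X D F =
     (\<^bold>\<forall>\<^sub>S x y u v. point X D x \<^bold>\<and> point X D y \<^bold>\<and> \<^bold>\<not> point_eq D x y \<^bold>\<and>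
        is_value X D F x u \<^bold>\<and> is_value X D F y v \<^bold>\<longrightarrow>
        real_less (point_dist D (seq u) (seq v)) (point_dist D (seq x) (seq y)))"

definition fixed_point :: "lset \<Rightarrow> lset \<Rightarrow> lset \<Rightarrow> lset \<Rightarrow> lform" where
  "fixed_point X D F x =
     (point X D x \<^bold>\<and> (\<^bold>\<exists>\<^sub>S y. is_value X D F x y \<^bold>\<and> point_eq D y x))"

end

theory Submission
  imports Defs "HOL-Library.Countable" "HOL-Computational_Algebra.Fraction_Field"
begin

text \<open>
  By the completeness theorem it suffices to prove the statement in all models of \<open>RCA\<^sub>0\<close>. Inside a
  model, reals are compared through their lower cuts of rationals. For \<open>b\<close> in the dense set write
  \<open>\<phi>(b) = d(b, f(b))\<close>; then \<open>\<phi>(b) < s\<close> and \<open>\<phi>(b) > s\<close> are \<open>\<Sigma>\<^sup>0\<^sub>1\<close>. By primitive recursion one obtains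
  closed balls with centres \<open>a\<^sub>n\<close> in the dense set and rational radii \<open>r\<^sub>n > \<phi>(a\<^sub>n)\<close>, each contained in
  the previous one. Stage \<open>n\<close> considers the \<open>n\<close>-th triple of a point \<open>b\<close> of the dense set and rationals
  \<open>s' < s\<close>. It picks a rational \<open>t\<close> with \<open>\<phi>(a\<^sub>n) < t < r\<^sub>n\<close> and searches for a proof of \<open>d(a\<^sub>n, b) > t\<close>
  or of \<open>d(a\<^sub>n, b) < r\<^sub>n\<close>. In the first case the radius is decreased to \<open>t\<close>, which excludes \<open>b\<close>. In the
  second case the next ball has centre \<open>b\<close> and radius \<open>s\<close>, unless \<open>s \<ge> r\<^sub>n\<close> or \<open>\<phi>(b) > s'\<close> is found, when
  nothing changes.

  A point \<open>x\<close> in all these balls satisfies \<open>d(x, f(x)) \<le> r\<^sub>n\<close> for all \<open>n\<close>. If \<open>f(x) \<noteq> x\<close>, choose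
  \<open>s' < s\<close> between \<open>d(f(x), f(f(x)))\<close> and \<open>d(x, f(x))\<close>, and \<open>b\<close> close to \<open>f(x)\<close>, so that \<open>\<phi>(b) \<le> s'\<close>.
  The stage for this triple either separates \<open>b\<close> from \<open>x\<close> by more than \<open>d(x, f(x))\<close>, or makes the
  radius smaller than \<open>d(x, f(x))\<close>; both are impossible.
\<close>

section \<open>Substitution and derivations\<close>

text \<open>The classical argument applies Zorn's lemma to the balls with centre x and radius d(x,
  f(x)). Neither minimal balls nor infima of radii are available in \<open>RCA0\<close>, so a chain
  has to be computed, and only rational radii and centres from the dense set can be fed to a
  recursion on numbers. The obstacle is that comparisons of reals are only semidecidable. Every
  decision is therefore posed with two thresholds: for t < r, one of d(a, b) > t and d(a, b) < r is
  eventually confirmed, and likewise for \<phi>(b). Keeping r strictly above \<phi>(a) leaves room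
  for t. A stage is thus a \<open>Sigma01\<close> relation, total thanks to the invariant \<phi>(a)
  < r. Uniformization makes it a function, and iterating it requires codes of finite computations,
  hence powers of 2, which the metric itself supplies. That b close to f(x) has \<phi>(b) \<le> s'
  is the ultrametric inequality along b, f(x), f(f(x)), f(b), where contraction bounds the last
  distance by d(b, f(x)).\<close>

lemma tsub_tsub: "tsub \<sigma> (tsub \<sigma>' t) = tsub (tsub \<sigma> \<circ> \<sigma>') t"
  by (induction t) auto

lemma tsub_Var [simp]: "tsub Var t = t"
  by (induction t) auto

lemma upN_simps [simp]: "upN \<sigma> 0 = Var 0" "upN \<sigma> (Suc i) = tshift (\<sigma> i)"
  by (simp_all add: upN_def)

lemma upS_simps [simp]: "upS \<tau> 0 = 0" "upS \<tau> (Suc i) = Suc (\<tau> i)"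
  by (simp_all add: upS_def)

lemma tsub_upN_tshift: "tsub (upN \<sigma>) (tshift t) = tshift (tsub \<sigma> t)"
  by (simp add: tshift_def tsub_tsub comp_def)

lemma tsub_case_nat_tshift [simp]: "tsub (case_nat t \<sigma>) (tshift s) = tsub \<sigma> s"
  by (simp add: tshift_def tsub_tsub comp_def)

lemma upN_comp: "tsub (upN \<sigma>) \<circ> upN \<sigma>' = upN (tsub \<sigma> \<circ> \<sigma>')"
proof
  fix i show "(tsub (upN \<sigma>) \<circ> upN \<sigma>') i = upN (tsub \<sigma> \<circ> \<sigma>') i"
    by (cases i) (simp_all add: tsub_upN_tshift)
qed

lemma upS_comp: "upS \<tau> \<circ> upS \<tau>' = upS (\<tau> \<circ> \<tau>')"
proof
  fix i show "(upS \<tau> \<circ> upS \<tau>') i = upS (\<tau> \<circ> \<tau>') i"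
    by (cases i) simp_all
qed

lemma fsub_fsub: "fsub \<sigma> \<tau> (fsub \<sigma>' \<tau>' p) = fsub (tsub \<sigma> \<circ> \<sigma>') (\<tau> \<circ> \<tau>') p"
  by (induction p arbitrary: \<sigma> \<sigma>' \<tau> \<tau>') (auto simp: tsub_tsub upN_comp upS_comp)

lemma upN_Var [simp]: "upN Var = Var"
proof
  fix i show "upN Var i = Var i" by (cases i) (simp_all add: tshift_def)
qed

lemma upS_id [simp]: "upS id = id"
proof
  fix i show "upS id i = id i" by (cases i) simp_all
qed

lemma fsub_Var [simp]: "fsub Var id p = p"
  by (induction p) (simp_all del: id_apply, simp)

lemma tsub_closed: "tm_closed n t \<Longrightarrow> (\<And>i. i < n \<Longrightarrow> \<sigma> i = \<sigma>' i) \<Longrightarrow> tsub \<sigma> t = tsub \<sigma>' t"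
  by (induction t) auto

text \<open>Only the free indices matter. Closed axioms are thus fixed by every substitution, and a
  renaming that moves one fresh index acts on the other formulas as a plain shift.\<close>

lemma fsub_closed:
  "fm_closed n m p \<Longrightarrow> (\<And>i. i < n \<Longrightarrow> \<sigma> i = \<sigma>' i) \<Longrightarrow> (\<And>i. i < m \<Longrightarrow> \<tau> i = \<tau>' i) \<Longrightarrow>
    fsub \<sigma> \<tau> p = fsub \<sigma>' \<tau>' p"
proof (induction p arbitrary: n m \<sigma> \<sigma>' \<tau> \<tau>')
  case (AllN p)
  have "upN \<sigma> i = upN \<sigma>' i" if "i < Suc n" for i
    using that AllN.prems(2) by (cases i) auto
  with AllN.IH[of "Suc n" m "upN \<sigma>" "upN \<sigma>'" \<tau> \<tau>'] AllN.prems show ?case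
    by simp
next
  case (AllS p)
  have "upS \<tau> i = upS \<tau>' i" if "i < Suc m" for i
    using that AllS.prems(3) by (cases i) auto
  with AllS.IH[of n "Suc m" \<sigma> \<sigma>' "upS \<tau>" "upS \<tau>'"] AllS.prems show ?case
    by simp
next
  case (Imp p q)
  then show ?case by (metis fm_closed.simps(5) fsub.simps(5))
qed (auto intro: tsub_closed)

lemma tm_closed_mono: "tm_closed n t \<Longrightarrow> n \<le> n' \<Longrightarrow> tm_closed n' t"
  by (induction t) auto

lemma fm_closed_mono: "fm_closed n m p \<Longrightarrow> n \<le> n' \<Longrightarrow> m \<le> m' \<Longrightarrow> fm_closed n' m' p"
proof (induction p arbitrary: n m n' m')
  case (AllN p)
  then show ?case using AllN.IH[of "Suc n" m "Suc n'" m'] by simp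
next
  case (AllS p)
  then show ?case using AllS.IH[of n "Suc m" n' "Suc m'"] by simp
next
  case (Imp p q)
  then show ?case by (metis fm_closed.simps(5))
qed (auto intro: tm_closed_mono)

lemma tm_closed_ex: "\<exists>n. tm_closed n t"
proof (induction t)
  case (Var i)
  then show ?case by (auto intro: exI[of _ "Suc i"])
next
  case (Add s t)
  then obtain a b where "tm_closed a s" "tm_closed b t" by auto
  then have "tm_closed (max a b) (Add s t)" by (auto intro: tm_closed_mono)
  then show ?case ..
next
  case (Mul s t)
  then obtain a b where "tm_closed a s" "tm_closed b t" by auto
  then have "tm_closed (max a b) (Mul s t)" by (auto intro: tm_closed_mono)
  then show ?case ..
qed auto

lemma fm_closed_ex: "\<exists>k. fm_closed k k p"
proof (induction p)
  case (Eq s t)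
  obtain a b where "tm_closed a s" "tm_closed b t" using tm_closed_ex by metis
  then have "fm_closed (max a b) (max a b) (Eq s t)" by (auto intro: tm_closed_mono)
  then show ?case ..
next
  case (Less s t)
  obtain a b where "tm_closed a s" "tm_closed b t" using tm_closed_ex by metis
  then have "fm_closed (max a b) (max a b) (Less s t)" by (auto intro: tm_closed_mono)
  then show ?case ..
next
  case (Mem t X)
  obtain a where "tm_closed a t" using tm_closed_ex by metis
  then have "fm_closed (max a (Suc X)) (max a (Suc X)) (Mem t X)" by (auto intro: tm_closed_mono)
  then show ?case ..
next
  case (Imp p q)
  then obtain a b where "fm_closed a a p" "fm_closed b b q" by auto
  then have "fm_closed (max a b) (max a b) (Imp p q)" by (auto intro: fm_closed_mono)
  then show ?case ..
next
  case (AllN p)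
  then obtain k where "fm_closed k k p" by auto
  then have "fm_closed k k (AllN p)" by (auto intro: fm_closed_mono)
  then show ?case ..
next
  case (AllS p)
  then obtain k where "fm_closed k k p" by auto
  then have "fm_closed k k (AllS p)" by (auto intro: fm_closed_mono)
  then show ?case ..
qed auto

lemma fm_closed_finite: "finite F \<Longrightarrow> \<exists>k. \<forall>p\<in>F. fm_closed k k p"
proof (induction F rule: finite_induct)
  case (insert p F)
  then obtain a where a: "\<forall>p\<in>F. fm_closed a a p" by auto
  obtain b where b: "fm_closed b b p" using fm_closed_ex by auto
  have "\<forall>q\<in>insert p F. fm_closed (max a b) (max a b) q"
    using a b by (auto intro: fm_closed_mono)
  then show ?case ..
qed auto

lemma fm_closed_AllN_pow: "fm_closed k m ((AllN ^^ n) p) = fm_closed (n + k) m p"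
  by (induction n arbitrary: k) auto

lemma fm_closed_AllS_pow: "fm_closed k m ((AllS ^^ n) p) = fm_closed k (n + m) p"
  by (induction n arbitrary: m) auto

lemma RCA0_closed: "p \<in> RCA0 \<Longrightarrow> fm_closed 0 0 p"
  by (auto simp: RCA0_def fm_closed_AllN_pow fm_closed_AllS_pow)

section \<open>Substitution, weakening and compactness for derivations\<close>

lemma fsub_instN: "fsub \<sigma> \<tau> (instN t p) = instN (tsub \<sigma> t) (fsub (upN \<sigma>) \<tau> p)"
proof -
  have "tsub \<sigma> \<circ> case_nat t Var = tsub (case_nat (tsub \<sigma> t) Var) \<circ> upN \<sigma>"
  proof
    fix i show "(tsub \<sigma> \<circ> case_nat t Var) i = (tsub (case_nat (tsub \<sigma> t) Var) \<circ> upN \<sigma>) i"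
      by (cases i) simp_all
  qed
  then show ?thesis by (simp add: instN_def fsub_fsub)
qed

lemma fsub_instS: "fsub \<sigma> \<tau> (instS X p) = instS (\<tau> X) (fsub \<sigma> (upS \<tau>) p)"
proof -
  have "\<tau> \<circ> case_nat X id = case_nat (\<tau> X) id \<circ> upS \<tau>"
  proof
    fix i show "(\<tau> \<circ> case_nat X id) i = (case_nat (\<tau> X) id \<circ> upS \<tau>) i"
      by (cases i) simp_all
  qed
  then show ?thesis by (simp add: instS_def fsub_fsub comp_def[of "tsub Var"] comp_def[of _ Var])
qed

lemma fsub_shiftN: "fsub (upN \<sigma>) \<tau> (shiftN p) = shiftN (fsub \<sigma> \<tau> p)"
  by (simp add: shiftN_def fsub_fsub comp_def tshift_def)

lemma fsub_shiftS: "fsub \<sigma> (upS \<tau>) (shiftS p) = shiftS (fsub \<sigma> \<tau> p)"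
  by (simp add: shiftS_def fsub_fsub comp_def)

lemma instN_fsub_upN: "instN t (fsub (upN \<sigma>) \<tau> p) = fsub (case_nat t \<sigma>) \<tau> p"
proof -
  have "tsub (case_nat t Var) \<circ> upN \<sigma> = case_nat t \<sigma>"
  proof
    fix i show "(tsub (case_nat t Var) \<circ> upN \<sigma>) i = case_nat t \<sigma> i" by (cases i) simp_all
  qed
  then show ?thesis by (simp add: instN_def fsub_fsub)
qed

lemma instS_fsub_upS: "instS X (fsub \<sigma> (upS \<tau>) p) = fsub \<sigma> (case_nat X \<tau>) p"
proof -
  have "case_nat X id \<circ> upS \<tau> = case_nat X \<tau>"
  proof
    fix i show "(case_nat X id \<circ> upS \<tau>) i = case_nat X \<tau> i" by (cases i) simp_all
  qed
  then show ?thesis by (simp add: instS_def fsub_fsub comp_def[of "tsub Var"])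
qed

lemma proves_mono: "\<Gamma> \<turnstile> p \<Longrightarrow> \<Gamma> \<subseteq> \<Delta> \<Longrightarrow> \<Delta> \<turnstile> p"
proof (induction arbitrary: \<Delta> rule: proves.induct)
  case (Assm p \<Gamma>)
  then show ?case by (auto intro: proves.Assm)
next
  case (ImpI p \<Gamma> q)
  show ?case by (rule proves.ImpI, rule ImpI.IH) (use ImpI.prems in auto)
next
  case (ImpE \<Gamma> p q)
  show ?case by (rule proves.ImpE[OF ImpE.IH(1)[OF ImpE.prems] ImpE.IH(2)[OF ImpE.prems]])
next
  case (Raa p \<Gamma>)
  show ?case by (rule proves.Raa, rule Raa.IH) (use Raa.prems in auto)
next
  case (AllNI \<Gamma> p)
  show ?case by (rule proves.AllNI, rule AllNI.IH) (use AllNI.prems in auto)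
next
  case (AllSI \<Gamma> p)
  show ?case by (rule proves.AllSI, rule AllSI.IH) (use AllSI.prems in auto)
next
  case (EqSubst \<Gamma> s t p)
  show ?case by (rule proves.EqSubst[OF EqSubst.IH(1)[OF EqSubst.prems] EqSubst.IH(2)[OF
      EqSubst.prems]])
qed (auto intro: proves.intros)

text \<open>The substitution is generalized in the induction because the quantifier rules push it
  under a binder. The purpose is to rename a fresh index into the eigenvariable of
  \<open>AllNI\<close> or \<open>AllSI\<close>.\<close>

lemma proves_fsub: "\<Gamma> \<turnstile> p \<Longrightarrow> fsub \<sigma> \<tau> ` \<Gamma> \<turnstile> fsub \<sigma> \<tau> p"
proof (induction arbitrary: \<sigma> \<tau> rule: proves.induct)
  case (Assm p \<Gamma>)
  then show ?case by (auto intro: proves.Assm)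
next
  case (ImpI p \<Gamma> q)
  show ?case using ImpI.IH[of \<sigma> \<tau>] by (auto intro: proves.ImpI)
next
  case (ImpE \<Gamma> p q)
  show ?case using ImpE.IH[of \<sigma> \<tau>] by (auto intro: proves.ImpE)
next
  case (Raa p \<Gamma>)
  show ?case using Raa.IH[of \<sigma> \<tau>] by (auto intro: proves.Raa)
next
  case (AllNI \<Gamma> p)
  have "fsub (upN \<sigma>) \<tau> ` shiftN ` \<Gamma> = shiftN ` fsub \<sigma> \<tau> ` \<Gamma>"
    by (simp add: image_image fsub_shiftN)
  then show ?case using AllNI.IH[of "upN \<sigma>" \<tau>] by (auto intro: proves.AllNI)
next
  case (AllNE \<Gamma> p t)
  show ?case using AllNE.IH[of \<sigma> \<tau>] by (auto simp: fsub_instN intro: proves.AllNE)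
next
  case (AllSI \<Gamma> p)
  have "fsub \<sigma> (upS \<tau>) ` shiftS ` \<Gamma> = shiftS ` fsub \<sigma> \<tau> ` \<Gamma>"
    by (simp add: image_image fsub_shiftS)
  then show ?case using AllSI.IH[of \<sigma> "upS \<tau>"] by (auto intro: proves.AllSI)
next
  case (AllSE \<Gamma> p X)
  show ?case using AllSE.IH[of \<sigma> \<tau>] by (auto simp: fsub_instS intro: proves.AllSE)
next
  case (EqRefl \<Gamma> t)
  then show ?case by (auto intro: proves.EqRefl)
next
  case (EqSubst \<Gamma> s t p)
  show ?case using EqSubst.IH[of \<sigma> \<tau>] by (auto simp: fsub_instN intro: proves.EqSubst)
qed

text \<open>Derivations are finite. In the quantifier rules the finite set consists of shifted
  premises and has to be pulled back through the shift.\<close>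

lemma proves_compact: "\<Gamma> \<turnstile> p \<Longrightarrow> \<exists>\<Delta>. finite \<Delta> \<and> \<Delta> \<subseteq> \<Gamma> \<and> \<Delta> \<turnstile> p"
proof (induction rule: proves.induct)
  case (Assm p \<Gamma>)
  have "{p} \<turnstile> p" by (rule proves.Assm) simp
  with Assm show ?case by (intro exI[of _ "{p}"]) simp
next
  case (ImpI p \<Gamma> q)
  then obtain \<Delta> where \<Delta>: "finite \<Delta>" "\<Delta> \<subseteq> insert p \<Gamma>" "\<Delta> \<turnstile> q" by blast
  have "\<Delta> - {p} \<turnstile> Imp p q" by (rule proves.ImpI, rule proves_mono[OF \<Delta>(3)]) blast
  with \<Delta> show ?case by (intro exI[of _ "\<Delta> - {p}"]) blast
next
  case (ImpE \<Gamma> p q)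
  then obtain \<Delta> \<Delta>' where \<Delta>: "finite \<Delta>" "\<Delta> \<subseteq> \<Gamma>" "\<Delta> \<turnstile> Imp p q" "finite \<Delta>'" "\<Delta>' \<subseteq> \<Gamma>" "\<Delta>' \<turnstile> p" by blast
  have "\<Delta> \<union> \<Delta>' \<turnstile> q"
    by (rule proves.ImpE[OF proves_mono[OF \<Delta>(3)] proves_mono[OF \<Delta>(6)]]) blast+
  with \<Delta> show ?case by (intro exI[of _ "\<Delta> \<union> \<Delta>'"]) blast
next
  case (Raa p \<Gamma>)
  then obtain \<Delta> where \<Delta>: "finite \<Delta>" "\<Delta> \<subseteq> insert (Neg p) \<Gamma>" "\<Delta> \<turnstile> Falsum" by blast
  have "\<Delta> - {Neg p} \<turnstile> p" by (rule proves.Raa, rule proves_mono[OF \<Delta>(3)]) blast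
  with \<Delta> show ?case by (intro exI[of _ "\<Delta> - {Neg p}"]) blast
next
  case (AllNI \<Gamma> p)
  then obtain \<Delta> where \<Delta>: "finite \<Delta>" "\<Delta> \<subseteq> shiftN ` \<Gamma>" "\<Delta> \<turnstile> p" by blast
  then obtain \<Delta>' where "\<Delta>' \<subseteq> \<Gamma>" "finite \<Delta>'" "\<Delta> = shiftN ` \<Delta>'"
    by (meson finite_subset_image)
  with \<Delta> show ?case by (meson proves.AllNI)
next
  case (AllNE \<Gamma> p t)
  then show ?case by (meson proves.AllNE)
next
  case (AllSI \<Gamma> p)
  then obtain \<Delta> where \<Delta>: "finite \<Delta>" "\<Delta> \<subseteq> shiftS ` \<Gamma>" "\<Delta> \<turnstile> p" by blast
  then obtain \<Delta>' where "\<Delta>' \<subseteq> \<Gamma>" "finite \<Delta>'" "\<Delta> = shiftS ` \<Delta>'"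
    by (meson finite_subset_image)
  with \<Delta> show ?case by (meson proves.AllSI)
next
  case (AllSE \<Gamma> p X)
  then show ?case by (meson proves.AllSE)
next
  case (EqRefl \<Gamma> t)
  show ?case by (meson proves.EqRefl finite.emptyI empty_subsetI)
next
  case (EqSubst \<Gamma> s t p)
  then obtain \<Delta> \<Delta>' where \<Delta>: "finite \<Delta>" "\<Delta> \<subseteq> \<Gamma>" "\<Delta> \<turnstile> Eq s t" "finite \<Delta>'" "\<Delta>' \<subseteq> \<Gamma>" "\<Delta>' \<turnstile> instN s p"
    by blast
  have "\<Delta> \<union> \<Delta>' \<turnstile> instN t p"
    by (rule proves.EqSubst[OF proves_mono[OF \<Delta>(3)] proves_mono[OF \<Delta>(6)]]) blast+
  with \<Delta> show ?case by (intro exI[of _ "\<Delta> \<union> \<Delta>'"]) blast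
qed

section \<open>The Henkin construction\<close>

instance tm :: countable by countable_datatype
instance fm :: countable by countable_datatype

abbreviation consistent :: "fm set \<Rightarrow> bool" where
  "consistent \<Gamma> \<equiv> \<not> \<Gamma> \<turnstile> Falsum"

text \<open>These are the closure conditions behind the term model: the quantifier equivalences
  contain the Henkin witnesses in contrapositive form, and the last clause makes equality in the
  theory a congruence.\<close>

definition complete_theory :: "fm set \<Rightarrow> bool" where
  "complete_theory G \<longleftrightarrow>
     Falsum \<notin> G \<and>
     (\<forall>p q. Imp p q \<in> G \<longleftrightarrow> (p \<in> G \<longrightarrow> q \<in> G)) \<and>
     (\<forall>p. AllN p \<in> G \<longleftrightarrow> (\<forall>t. instN t p \<in> G)) \<and>
     (\<forall>p. AllS p \<in> G \<longleftrightarrow> (\<forall>X. instS X p \<in> G)) \<and>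
     (\<forall>t. Eq t t \<in> G) \<and>
     (\<forall>s t p. Eq s t \<in> G \<longrightarrow> instN s p \<in> G \<longrightarrow> instN t p \<in> G)"

lemma proves_insert: "\<Gamma> \<turnstile> p \<Longrightarrow> insert q \<Gamma> \<turnstile> p"
  by (erule proves_mono) auto

lemma proves_cut: "insert p \<Gamma> \<turnstile> q \<Longrightarrow> \<Gamma> \<turnstile> p \<Longrightarrow> \<Gamma> \<turnstile> q"
  using ImpE[OF ImpI] by blast

text \<open>The renaming \<open>?r\<close> sends the fresh index \<open>k\<close> to 0 and shifts
  all others: it acts as \<open>shiftN\<close> on the premises and turns
  \<open>instN (Var k) p\<close> back into \<open>p\<close>, as \<open>AllNI\<close>
  demands.\<close>

lemma AllN_fresh:
  assumes "\<Gamma> \<turnstile> instN (Var k) p" and fr: "\<forall>q\<in>\<Gamma>. fm_closed k m q" and p: "fm_closed (Suc k) m p"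
  shows "\<Gamma> \<turnstile> AllN p"
proof -
  let ?r = "\<lambda>i. if i = k then Var 0 else Var (Suc i)"
  have "fsub ?r id ` \<Gamma> \<turnstile> fsub ?r id (instN (Var k) p)"
    using assms(1) by (rule proves_fsub)
  moreover have "fsub ?r id q = shiftN q" if "q \<in> \<Gamma>" for q
    unfolding shiftN_def by (rule fsub_closed[OF fr[rule_format, OF that]]) auto
  then have "fsub ?r id ` \<Gamma> = shiftN ` \<Gamma>" by auto
  moreover have "fsub ?r id (instN (Var k) p) = fsub Var id p"
    unfolding instN_def fsub_fsub by (rule fsub_closed[OF p]) (auto split: nat.split)
  ultimately show ?thesis by (simp add: AllNI)
qed

lemma AllS_fresh:
  assumes "\<Gamma> \<turnstile> instS k p" and fr: "\<forall>q\<in>\<Gamma>. fm_closed n k q" and p: "fm_closed n (Suc k) p"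
  shows "\<Gamma> \<turnstile> AllS p"
proof -
  let ?r = "\<lambda>i. if i = k then 0 else Suc i"
  have "fsub Var ?r ` \<Gamma> \<turnstile> fsub Var ?r (instS k p)"
    using assms(1) by (rule proves_fsub)
  moreover have "fsub Var ?r q = shiftS q" if "q \<in> \<Gamma>" for q
    unfolding shiftS_def by (rule fsub_closed[OF fr[rule_format, OF that]]) auto
  then have "fsub Var ?r ` \<Gamma> = shiftS ` \<Gamma>" by auto
  moreover have "fsub Var ?r (instS k p) = fsub Var id p"
    unfolding instS_def fsub_fsub by (rule fsub_closed[OF p]) (auto split: nat.split)
  ultimately show ?thesis by (simp add: AllSI)
qed

text \<open>\<open>R\<close> may be infinite but consists of sentences, so the finite set
  \<open>F\<close> leaves an index \<open>k\<close> free. With that index a counterexample to a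
  refuted universal formula can be named without losing consistency.\<close>

lemma henkin_step:
  assumes R: "\<forall>q\<in>R. fm_closed 0 0 q" and F: "finite F" "consistent (R \<union> F)"
  shows "\<exists>F'. finite F' \<and> consistent (R \<union> F') \<and> F \<subseteq> F' \<and>
    (consistent (R \<union> insert p F) \<longrightarrow> p \<in> F') \<and>
    (\<forall>q. p = Neg (AllN q) \<longrightarrow> p \<in> F' \<longrightarrow> (\<exists>t. Neg (instN t q) \<in> F')) \<and>
    (\<forall>q. p = Neg (AllS q) \<longrightarrow> p \<in> F' \<longrightarrow> (\<exists>X. Neg (instS X q) \<in> F'))"
proof (cases "consistent (R \<union> insert p F)")
  case False
  then have "p \<notin> F" using F(2) by (auto simp: insert_absorb)
  with False F show ?thesis by (intro exI[of _ F]) auto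
next
  case True
  obtain k where k: "\<forall>q\<in>insert p F. fm_closed k k q"
    using fm_closed_finite[of "insert p F"] F by auto
  have k': "\<forall>q\<in>R \<union> insert p F. fm_closed k k q"
    using k R fm_closed_mono[of 0 0 _ k k] by blast
  consider (N) q where "p = Neg (AllN q)" | (S) q where "p = Neg (AllS q)"
    | (O) "\<nexists>q. p = Neg (AllN q)" "\<nexists>q. p = Neg (AllS q)" by blast
  then show ?thesis
  proof cases
    case N
    have q: "fm_closed (Suc k) k q" using k by (simp add: N)
    have "consistent (R \<union> insert (Neg (instN (Var k) q)) (insert p F))"
    proof
      assume "R \<union> insert (Neg (instN (Var k) q)) (insert p F) \<turnstile> Falsum"
      then have "R \<union> insert p F \<turnstile> instN (Var k) q" by - (rule Raa, simp)
      then have "R \<union> insert p F \<turnstile> AllN q" by (rule AllN_fresh[OF _ k' q])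
      moreover have "R \<union> insert p F \<turnstile> Neg (AllN q)" by (rule Assm) (simp add: N)
      ultimately show False using True by (blast dest: ImpE)
    qed
    moreover have "\<exists>t. Neg (instN t q) \<in> insert (Neg (instN (Var k) q)) (insert p F)" by blast
    ultimately show ?thesis using F(1) N
      by (intro exI[of _ "insert (Neg (instN (Var k) q)) (insert p F)"]) auto
  next
    case S
    have q: "fm_closed k (Suc k) q" using k by (simp add: S)
    have "consistent (R \<union> insert (Neg (instS k q)) (insert p F))"
    proof
      assume "R \<union> insert (Neg (instS k q)) (insert p F) \<turnstile> Falsum"
      then have "R \<union> insert p F \<turnstile> instS k q" by - (rule Raa, simp)
      then have "R \<union> insert p F \<turnstile> AllS q" by (rule AllS_fresh[OF _ k' q])
      moreover have "R \<union> insert p F \<turnstile> Neg (AllS q)" by (rule Assm) (simp add: S)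
      ultimately show False using True by (blast dest: ImpE)
    qed
    moreover have "\<exists>X. Neg (instS X q) \<in> insert (Neg (instS k q)) (insert p F)" by blast
    ultimately show ?thesis using F(1) S
      by (intro exI[of _ "insert (Neg (instS k q)) (insert p F)"]) auto
  next
    case O
    with True F(1) show ?thesis by (intro exI[of _ "insert p F"]) auto
  qed
qed

text \<open>Every formula is treated at the stage numbered by its own code, and the union of the
  stages is consistent by compactness.\<close>

lemma henkin_extension:
  assumes R: "\<forall>q\<in>R. fm_closed 0 0 q" and F: "finite F" "consistent (R \<union> F)"
  shows "\<exists>G. R \<union> F \<subseteq> G \<and> complete_theory G"
proof -
  define P where "P n F' \<longleftrightarrow> finite F' \<and> consistent (R \<union> F') \<and> (n = 0 \<longrightarrow> F' = F)" for n :: nat and F'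
  define Q where "Q n F F' \<longleftrightarrow> F \<subseteq> F' \<and>
    (consistent (R \<union> insert (from_nat n) F) \<longrightarrow> from_nat n \<in> F') \<and>
    (\<forall>q. from_nat n = Neg (AllN q) \<longrightarrow> from_nat n \<in> F' \<longrightarrow> (\<exists>t. Neg (instN t q) \<in> F')) \<and>
    (\<forall>q. from_nat n = Neg (AllS q) \<longrightarrow> from_nat n \<in> F' \<longrightarrow> (\<exists>X. Neg (instS X q) \<in> F'))"
    for n and F F' :: "fm set"
  have "\<exists>f. \<forall>n. P n (f n) \<and> Q n (f n) (f (Suc n))"
  proof (rule dependent_nat_choice)
    show "\<exists>x. P 0 x" using F by (auto simp: P_def)
    fix F' n assume "P n F'"
    then show "\<exists>y. P (Suc n) y \<and> Q n F' y"
      using henkin_step[OF R, of F' "from_nat n"] unfolding P_def Q_def by blast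
  qed
  then obtain f where f: "\<And>n. P n (f n)" "\<And>n. Q n (f n) (f (Suc n))" by blast
  have con: "consistent (R \<union> f n)" and f0: "f 0 = F" for n
    using f(1) by (auto simp: P_def)
  have fS: "f n \<subseteq> f (Suc n)" for n
    using f(2) by (auto simp: Q_def)
  have fi: "from_nat n \<in> f (Suc n)" if "consistent (R \<union> insert (from_nat n) (f n))" for n
    using f(2)[of n] that by (simp add: Q_def)
  have fN: "\<exists>t. Neg (instN t q) \<in> f (Suc n)" if "from_nat n = Neg (AllN q)" "from_nat n \<in> f (Suc
      n)" for n q
    using f(2)[of n] that by (simp add: Q_def)
  have fX: "\<exists>X. Neg (instS X q) \<in> f (Suc n)" if "from_nat n = Neg (AllS q)" "from_nat n \<in> f (Suc
      n)" for n q
    using f(2)[of n] that by (simp add: Q_def)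
  have mono: "f i \<subseteq> f j" if "i \<le> j" for i j
    using lift_Suc_mono_le[of f, OF fS that] .
  define G where "G = R \<union> (\<Union>n. f n)"
  have fG: "R \<union> f n \<subseteq> G" for n by (auto simp: G_def)
  have sub: "\<exists>n. \<Delta> \<subseteq> R \<union> f n" if "finite \<Delta>" "\<Delta> \<subseteq> G" for \<Delta>
    using that
  proof (induction \<Delta> rule: finite_induct)
    case (insert p \<Delta>)
    then obtain n where n: "\<Delta> \<subseteq> R \<union> f n" by auto
    obtain m where m: "p \<in> R \<union> f m" using insert.prems by (auto simp: G_def)
    have "insert p \<Delta> \<subseteq> R \<union> f (max n m)"
      using n m mono[of n "max n m"] mono[of m "max n m"] by auto
    then show ?case ..
  qed auto
  have G_con: "consistent G"
  proof
    assume "G \<turnstile> Falsum"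
    then obtain \<Delta> where "finite \<Delta>" "\<Delta> \<subseteq> G" "\<Delta> \<turnstile> Falsum" using proves_compact by blast
    then show False using sub[of \<Delta>] con proves_mono[of \<Delta> Falsum] by blast
  qed
  have max: "p \<in> G" if "consistent (insert p G)" for p
  proof -
    \<comment> \<open>The stage numbered \<open>to_nat p\<close> is contained in \<open>G\<close>,
      so \<open>p\<close> is consistent with that stage too and was added there.\<close>
    have "consistent (R \<union> insert p (f (to_nat p)))"
      using that fG[of "to_nat p"] proves_mono[of "R \<union> insert p (f (to_nat p))" Falsum "insert p G"]
      by blast
    then have "p \<in> f (Suc (to_nat p))" using fi[of "to_nat p"] by simp
    then show ?thesis by (auto simp: G_def)
  qed
  have ded: "p \<in> G" if "G \<turnstile> p" for p
    using that max[of p] G_con proves_cut[of p G Falsum] by blast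
  have pr: "G \<turnstile> p \<longleftrightarrow> p \<in> G" for p using ded Assm by blast
  have neg: "p \<in> G \<or> Neg p \<in> G" for p
    using max[of p] ded[of "Neg p"] ImpI[of p G Falsum] by blast
  have imp: "Imp p q \<in> G \<longleftrightarrow> (p \<in> G \<longrightarrow> q \<in> G)" for p q
  proof
    show "Imp p q \<in> G \<Longrightarrow> p \<in> G \<longrightarrow> q \<in> G" using pr ImpE by blast
    assume "p \<in> G \<longrightarrow> q \<in> G"
    then consider "q \<in> G" | "Neg p \<in> G" using neg by blast
    then show "Imp p q \<in> G"
    proof cases
      case 1
      then have "insert p G \<turnstile> q" by (simp add: Assm)
      then show ?thesis by - (rule ded, rule ImpI)
    next
      case 2
      have "insert p G \<turnstile> Falsum" by (rule ImpE[of "insert p G" p Falsum]) (use 2 in \<open>simp_all add: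
          Assm\<close>)
      then have "insert (Neg q) (insert p G) \<turnstile> Falsum" by (rule proves_insert)
      then have "insert p G \<turnstile> q" by (rule Raa)
      then show ?thesis by - (rule ded, rule ImpI)
    qed
  qed
  have F0: "Falsum \<notin> G" using G_con Assm by blast
  have alln: "AllN p \<in> G \<longleftrightarrow> (\<forall>t. instN t p \<in> G)" for p
  proof
    show "AllN p \<in> G \<Longrightarrow> \<forall>t. instN t p \<in> G" using pr AllNE by blast
    assume a: "\<forall>t. instN t p \<in> G"
    show "AllN p \<in> G"
    proof (rule ccontr)
      assume "AllN p \<notin> G"
      then have "Neg (AllN p) \<in> G" using neg by blast
      \<comment> \<open>The negated universal formula was hence accepted at its own stage, and that
        stage also named a counterexample.\<close>
      then have "consistent (R \<union> insert (Neg (AllN p)) (f (to_nat (Neg (AllN p)))))"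
        using G_con fG[of "to_nat (Neg (AllN p))"]
          proves_mono[of "R \<union> insert (Neg (AllN p)) (f (to_nat (Neg (AllN p))))" Falsum G]
        by blast
      then obtain t where "Neg (instN t p) \<in> f (Suc (to_nat (Neg (AllN p))))"
        using fN[of "to_nat (Neg (AllN p))" p] fi[of "to_nat (Neg (AllN p))"] by auto
      then have "Neg (instN t p) \<in> G" unfolding G_def by blast
      with a imp F0 show False by blast
    qed
  qed
  have alls: "AllS p \<in> G \<longleftrightarrow> (\<forall>X. instS X p \<in> G)" for p
  proof
    show "AllS p \<in> G \<Longrightarrow> \<forall>X. instS X p \<in> G" using pr AllSE by blast
    assume a: "\<forall>X. instS X p \<in> G"
    show "AllS p \<in> G"
    proof (rule ccontr)
      assume "AllS p \<notin> G"
      then have "Neg (AllS p) \<in> G" using neg by blast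
      then have "consistent (R \<union> insert (Neg (AllS p)) (f (to_nat (Neg (AllS p)))))"
        using G_con fG[of "to_nat (Neg (AllS p))"]
          proves_mono[of "R \<union> insert (Neg (AllS p)) (f (to_nat (Neg (AllS p))))" Falsum G]
        by blast
      then obtain X where "Neg (instS X p) \<in> f (Suc (to_nat (Neg (AllS p))))"
        using fX[of "to_nat (Neg (AllS p))" p] fi[of "to_nat (Neg (AllS p))"] by auto
      then have "Neg (instS X p) \<in> G" unfolding G_def by blast
      with a imp F0 show False by blast
    qed
  qed
  have "complete_theory G"
    unfolding complete_theory_def
  proof (intro conjI allI impI)
    fix s t p assume "Eq s t \<in> G" "instN s p \<in> G"
    then show "instN t p \<in> G" using pr EqSubst by blast
  qed (use F0 imp alln alls ded[OF EqRefl] in \<open>simp_all\<close>)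
  moreover have "R \<union> F \<subseteq> G" using fG[of 0] f0 by simp
  ultimately show ?thesis by blast
qed

section \<open>Satisfaction\<close>

primrec teval :: "(nat \<Rightarrow> 'a::{zero,one,plus,times}) \<Rightarrow> tm \<Rightarrow> 'a" where
  "teval e (Var i) = e i"
| "teval e Zero = 0"
| "teval e One = 1"
| "teval e (Add s t) = teval e s + teval e t"
| "teval e (Mul s t) = teval e s * teval e t"

primrec sat :: "'a set set \<Rightarrow> (nat \<Rightarrow> 'a::{zero,one,plus,times,ord}) \<Rightarrow> (nat \<Rightarrow> 'a set) \<Rightarrow> fm \<Rightarrow> bool"
    where
  "sat S e A Falsum = False"
| "sat S e A (Eq s t) = (teval e s = teval e t)"
| "sat S e A (Less s t) = (teval e s < teval e t)"
| "sat S e A (Mem t X) = (teval e t \<in> A X)"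
| "sat S e A (Imp p q) = (sat S e A p \<longrightarrow> sat S e A q)"
| "sat S e A (AllN p) = (\<forall>v. sat S (case_nat v e) A p)"
| "sat S e A (AllS p) = (\<forall>B\<in>S. sat S e (case_nat B A) p)"

lemma teval_tsub: "teval e (tsub \<sigma> t) = teval (\<lambda>i. teval e (\<sigma> i)) t"
  by (induction t) auto

lemma teval_tshift [simp]: "teval (case_nat v e) (tshift t) = teval e t"
  by (simp add: tshift_def teval_tsub)

lemma sat_fsub: "sat S e A (fsub \<sigma> \<tau> p) = sat S (\<lambda>i. teval e (\<sigma> i)) (\<lambda>i. A (\<tau> i)) p"
proof (induction p arbitrary: e A \<sigma> \<tau>)
  case (AllN p)
  have "(\<lambda>i. teval (case_nat v e) (upN \<sigma> i)) = case_nat v (\<lambda>i. teval e (\<sigma> i))" for v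
  proof
    fix i show "teval (case_nat v e) (upN \<sigma> i) = case_nat v (\<lambda>i. teval e (\<sigma> i)) i"
      by (cases i) simp_all
  qed
  then show ?case by (simp add: AllN)
next
  case (AllS p)
  have "(\<lambda>i. (case_nat B A) (upS \<tau> i)) = case_nat B (\<lambda>i. A (\<tau> i))" for B
  proof
    fix i show "(case_nat B A) (upS \<tau> i) = case_nat B (\<lambda>i. A (\<tau> i)) i"
      by (cases i) simp_all
  qed
  then show ?case by (simp add: AllS)
qed (auto simp: teval_tsub)

lemma sat_instN: "sat S e A (instN t p) = sat S (case_nat (teval e t) e) A p"
proof -
  have "(\<lambda>i. teval e (case_nat t Var i)) = case_nat (teval e t) e"
    by (rule ext) (simp split: nat.split)
  then show ?thesis by (simp add: instN_def sat_fsub)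
qed

lemma sat_instS: "sat S e A (instS X p) = sat S e (case_nat (A X) A) p"
proof -
  have "(\<lambda>i. A (case_nat X id i)) = case_nat (A X) A"
    by (rule ext) (simp split: nat.split)
  then show ?thesis by (simp add: instS_def sat_fsub)
qed

lemma sat_shiftN [simp]: "sat S (case_nat v e) A (shiftN p) = sat S e A p"
  by (simp add: shiftN_def sat_fsub)

lemma sat_shiftS [simp]: "sat S e (case_nat B A) (shiftS p) = sat S e A p"
  by (simp add: shiftS_def sat_fsub)

text \<open>The range condition places the values of free set variables inside the family, which
  \<open>AllSE\<close> relies on.\<close>

lemma proves_sound:
  "\<Gamma> \<turnstile> p \<Longrightarrow> range A \<subseteq> S \<Longrightarrow> \<forall>q\<in>\<Gamma>. sat S e A q \<Longrightarrow> sat S e A p"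
proof (induction arbitrary: e A rule: proves.induct)
  case (AllSI \<Gamma> p)
  have "sat S e (case_nat B A) p" if "B \<in> S" for B
  proof (rule AllSI.IH)
    show "range (case_nat B A) \<subseteq> S" using that AllSI.prems(1) by (auto simp:
        image_subset_iff split: nat.split)
  qed (use AllSI.prems in auto)
  then show ?case by simp
next
  case (AllSE \<Gamma> p X)
  have "A X \<in> S" using AllSE.prems(1) by blast
  moreover have "sat S e A (AllS p)" using AllSE by blast
  ultimately show ?case by (simp add: sat_instS)
next
  case (EqSubst \<Gamma> s t p)
  then have "teval e s = teval e t" "sat S e A (instN s p)" by auto
  then show ?case by (simp add: sat_instN)
next
  case (Raa p \<Gamma>)
  show ?case
  proof (rule ccontr)
    assume "\<not> sat S e A p"
    then have "sat S e A Falsum" by (intro Raa.IH) (use Raa.prems in auto)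
    then show False by simp
  qed
qed (auto simp: sat_instN)

text \<open>The standard model serves to prove \<open>RCA0\<close> consistent, so that a complete
  extension exists even if \<open>goal\<close> is derivable.\<close>

lemma standard_model:
  assumes "p \<in> RCA0"
  shows "sat (UNIV :: nat set set) e A p"
proof -
  have *: "sat (UNIV :: nat set set) e A q" if "q \<in> rca0_open" for e A q
    using that
  proof (induction rule: rca0_open.induct)
    case (9 p)
    have "sat UNIV (case_nat v e) A p"
      if "sat UNIV (case_nat 0 e) A p"
        "\<And>v. sat UNIV (case_nat v e) A p \<Longrightarrow> sat UNIV (case_nat (v + 1) e) A p" for v
      by (induction v) (use that in auto)
    moreover have "(\<lambda>i. teval (case_nat v e) (case_nat (Add (Var 0) One) (\<lambda>i. Var (Suc i)) i)) =
        case_nat (v + 1) e" for v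
      by (rule ext) (simp split: nat.split)
    ultimately show ?case by (simp add: induction_axiom_def sat_instN sat_fsub)
  next
    case (10 p q)
    show ?case
      by (auto simp: comprehension_axiom_def intro!: exI[of _ "{v. sat UNIV (case_nat v e) A p}"])
  qed auto
  have N: "sat UNIV e A ((AllN ^^ n) q)" if "\<And>e. sat UNIV e A q" for n e and A ::
      "nat \<Rightarrow> nat set" and q
    using that by (induction n arbitrary: e) auto
  have S: "sat UNIV e A ((AllS ^^ n) q)" if "\<And>A. sat UNIV e A q" for n and e :: "nat \<Rightarrow> nat" and A q
    using that by (induction n arbitrary: A) auto
  obtain n m q where p: "p = (AllN ^^ n) ((AllS ^^ m) q)" and q: "q \<in> rca0_open"
    using assms by (auto simp: RCA0_def)
  show ?thesis unfolding p by (rule N, rule S, rule *[OF q])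
qed

lemma RCA0_consistent: "consistent RCA0"
proof
  assume "RCA0 \<turnstile> Falsum"
  from proves_sound[OF this, of "\<lambda>_. {}" UNIV "\<lambda>_. 0"] show False
    using standard_model by auto
qed

section \<open>The model\<close>

text \<open>Order, rings and fields are only available for types, so instead of considering an arbitrary
  model we fix a single term model: a countermodel to the theorem if the theorem were not provable.\<close>

definition goal :: fm where
  "goal = sentence
    (\<^bold>\<forall>\<^sub>S X D F.
       csm_space X D \<^bold>\<and> ultrametric X D \<^bold>\<and> spherically_complete X D \<^bold>\<and>
       continuous_code X D F \<^bold>\<and> total_function X D F \<^bold>\<and> strictly_contracting X D F \<^bold>\<longrightarrow>
       (\<^bold>\<exists>\<^sub>S x. fixed_point X D F x \<^bold>\<and> (\<^bold>\<forall>\<^sub>S y. fixed_point X D F y \<^bold>\<longrightarrow> point_eq D y x)))"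

text \<open>The choice is unconditional: if \<open>goal\<close> is derivable, any complete extension
  serves, and if not, one refuting \<open>goal\<close>.\<close>

definition theory_of_model :: "fm set" where
  "theory_of_model = (SOME G. RCA0 \<subseteq> G \<and> complete_theory G \<and> (RCA0 \<turnstile> goal \<or> Neg goal \<in> G))"

lemma theory_of_model:
  "RCA0 \<subseteq> theory_of_model" "complete_theory theory_of_model"
  "RCA0 \<turnstile> goal \<or> Neg goal \<in> theory_of_model"
proof -
  have "\<exists>G. RCA0 \<subseteq> G \<and> complete_theory G \<and> (RCA0 \<turnstile> goal \<or> Neg goal \<in> G)"
  proof (cases "RCA0 \<turnstile> goal")
    case True
    have "\<exists>G. RCA0 \<union> {} \<subseteq> G \<and> complete_theory G"
      by (rule henkin_extension) (use RCA0_closed RCA0_consistent in auto)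
    with True show ?thesis by auto
  next
    case False
    have "consistent (RCA0 \<union> {Neg goal})"
    proof
      assume "RCA0 \<union> {Neg goal} \<turnstile> Falsum"
      then have "RCA0 \<turnstile> goal" by - (rule Raa, simp)
      with False show False ..
    qed
    then have "\<exists>G. RCA0 \<union> {Neg goal} \<subseteq> G \<and> complete_theory G"
      by (intro henkin_extension) (use RCA0_closed in auto)
    then show ?thesis by auto
  qed
  from someI_ex[OF this]
  show "RCA0 \<subseteq> theory_of_model" "complete_theory theory_of_model"
    "RCA0 \<turnstile> goal \<or> Neg goal \<in> theory_of_model"
    unfolding theory_of_model_def by blast+
qed

lemma complete_theory_simps:
  assumes "complete_theory G"
  shows "Falsum \<notin> G" "Imp p q \<in> G \<longleftrightarrow> (p \<in> G \<longrightarrow> q \<in> G)" "AllN p \<in> G \<longleftrightarrow> (\<forall>t. instN t p \<in> G)"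
    "AllS p \<in> G \<longleftrightarrow> (\<forall>X. instS X p \<in> G)" "Eq t t \<in> G"
  using assms unfolding complete_theory_def by simp_all

lemmas tom_simps = complete_theory_simps[OF theory_of_model(2)]

lemma tom_subst: "Eq s t \<in> theory_of_model \<Longrightarrow> instN s p \<in> theory_of_model \<Longrightarrow>
    instN t p \<in> theory_of_model"
  using theory_of_model(2) unfolding complete_theory_def by blast

section \<open>The term model: a type of numbers and a family of sets\<close>

definition tm_eq :: "tm \<Rightarrow> tm \<Rightarrow> bool" where
  "tm_eq s t \<longleftrightarrow> Eq s t \<in> theory_of_model"

lemma tsub_inst_shift: "tsub (case_nat t Var) (tsub (\<lambda>i. Var (Suc i)) s) = s"
  by (simp add: tsub_tsub comp_def)

lemma tm_eq_sym: "tm_eq s t \<Longrightarrow> tm_eq t s"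
  unfolding tm_eq_def
  using tom_subst[of s t "Eq (Var 0) (tsub (\<lambda>i. Var (Suc i)) s)"] tom_simps(5)
  by (simp add: instN_def tsub_inst_shift)

lemma tm_eq_trans: "tm_eq s t \<Longrightarrow> tm_eq t u \<Longrightarrow> tm_eq s u"
  unfolding tm_eq_def
  using tom_subst[of t u "Eq (tsub (\<lambda>i. Var (Suc i)) s) (Var 0)"]
  by (simp add: instN_def tsub_inst_shift)

text \<open>One argument is replaced at a time: the formula given to \<open>tom_subst\<close> has
  \<open>Var 0\<close> in that place, and shifting protects the other terms from the
  instantiation.\<close>

lemma tm_eq_cong:
  assumes "tm_eq s s'" "tm_eq t t'"
  shows "tm_eq (Add s t) (Add s' t')" "tm_eq (Mul s t) (Mul s' t')"
    "Less s t \<in> theory_of_model \<Longrightarrow> Less s' t' \<in> theory_of_model"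
proof -
  let ?sh = "tsub (\<lambda>i. Var (Suc i))"
  show "tm_eq (Add s t) (Add s' t')"
    using tom_subst[of s s' "Eq (Add (?sh s) (?sh t)) (Add (Var 0) (?sh t))"]
      tom_subst[of t t' "Eq (Add (?sh s) (?sh t)) (Add (?sh s') (Var 0))"]
      assms tom_simps(5) by (simp add: instN_def tsub_inst_shift tm_eq_def)
  show "tm_eq (Mul s t) (Mul s' t')"
    using tom_subst[of s s' "Eq (Mul (?sh s) (?sh t)) (Mul (Var 0) (?sh t))"]
      tom_subst[of t t' "Eq (Mul (?sh s) (?sh t)) (Mul (?sh s') (Var 0))"]
      assms tom_simps(5) by (simp add: instN_def tsub_inst_shift tm_eq_def)
  show "Less s t \<in> theory_of_model \<Longrightarrow> Less s' t' \<in> theory_of_model"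
    using tom_subst[of s s' "Less (Var 0) (?sh t)"] tom_subst[of t t' "Less (?sh s') (Var 0)"]
      assms by (simp add: instN_def tsub_inst_shift tm_eq_def)
qed

lemma tm_eq_mem: "tm_eq s t \<Longrightarrow> Mem s X \<in> theory_of_model \<Longrightarrow> Mem t X \<in> theory_of_model"
  using tom_subst[of s t "Mem (Var 0) X"] by (simp add: instN_def tm_eq_def)

quotient_type mnat = tm / tm_eq
  by (rule equivpI)
    (auto simp: reflp_def symp_def transp_def intro: tm_eq_sym tm_eq_trans, simp add:
        tm_eq_def tom_simps)

instantiation mnat :: "{zero,one,plus,times,ord}"
begin
lift_definition zero_mnat :: mnat is Zero .
lift_definition one_mnat :: mnat is One .
lift_definition plus_mnat :: "mnat \<Rightarrow> mnat \<Rightarrow> mnat" is Add by (rule tm_eq_cong)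
lift_definition times_mnat :: "mnat \<Rightarrow> mnat \<Rightarrow> mnat" is Mul by (rule tm_eq_cong)
lift_definition less_mnat :: "mnat \<Rightarrow> mnat \<Rightarrow> bool" is "\<lambda>s t. Less s t \<in> theory_of_model"
  using tm_eq_cong(3) tm_eq_sym by blast
definition less_eq_mnat :: "mnat \<Rightarrow> mnat \<Rightarrow> bool" where "less_eq_mnat a b \<longleftrightarrow> a < b \<or> a = b"
instance ..
end

lift_definition set_of_var :: "nat \<Rightarrow> mnat \<Rightarrow> bool" is "\<lambda>X t. Mem t X \<in> theory_of_model"
  using tm_eq_mem tm_eq_sym by blast

definition set_var :: "nat \<Rightarrow> mnat set" where "set_var X = {v. set_of_var X v}"

definition sets :: "mnat set set" where "sets = range set_var"

lemma teval_abs_mnat: "teval (\<lambda>i. abs_mnat (\<sigma> i)) t = abs_mnat (tsub \<sigma> t)"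
  by (induction t) (simp_all add: zero_mnat.abs_eq one_mnat.abs_eq plus_mnat.abs_eq
      times_mnat.abs_eq)

lemma all_mnat: "(\<forall>v. P v) \<longleftrightarrow> (\<forall>t. P (abs_mnat t))"
  by (auto intro: mnat.abs_induct)

text \<open>Environments of the term model come from substitutions, so satisfaction is membership of
  the substituted formula. Allowing arbitrary substitutions lets the induction cross the
  quantifiers.\<close>

lemma truth_lemma:
  "sat sets (\<lambda>i. abs_mnat (\<sigma> i)) (\<lambda>i. set_var (\<tau> i)) p \<longleftrightarrow> fsub \<sigma> \<tau> p \<in> theory_of_model"
proof (induction p arbitrary: \<sigma> \<tau>)
  case (AllN p)
  have *: "case_nat (abs_mnat t) (\<lambda>i. abs_mnat (\<sigma> i)) = (\<lambda>i. abs_mnat (case_nat t \<sigma> i))" for t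
    by (rule ext) (simp split: nat.split)
  have "sat sets (\<lambda>i. abs_mnat (\<sigma> i)) (\<lambda>i. set_var (\<tau> i)) (AllN p) \<longleftrightarrow>
    (\<forall>t. sat sets (case_nat (abs_mnat t) (\<lambda>i. abs_mnat (\<sigma> i))) (\<lambda>i. set_var (\<tau> i)) p)"
    unfolding sat.simps by (rule all_mnat)
  also have "\<dots> \<longleftrightarrow> (\<forall>t. instN t (fsub (upN \<sigma>) \<tau> p) \<in> theory_of_model)"
    unfolding * AllN.IH by (simp add: instN_fsub_upN)
  finally show ?case by (simp add: tom_simps)
next
  case (AllS p)
  have *: "case_nat (set_var X) (\<lambda>i. set_var (\<tau> i)) = (\<lambda>i. set_var (case_nat X \<tau> i))" for X
    by (rule ext) (simp split: nat.split)
  have "sat sets (\<lambda>i. abs_mnat (\<sigma> i)) (\<lambda>i. set_var (\<tau> i)) (AllS p) \<longleftrightarrow>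
    (\<forall>X. sat sets (\<lambda>i. abs_mnat (\<sigma> i)) (case_nat (set_var X) (\<lambda>i. set_var (\<tau> i))) p)"
    by (auto simp: sets_def)
  also have "\<dots> \<longleftrightarrow> (\<forall>X. instS X (fsub \<sigma> (upS \<tau>) p) \<in> theory_of_model)"
    unfolding * AllS.IH by (simp add: instS_fsub_upS)
  finally show ?case by (simp add: tom_simps)
qed (simp_all add: teval_abs_mnat tom_simps mnat.abs_eq_iff tm_eq_def less_mnat.abs_eq set_var_def
      set_of_var.abs_eq)

lemma env_cases:
  obtains \<sigma> where "e = (\<lambda>i. abs_mnat (\<sigma> i))"
proof -
  have "\<exists>\<sigma>. \<forall>i. e i = abs_mnat (\<sigma> i)"
    by (rule choice) (auto intro: mnat.abs_induct)
  then show ?thesis using that by blast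
qed

lemma sets_env_cases:
  assumes "range A \<subseteq> sets"
  obtains \<tau> where "A = (\<lambda>i. set_var (\<tau> i))"
proof -
  have "\<exists>\<tau>. \<forall>i. A i = set_var (\<tau> i)"
    by (rule choice) (use assms in \<open>auto simp: sets_def\<close>)
  then show ?thesis using that by blast
qed

lemma sat_AllN_pow: "(\<And>e. sat S e A ((AllN ^^ n) q)) \<Longrightarrow> sat S e A q"
proof (induction n arbitrary: e)
  case (Suc n)
  have "sat S e A ((AllN ^^ n) q)" for e
  proof -
    have "sat S (case_nat (e 0) (\<lambda>i. e (Suc i))) A ((AllN ^^ n) q)"
      using Suc.prems by simp
    moreover have "case_nat (e 0) (\<lambda>i. e (Suc i)) = e" by (rule ext) (simp split: nat.split)
    ultimately show ?thesis by simp
  qed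
  then show ?case by (rule Suc.IH)
qed simp

lemma sat_AllS_pow:
  "(\<And>A. range A \<subseteq> S \<Longrightarrow> sat S e A ((AllS ^^ n) q)) \<Longrightarrow> range A \<subseteq> S \<Longrightarrow> sat S e A q"
proof (induction n arbitrary: A)
  case (Suc n)
  have "sat S e A ((AllS ^^ n) q)" if A: "range A \<subseteq> S" for A
  proof -
    have "range (\<lambda>i. A (Suc i)) \<subseteq> S" "A 0 \<in> S" using A by auto
    then have "sat S e (case_nat (A 0) (\<lambda>i. A (Suc i))) ((AllS ^^ n) q)"
      using Suc.prems(1)[of "\<lambda>i. A (Suc i)"] by simp
    moreover have "case_nat (A 0) (\<lambda>i. A (Suc i)) = A" by (rule ext) (simp split: nat.split)
    ultimately show ?thesis by simp
  qed
  then show ?case using Suc.IH Suc.prems(2) by blast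
qed simp

text \<open>\<open>RCA0\<close> contains universal closures. Stripping the quantifiers gives the
  open axioms under every environment, that is, with arbitrary elements and sets of the model as
  parameters.\<close>

lemma sat_RCA0:
  assumes p: "p \<in> rca0_open" and A: "range A \<subseteq> sets"
  shows "sat sets e A p"
proof -
  obtain k where k: "fm_closed k k p" using fm_closed_ex by blast
  have "sat sets e A ((AllN ^^ k) ((AllS ^^ k) p))" if A: "range A \<subseteq> sets" for e A
  proof -
    obtain \<sigma> \<tau> where \<sigma>: "e = (\<lambda>i. abs_mnat (\<sigma> i))" and \<tau>: "A = (\<lambda>i. set_var (\<tau> i))"
      using env_cases sets_env_cases[OF A] by metis
    have *: "(AllN ^^ k) ((AllS ^^ k) p) \<in> RCA0" using p k by (auto simp: RCA0_def)
    then have "fsub \<sigma> \<tau> ((AllN ^^ k) ((AllS ^^ k) p)) = fsub Var id ((AllN ^^ k) ((AllS ^^ k) p))"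
      by (intro fsub_closed[OF RCA0_closed]) auto
    then show ?thesis unfolding \<sigma> \<tau> truth_lemma using * theory_of_model(1) by auto
  qed
  then have "sat sets e A ((AllS ^^ k) p)" if "range A \<subseteq> sets" for e A
    using sat_AllN_pow that by blast
  then show ?thesis using sat_AllS_pow[OF _ A] by blast
qed

lemma range_set_var [simp]: "range set_var \<subseteq> sets"
  by (simp add: sets_def)

lemma sat_goal:
  assumes "\<And>e A. range A \<subseteq> sets \<Longrightarrow> sat sets e A goal"
  shows "RCA0 \<turnstile> goal"
  using theory_of_model(3) truth_lemma[of Var id "Neg goal"] assms[of set_var] by auto

section \<open>Arithmetic in the model\<close>

lemma bounded_fsub: "bounded p \<Longrightarrow> bounded (fsub \<sigma> \<tau> p)"
proof (induction arbitrary: \<sigma> \<tau> rule: bounded.induct)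
  case (6 p t)
  then show ?case by (simp add: tsub_upN_tshift bounded.intros)
next
  case (7 p t)
  then show ?case by (simp add: tsub_upN_tshift bounded.intros)
qed (auto intro: bounded.intros)

lemma bounded_shiftN: "bounded p \<Longrightarrow> bounded (shiftN p)"
  by (simp add: shiftN_def bounded_fsub)

text \<open>\<open>P\<close> is any HOL predicate with a defining formula that has the witness at
  index 0, the induction variable at index 1 and the parameters above.\<close>

lemma sigma_induct:
  assumes q: "bounded q" and P: "\<And>v. P v \<longleftrightarrow> (\<exists>w. sat sets (case_nat w (case_nat v e)) A q)"
    and A: "range A \<subseteq> sets"
    and 0: "P 0" and step: "\<And>v. P v \<Longrightarrow> P (v + 1)"
  shows "P (v :: mnat)"
proof -
  have "induction_axiom (ExN q) \<in> rca0_open"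
    using q by (intro rca0_open.intros) (auto simp: Sigma01_def)
  note ax = sat_RCA0[OF this A, of e]
  have *: "(\<lambda>i. teval (case_nat v e) (case_nat (Add (Var 0) One) (\<lambda>i. Var (Suc i)) i)) = case_nat
      (v + 1) e" for v
    by (rule ext) (simp split: nat.split)
  have "\<forall>v. sat sets (case_nat v e) A (ExN q)"
  proof -
    have "sat sets (case_nat 0 e) A (ExN q)" using 0 P[of 0] by simp
    moreover have "\<forall>v. sat sets (case_nat v e) A (ExN q) \<longrightarrow> sat sets (case_nat (v + 1) e) A (ExN q)"
      using step P by simp
    moreover have "sat sets e A (induction_axiom (ExN q)) \<longleftrightarrow>
      (sat sets (case_nat 0 e) A (ExN q) \<and>
        (\<forall>v. sat sets (case_nat v e) A (ExN q) \<longrightarrow> sat sets (case_nat (v + 1) e) A (ExN q)) \<longrightarrow>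
      (\<forall>v. sat sets (case_nat v e) A (ExN q)))"
      unfolding induction_axiom_def sat.simps sat_instN sat_fsub * teval.simps id_apply by blast
    ultimately show ?thesis using ax by blast
  qed
  then show ?thesis using P by simp
qed

text \<open>A bounded formula becomes \<open>Sigma01\<close> under a vacuous quantifier, whence the
  shift.\<close>

lemma bounded_induct:
  assumes q: "bounded q" and P: "\<And>v. P v \<longleftrightarrow> sat sets (case_nat v e) set_var q"
    and 0: "P 0" and step: "\<And>v. P v \<Longrightarrow> P (v + 1)"
  shows "P (v :: mnat)"
  using bounded_shiftN[OF q] _ range_set_var 0 step
  by (rule sigma_induct[where e=e]) (simp add: P)

section \<open>The axioms of arithmetic and the ordered semiring they yield\<close>

lemma mnat_Q1: "a + 1 \<noteq> (0::mnat)"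
  using sat_RCA0[OF rca0_open.intros(1) range_set_var, of "\<lambda>_. a"] by simp

lemma mnat_Q2: "a + 1 = b + 1 \<Longrightarrow> a = (b::mnat)"
  using sat_RCA0[OF rca0_open.intros(2) range_set_var, of "case_nat a (\<lambda>_. b)"] by simp

lemma mnat_Q3: "a + 0 = (a::mnat)"
  using sat_RCA0[OF rca0_open.intros(3) range_set_var, of "\<lambda>_. a"] by simp

lemma mnat_Q4: "a + (b + 1) = (a + b) + (1::mnat)"
  using sat_RCA0[OF rca0_open.intros(4) range_set_var, of "case_nat a (\<lambda>_. b)"] by simp

lemma mnat_Q5: "a * 0 = (0::mnat)"
  using sat_RCA0[OF rca0_open.intros(5) range_set_var, of "\<lambda>_. a"] by simp

lemma mnat_Q6: "a * (b + 1) = a * b + (a::mnat)"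
  using sat_RCA0[OF rca0_open.intros(6) range_set_var, of "case_nat a (\<lambda>_. b)"] by simp

lemma mnat_Q7: "\<not> a < (0::mnat)"
  using sat_RCA0[OF rca0_open.intros(7) range_set_var, of "\<lambda>_. a"] by simp

lemma mnat_Q8: "a < b + 1 \<longleftrightarrow> a < b \<or> a = (b::mnat)"
  using sat_RCA0[OF rca0_open.intros(8) range_set_var, of "case_nat a (\<lambda>_. b)"] by auto

lemma mnat_cases: "a = 0 \<or> (\<exists>b. a = b + (1::mnat))"
proof -
  have "\<exists>b. a = 0 \<or> a = b + 1"
    by (rule sigma_induct[of "Or (Eq (Var 1) Zero) (Eq (Var 1) (Add (Var 0) One))" _ "\<lambda>_. 0"
        set_var])
      (auto intro!: bounded.intros)
  then show ?thesis by blast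
qed

lemma mnat_add_0: "0 + a = (a::mnat)"
  by (rule bounded_induct[of "Eq (Add Zero (Var 0)) (Var 0)"
      "\<lambda>a::mnat. 0 + a = a" "\<lambda>_. 0"])
    (auto intro!: bounded.intros simp: mnat_Q3 mnat_Q4)

lemma mnat_add_1: "(a + 1) + b = (a + b) + (1::mnat)"
  by (rule bounded_induct[of "Eq (Add (Add (Var 1) One) (Var 0)) (Add (Add (Var 1) (Var 0)) One)"
      "\<lambda>b. (a + 1) + b = (a + b) + 1" "\<lambda>_. a"])
    (auto intro!: bounded.intros simp: mnat_Q3 mnat_Q4)

lemma mnat_add_commute: "a + b = b + (a::mnat)"
  by (rule bounded_induct[of "Eq (Add (Var 1) (Var 0)) (Add (Var 0) (Var 1))"
      "\<lambda>b. a + b = b + a" "\<lambda>_. a"])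
    (auto intro!: bounded.intros simp: mnat_Q3 mnat_Q4 mnat_add_0 mnat_add_1)

lemma mnat_add_assoc: "(a + b) + c = a + (b + (c::mnat))"
  by (rule bounded_induct[of "Eq (Add (Add (Var 1) (Var 2)) (Var 0)) (Add (Var 1) (Add (Var 2)
      (Var 0)))"
      "\<lambda>c. (a + b) + c = a + (b + c)" "case_nat a (\<lambda>_. b)"])
    (auto intro!: bounded.intros simp: mnat_Q3 mnat_Q4 numeral_2_eq_2)

lemma mnat_mult_0: "0 * a = (0::mnat)"
  by (rule bounded_induct[of "Eq (Mul Zero (Var 0)) Zero"
      "\<lambda>a. 0 * a = 0" "\<lambda>_. 0"])
    (auto intro!: bounded.intros simp: mnat_Q3 mnat_Q5 mnat_Q6)

lemma mnat_mult_1: "(a + 1) * b = a * b + (b::mnat)"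
proof (rule bounded_induct[of "Eq (Mul (Add (Var 1) One) (Var 0)) (Add (Mul (Var 1) (Var 0)) (Var
    0))"
      "\<lambda>b. (a + 1) * b = a * b + b" "\<lambda>_. a"])
  fix v assume "(a + 1) * v = a * v + v"
  then show "(a + 1) * (v + 1) = a * (v + 1) + (v + 1)"
    by (simp add: mnat_Q6 mnat_Q4) (metis mnat_add_assoc mnat_add_commute)
qed (auto intro!: bounded.intros simp: mnat_Q3 mnat_Q5)

lemma mnat_mult_commute: "a * b = b * (a::mnat)"
  by (rule bounded_induct[of "Eq (Mul (Var 1) (Var 0)) (Mul (Var 0) (Var 1))"
      "\<lambda>b. a * b = b * a" "\<lambda>_. a"])
    (auto intro!: bounded.intros simp: mnat_Q5 mnat_Q6 mnat_mult_0 mnat_mult_1)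

lemma mnat_distrib: "a * (b + c) = a * b + a * (c::mnat)"
proof (rule bounded_induct[of "Eq (Mul (Var 1) (Add (Var 2) (Var 0))) (Add (Mul (Var 1) (Var 2))
    (Mul (Var 1) (Var 0)))"
      "\<lambda>c. a * (b + c) = a * b + a * c" "case_nat a (\<lambda>_. b)"])
  fix v assume "a * (b + v) = a * b + a * v"
  then show "a * (b + (v + 1)) = a * b + a * (v + 1)"
    unfolding mnat_Q4 mnat_Q6 by (simp add: mnat_add_assoc)
qed (auto intro!: bounded.intros simp: mnat_Q3 mnat_Q5 numeral_2_eq_2)

lemma mnat_mult_assoc: "(a * b) * c = a * (b * (c::mnat))"
proof (rule bounded_induct[of "Eq (Mul (Mul (Var 1) (Var 2)) (Var 0)) (Mul (Var 1) (Mul (Var 2)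
    (Var 0)))"
      "\<lambda>c. (a * b) * c = a * (b * c)" "case_nat a (\<lambda>_. b)"])
  fix v assume "a * b * v = a * (b * v)"
  then show "a * b * (v + 1) = a * (b * (v + 1))"
    unfolding mnat_Q6[of "a * b"] mnat_Q6[of b] mnat_distrib[of a] by simp
qed (auto intro!: bounded.intros simp: mnat_Q5 numeral_2_eq_2)

text \<open>The axioms describe \<open><\<close> by recursion on its right argument. Expressing it
  by differences reduces the order laws to laws of addition.\<close>

lemma mnat_less_iff: "a < b \<longleftrightarrow> (\<exists>c. b = a + (c + (1::mnat)))"
proof
  \<comment> \<open>The quantifier stands in front of the implication to give the statement
    \<open>Sigma01\<close> form.\<close>
  have "\<exists>c. a < b \<longrightarrow> b = a + (c + 1)"
  proof (rule sigma_induct[of "Imp (Less (Var 2) (Var 1)) (Eq (Var 1) (Add (Var 2) (Add (Var 0)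
      One)))"
        "\<lambda>b. \<exists>c. a < b \<longrightarrow> b = a + (c + 1)" "\<lambda>_. a" set_var])
    fix v assume "\<exists>c. a < v \<longrightarrow> v = a + (c + 1)"
    then show "\<exists>c. a < v + 1 \<longrightarrow> v + 1 = a + (c + 1)"
      by (metis mnat_Q8 mnat_add_assoc mnat_add_0)
  qed (auto intro!: bounded.intros simp: mnat_Q7 numeral_2_eq_2)
  then show "a < b \<Longrightarrow> \<exists>c. b = a + (c + 1)" by blast
  have "a < a + (c + 1)" for c
    by (rule bounded_induct[of "Less (Var 1) (Add (Var 1) (Add (Var 0) One))"
      "\<lambda>c. a < a + (c + 1)" "\<lambda>_. a"])
      (auto intro!: bounded.intros simp: mnat_add_0 mnat_Q4 mnat_Q8 mnat_Q3)
  then show "\<exists>c. b = a + (c + 1) \<Longrightarrow> a < b" by blast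
qed

lemma mnat_le_iff: "a \<le> b \<longleftrightarrow> (\<exists>c. b = a + (c::mnat))"
  unfolding less_eq_mnat_def mnat_less_iff using mnat_cases mnat_Q3 by metis

lemma mnat_add_cancel: "a + c = b + c \<Longrightarrow> a = (b::mnat)"
proof -
  have "a + c = b + c \<longrightarrow> a = b"
    by (rule bounded_induct[of "Imp (Eq (Add (Var 1) (Var 0)) (Add (Var 2) (Var 0))) (Eq (Var 1)
        (Var 2))"
      "\<lambda>c. a + c = b + c \<longrightarrow> a = b" "case_nat a (\<lambda>_. b)"])
      (auto intro!: bounded.intros simp: mnat_Q3 mnat_Q4 numeral_2_eq_2 dest: mnat_Q2)
  then show "a + c = b + c \<Longrightarrow> a = b" by blast
qed

lemma mnat_add_eq_0: "a + b = 0 \<Longrightarrow> a = (0::mnat) \<and> b = 0"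
  using mnat_cases[of b] mnat_Q1 mnat_Q4 mnat_Q3 by metis

lemma mnat_linear: "a \<le> b \<or> b \<le> (a::mnat)"
proof (rule bounded_induct[of "Or (Or (Less (Var 1) (Var 0)) (Eq (Var 1) (Var 0))) (Or (Less (Var
    0) (Var 1)) (Eq (Var 0) (Var 1)))"
      "\<lambda>b. a \<le> b \<or> b \<le> a" "\<lambda>_. a"])
  show "a \<le> 0 \<or> 0 \<le> a" by (metis mnat_le_iff mnat_add_0)
  fix v assume "a \<le> v \<or> v \<le> a"
  then consider c where "v = a + c" | c where "a = v + c" unfolding mnat_le_iff by blast
  then show "a \<le> v + 1 \<or> v + 1 \<le> a"
  proof cases
    case 1
    then show ?thesis unfolding mnat_le_iff by (metis mnat_add_assoc)
  next
    case 2
    then show ?thesis unfolding mnat_le_iff using mnat_cases[of c]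
      by (metis mnat_add_assoc mnat_add_commute mnat_Q3)
  qed
qed (auto intro!: bounded.intros simp: less_eq_mnat_def)

lemma mnat_le_antisym: "a \<le> b \<Longrightarrow> b \<le> a \<Longrightarrow> a = (b::mnat)"
  unfolding mnat_le_iff
  by (metis mnat_add_assoc mnat_add_cancel mnat_add_commute mnat_add_eq_0 mnat_add_0)

lemma mnat_less_irrefl: "\<not> a < (a::mnat)"
proof
  assume "a < a"
  then obtain c where "a + 0 = a + (c + 1)" unfolding mnat_less_iff by (auto simp: mnat_Q3)
  then have "c + 1 = 0" using mnat_add_cancel[of "c + 1" a 0] by (simp add: mnat_add_commute[of a])
  then show False by (simp add: mnat_Q1)
qed

lemma mnat_less_le: "a < b \<longleftrightarrow> a \<le> b \<and> \<not> b \<le> (a::mnat)"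
  using mnat_le_antisym[of a b] mnat_less_irrefl[of a] by (auto simp: less_eq_mnat_def)

instantiation mnat :: linordered_semidom
begin

definition minus_mnat :: "mnat \<Rightarrow> mnat \<Rightarrow> mnat" where
  "minus_mnat a b = (if b \<le> a then THE c. a = b + c else 0)"

lemma mnat_add_minus: "(a + b) - a = (b::mnat)"
proof -
  have "a \<le> a + b" unfolding mnat_le_iff by blast
  moreover have "(THE c. a + b = a + c) = b"
  proof (rule the_equality)
    fix c assume "a + b = a + c"
    then show "c = b" using mnat_add_cancel[of c a b] by (simp add: mnat_add_commute[of _ a])
  qed simp
  ultimately show ?thesis by (simp add: minus_mnat_def)
qed

lemma mnat_minus_0: "\<not> b \<le> a \<Longrightarrow> a - b = (0::mnat)"
  by (simp add: minus_mnat_def)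

lemma mnat_mult_pos: "a \<noteq> 0 \<Longrightarrow> b \<noteq> 0 \<Longrightarrow> a * b \<noteq> (0::mnat)"
  using mnat_cases[of a] mnat_cases[of b] mnat_Q6 mnat_add_eq_0 mnat_Q1 by metis

instance
proof
  fix a b c :: mnat
  show "a + b + c = a + (b + c)" by (rule mnat_add_assoc)
  show "a + b = b + a" by (rule mnat_add_commute)
  show "0 + a = a" by (rule mnat_add_0)
  show "a * b * c = a * (b * c)" by (rule mnat_mult_assoc)
  show "a * b = b * a" by (rule mnat_mult_commute)
  show "1 * a = a" by (metis mnat_mult_1 mnat_add_0 mnat_mult_0)
  show "(a + b) * c = a * c + b * c" by (metis mnat_distrib mnat_mult_commute)
  show "a * (b + c) = a * b + a * c" by (rule mnat_distrib)
  show "0 * a = 0" by (rule mnat_mult_0)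
  show "(a * 0) = 0" by (rule mnat_Q5)
  show "(0::mnat) \<noteq> 1" by (metis mnat_Q1 mnat_add_0)
  show "a + b - a = b" by (rule mnat_add_minus)
  show "a - b - c = a - (b + c)"
  proof (cases "b + c \<le> a")
    case True
    then obtain d where "a = b + c + d" unfolding mnat_le_iff by blast
    then show ?thesis by (metis mnat_add_assoc mnat_add_minus)
  next
    case False
    have *: "\<not> c \<le> a - b" if "b \<le> a"
      using that False unfolding mnat_le_iff by (metis mnat_add_assoc mnat_add_minus)
    have "a - b - c = 0"
    proof (cases "b \<le> a")
      case True then show ?thesis using * by (simp add: mnat_minus_0)
    next
      case False
      then have "a - b = 0" by (rule mnat_minus_0)
      moreover have "0 - c = 0"
        by (metis mnat_add_0 mnat_add_minus mnat_le_iff mnat_minus_0 mnat_add_eq_0)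
      ultimately show ?thesis by simp
    qed
    then show ?thesis using False by (simp add: mnat_minus_0)
  qed
  show "a * (b - c) = a * b - a * c"
  proof (cases "c \<le> b")
    case True
    then show ?thesis unfolding mnat_le_iff by (metis mnat_distrib mnat_add_minus)
  next
    case False
    then obtain d where d: "c = b + d" using mnat_linear unfolding mnat_le_iff by blast
    have "a * b - a * c = 0"
    proof (cases "a * c \<le> a * b")
      case True
      then have "a * c = a * b"
        by (intro mnat_le_antisym) (auto simp: d mnat_distrib mnat_le_iff)
      then show ?thesis by (metis mnat_add_minus mnat_Q3)
    qed (rule mnat_minus_0)
    then show ?thesis using False by (simp add: mnat_minus_0 mnat_Q5)
  qed
  show "a \<noteq> 0 \<Longrightarrow> b \<noteq> 0 \<Longrightarrow> a * b \<noteq> 0" by (rule mnat_mult_pos)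
  show "(a < b) = (a \<le> b \<and> \<not> b \<le> a)" by (rule mnat_less_le)
  show "a \<le> a" by (simp add: less_eq_mnat_def)
  show "a \<le> b \<Longrightarrow> b \<le> c \<Longrightarrow> a \<le> c" unfolding mnat_le_iff by (metis mnat_add_assoc)
  show "a \<le> b \<Longrightarrow> b \<le> a \<Longrightarrow> a = b" by (rule mnat_le_antisym)
  show "a \<le> b \<or> b \<le> a" by (rule mnat_linear)
  show "a \<le> b \<Longrightarrow> c + a \<le> c + b" unfolding mnat_le_iff by (metis mnat_add_assoc)
  show "(0::mnat) < 1" by (metis mnat_less_iff mnat_add_0)
  show "b \<le> a \<Longrightarrow> a - b + b = a" unfolding mnat_le_iff by (metis mnat_add_minus mnat_add_commute)
  show "a < b \<Longrightarrow> 0 < c \<Longrightarrow> c * a < c * b"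
  proof -
    assume "a < b" "0 < c"
    then obtain d e where "b = a + (d + 1)" "c = 0 + (e + 1)" unfolding mnat_less_iff by blast
    then have "c * b = c * a + ((e * (d + 1) + d) + 1)"
      by (metis mnat_distrib mnat_mult_1 mnat_add_0 mnat_add_assoc)
    then show "c * a < c * b" unfolding mnat_less_iff by blast
  qed
qed

end

lemma mnat_zero_le [simp]: "0 \<le> (a::mnat)"
  by (metis mnat_le_iff mnat_add_0)

lemma mnat_less_add_1 [simp]: "a < b + 1 \<longleftrightarrow> a \<le> (b::mnat)"
  by (auto simp: mnat_Q8 less_eq_mnat_def)

lemma mnat_add_1_le: "a + 1 \<le> b \<longleftrightarrow> a < (b::mnat)"
  by (metis leD leI mnat_less_add_1)

lemma mnat_not_less_0 [simp]: "\<not> x < (0::mnat)"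
  by (rule mnat_Q7)

lemma mnat_pos_iff: "0 < x \<longleftrightarrow> x \<noteq> (0::mnat)"
  using mnat_zero_le[of x] by (auto simp: le_less)

lemma mnat_one_le: "1 \<le> x \<longleftrightarrow> 0 < (x::mnat)"
  using mnat_add_1_le[of 0 x] by simp

section \<open>Definability in the model\<close>

text \<open>Predicates of an environment \<open>e\<close> of numbers. Even indices of the environment of a formula hold
  the values of \<open>e\<close>, odd ones hold the values of the variables of the term model, so that every element
  of the model is available as a parameter.\<close>

definition mix :: "(nat \<Rightarrow> mnat) \<Rightarrow> nat \<Rightarrow> mnat" where
  "mix e i = (if even i then e (i div 2) else abs_mnat (Var (i div 2)))"

definition tmf :: "((nat \<Rightarrow> mnat) \<Rightarrow> mnat) \<Rightarrow> bool" where
  "tmf f \<longleftrightarrow> (\<exists>t. \<forall>e. f e = teval (mix e) t)"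

text \<open>Definability is kept semantic: closure under connectives, bounded quantifiers and
  substitution is proved once, and later predicates are shown definable by these rules without
  writing a formula.\<close>

definition d0 :: "((nat \<Rightarrow> mnat) \<Rightarrow> bool) \<Rightarrow> bool" where
  "d0 P \<longleftrightarrow> (\<exists>p. bounded p \<and> (\<forall>e. P e \<longleftrightarrow> sat sets (mix e) set_var p))"

definition sg :: "((nat \<Rightarrow> mnat) \<Rightarrow> bool) \<Rightarrow> bool" where
  "sg P \<longleftrightarrow> (\<exists>Q. d0 Q \<and> (\<forall>e. P e \<longleftrightarrow> (\<exists>y. Q (case_nat y e))))"

lemma tmf_var: "tmf (\<lambda>e. e i)"
  unfolding tmf_def by (rule exI[of _ "Var (2 * i)"]) (simp add: mix_def)

lemma tmf_const: "tmf (\<lambda>e. c)"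
proof -
  obtain t where t: "c = abs_mnat t" using mnat.abs_induct[of "\<lambda>v. \<exists>t. v = abs_mnat t" c] by blast
  have "teval (mix e) (tsub (\<lambda>i. Var (2 * i + 1)) t) = c" for e
    using teval_abs_mnat[of Var t] by (simp add: teval_tsub mix_def t)
  then show ?thesis unfolding tmf_def by metis
qed

lemma tmf_add: "tmf f \<Longrightarrow> tmf g \<Longrightarrow> tmf (\<lambda>e. f e + g e)"
  unfolding tmf_def by (metis teval.simps(4))

lemma tmf_mult: "tmf f \<Longrightarrow> tmf g \<Longrightarrow> tmf (\<lambda>e. f e * g e)"
  unfolding tmf_def by (metis teval.simps(5))

lemma d0_eq: "tmf f \<Longrightarrow> tmf g \<Longrightarrow> d0 (\<lambda>e. f e = g e)"
proof -
  assume "tmf f" "tmf g"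
  then obtain s t where "\<And>e. f e = teval (mix e) s" "\<And>e. g e = teval (mix e) t"
    unfolding tmf_def by blast
  then show ?thesis unfolding d0_def by (intro exI[of _ "Eq s t"]) (auto intro: bounded.intros)
qed

lemma d0_less: "tmf f \<Longrightarrow> tmf g \<Longrightarrow> d0 (\<lambda>e. f e < g e)"
proof -
  assume "tmf f" "tmf g"
  then obtain s t where "\<And>e. f e = teval (mix e) s" "\<And>e. g e = teval (mix e) t"
    unfolding tmf_def by blast
  then show ?thesis unfolding d0_def by (intro exI[of _ "Less s t"]) (auto intro: bounded.intros)
qed

lemma d0_mem: "tmf f \<Longrightarrow> A \<in> sets \<Longrightarrow> d0 (\<lambda>e. f e \<in> A)"
proof -
  assume "tmf f" "A \<in> sets"
  then obtain s X where "\<And>e. f e = teval (mix e) s" "A = set_var X"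
    unfolding tmf_def sets_def by blast
  then show ?thesis unfolding d0_def by (intro exI[of _ "Mem s X"]) (auto intro: bounded.intros)
qed

lemma d0_imp: "d0 P \<Longrightarrow> d0 Q \<Longrightarrow> d0 (\<lambda>e. P e \<longrightarrow> Q e)"
proof -
  assume "d0 P" "d0 Q"
  then obtain p q where "bounded p" "bounded q" "\<And>e. P e \<longleftrightarrow> sat sets (mix e) set_var p"
    "\<And>e. Q e \<longleftrightarrow> sat sets (mix e) set_var q"
    unfolding d0_def by blast
  then show ?thesis unfolding d0_def by (intro exI[of _ "Imp p q"]) (auto intro: bounded.intros)
qed

lemma d0_const: "d0 (\<lambda>e. b)"
proof (cases b)
  case True
  have "d0 (\<lambda>e. 0 = (0::mnat))" by (intro d0_eq tmf_const)
  with True show ?thesis by simp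
next
  case False
  then show ?thesis unfolding d0_def by (intro exI[of _ Falsum]) (auto intro: bounded.intros)
qed

lemma d0_not: "d0 P \<Longrightarrow> d0 (\<lambda>e. \<not> P e)"
  using d0_imp[of P "\<lambda>_. False"] d0_const[of False] by simp

lemma d0_conj: "d0 P \<Longrightarrow> d0 Q \<Longrightarrow> d0 (\<lambda>e. P e \<and> Q e)"
  using d0_not[OF d0_imp[of P "\<lambda>e. \<not> Q e"]] d0_not[of Q] by simp

lemma d0_disj: "d0 P \<Longrightarrow> d0 Q \<Longrightarrow> d0 (\<lambda>e. P e \<or> Q e)"
  using d0_imp[of "\<lambda>e. \<not> P e" Q] d0_not[of P] by (simp add: disj_imp)

lemma d0_le: "tmf f \<Longrightarrow> tmf g \<Longrightarrow> d0 (\<lambda>e. f e \<le> g e)"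
  unfolding less_eq_mnat_def by (intro d0_disj d0_less d0_eq)

lemma d0_ball:
  assumes "tmf t" and "d0 (\<lambda>e. P (e 0) (\<lambda>i. e (Suc i)))"
  shows "d0 (\<lambda>e. \<forall>y<t e. P y e)"
proof -
  obtain s p where s: "\<And>e. t e = teval (mix e) s" and p: "bounded p"
    "\<And>e. P (e 0) (\<lambda>i. e (Suc i)) \<longleftrightarrow> sat sets (mix e) set_var p"
    using assms unfolding tmf_def d0_def by blast
  \<comment> \<open>Binding a variable puts it at index 0 in front of the mixed environment, while
    extending \<open>e\<close> puts it at position 0 of the mixture and moves the old values of
    \<open>e\<close> up by two. \<open>?r\<close> translates the second layout into the
    first.\<close>
  let ?r = "\<lambda>i. if i = 0 then 0 else if even i then i - 1 else Suc i"
  have "(\<lambda>i. case_nat y (mix e) (?r i)) = mix (case_nat y e)" for y e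
  proof
    fix i show "case_nat y (mix e) (?r i) = mix (case_nat y e) i"
    proof (cases i)
      case (Suc j)
      show ?thesis
      proof (cases "even i")
        case True
        then obtain k where "i = 2 * k" by blast
        with Suc obtain l where "i = 2 * Suc l" by (cases k) auto
        then show ?thesis by (simp add: mix_def)
      next
        case False
        then show ?thesis by (simp add: mix_def Suc)
      qed
    qed (simp add: mix_def)
  qed
  then have *: "sat sets (case_nat y (mix e)) set_var (fsub (\<lambda>i. Var (?r i)) id p) \<longleftrightarrow> P y e" for y e
    using p(2)[of "case_nat y e"] by (simp add: sat_fsub)
  show ?thesis unfolding d0_def
  proof (intro exI conjI allI)
    show "bounded (AllN (Imp (Less (Var 0) (tshift s)) (fsub (\<lambda>i. Var (?r i)) id p)))"
      by (intro bounded.intros bounded_fsub p(1))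
    show "(\<forall>y<t e. P y e) \<longleftrightarrow>
      sat sets (mix e) set_var (AllN (Imp (Less (Var 0) (tshift s)) (fsub (\<lambda>i. Var (?r i)) id
          p)))" for e
      unfolding sat.simps * by (simp add: s)
  qed
qed

lemma d0_bex:
  assumes "tmf t" and "d0 (\<lambda>e. P (e 0) (\<lambda>i. e (Suc i)))"
  shows "d0 (\<lambda>e. \<exists>y<t e. P y e)"
  using d0_not[OF d0_ball[OF assms(1) d0_not[OF assms(2)]]] by simp

lemma d0_ball_le:
  assumes "tmf t" and "d0 (\<lambda>e. P (e 0) (\<lambda>i. e (Suc i)))"
  shows "d0 (\<lambda>e. \<forall>y\<le>t e. P y e)"
  using d0_ball[OF tmf_add[OF assms(1) tmf_const[of 1]] assms(2)] by simp

lemma d0_bex_le: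
  assumes "tmf t" and "d0 (\<lambda>e. P (e 0) (\<lambda>i. e (Suc i)))"
  shows "d0 (\<lambda>e. \<exists>y\<le>t e. P y e)"
  using d0_bex[OF tmf_add[OF assms(1) tmf_const[of 1]] assms(2)] by simp

lemma tmf_subst:
  assumes "tmf g" "\<And>i. tmf (f i)"
  shows "tmf (\<lambda>e. g (\<lambda>i. f i e))"
proof -
  obtain t where t: "\<And>e. g e = teval (mix e) t" using assms unfolding tmf_def by blast
  have "\<exists>u. \<forall>i e. f i e = teval (mix e) (u i)" using assms(2) unfolding tmf_def by (intro choice)
      blast
  then obtain u where u: "\<And>i e. f i e = teval (mix e) (u i)" by blast
  have "(\<lambda>i. teval (mix e) (if even i then u (i div 2) else Var i)) = mix (\<lambda>i. f i e)" for e
    by (rule ext) (simp add: mix_def u)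
  then have "g (\<lambda>i. f i e) = teval (mix e) (tsub (\<lambda>i. if even i then u (i div 2) else Var i) t)"
      for e
    by (simp add: t teval_tsub)
  then show ?thesis unfolding tmf_def by blast
qed

lemma d0_subst:
  assumes "d0 P" "\<And>i. tmf (f i)"
  shows "d0 (\<lambda>e. P (\<lambda>i. f i e))"
proof -
  obtain p where p: "bounded p" "\<And>e. P e \<longleftrightarrow> sat sets (mix e) set_var p"
    using assms unfolding d0_def by blast
  have "\<exists>u. \<forall>i e. f i e = teval (mix e) (u i)" using assms(2) unfolding tmf_def by (intro choice)
      blast
  then obtain u where u: "\<And>i e. f i e = teval (mix e) (u i)" by blast
  have "(\<lambda>i. teval (mix e) (if even i then u (i div 2) else Var i)) = mix (\<lambda>i. f i e)" for e
    by (rule ext) (simp add: mix_def u)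
  then have "P (\<lambda>i. f i e) = sat sets (mix e) set_var (fsub (\<lambda>i. if even i then u (i div 2) else
      Var i) id p)" for e
    by (simp add: p(2) sat_fsub)
  then show ?thesis unfolding d0_def using bounded_fsub[OF p(1)] by blast
qed

lemma tmf_case_nat: "tmf f \<Longrightarrow> (\<And>j. tmf (\<lambda>e. g e j)) \<Longrightarrow> tmf (\<lambda>e. case_nat (f e) (g e) i)"
  by (cases i) auto

lemmas tmf_intros = tmf_var tmf_const tmf_add tmf_mult tmf_case_nat

lemma sgI: "d0 Q \<Longrightarrow> (\<And>e. P e \<longleftrightarrow> (\<exists>y. Q (case_nat y e))) \<Longrightarrow> sg P"
  unfolding sg_def by blast

lemma sg_d0: "d0 P \<Longrightarrow> sg P"
  by (rule sgI[of "\<lambda>e. P (\<lambda>i. e (Suc i))"]) (auto intro: d0_subst tmf_intros)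

lemma sg_subst:
  assumes "sg P" "\<And>i. tmf (f i)"
  shows "sg (\<lambda>e. P (\<lambda>i. f i e))"
proof -
  obtain Q where Q: "d0 Q" "\<And>e. P e \<longleftrightarrow> (\<exists>y. Q (case_nat y e))"
    using assms(1) unfolding sg_def by blast
  have f: "tmf (\<lambda>e. f j (\<lambda>i. e (Suc i)))" for j
    by (rule tmf_subst[OF assms(2)]) (rule tmf_var)
  show ?thesis
  proof (rule sgI)
    show "d0 (\<lambda>e. Q (case_nat (e 0) (\<lambda>j. f j (\<lambda>i. e (Suc i)))))"
      by (rule d0_subst[OF Q(1)]) (intro tmf_case_nat tmf_var f)
  qed (simp add: Q(2))
qed

lemma mnat_max_ex: "\<exists>w. y < w \<and> z < (w::mnat)"
  by (rule exI[of _ "max y z + 1"]) simp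

text \<open>Two number quantifiers merge into one common strict bound \<open>w\<close>, below which
  both witnesses are sought by bounded quantifiers.\<close>

lemma sg_ex:
  assumes "sg (\<lambda>e. P (e 0) (\<lambda>i. e (Suc i)))"
  shows "sg (\<lambda>e. \<exists>y. P y e)"
proof -
  obtain Q where Q: "d0 Q" "\<And>e. P (e 0) (\<lambda>i. e (Suc i)) \<longleftrightarrow> (\<exists>z. Q (case_nat z e))"
    using assms(1) unfolding sg_def by blast
  have P: "P y e \<longleftrightarrow> (\<exists>z. Q (case_nat z (case_nat y e)))" for y e
    using Q(2)[of "case_nat y e"] by simp
  show ?thesis
  proof (rule sgI)
    show "d0 (\<lambda>e. \<exists>y<e 0. \<exists>z<e 0. Q (case_nat z (case_nat y (\<lambda>i. e (Suc i)))))"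
      by (intro d0_bex tmf_var d0_subst[OF Q(1)] tmf_case_nat)
    fix e
    have "(\<exists>y z. Q (case_nat z (case_nat y e))) \<longleftrightarrow>
      (\<exists>w. \<exists>y<w. \<exists>z<w. Q (case_nat z (case_nat y e)))"
      using mnat_max_ex by metis
    then show "(\<exists>y. P y e) \<longleftrightarrow> (\<exists>w. \<exists>y<case_nat w e 0. \<exists>z<case_nat w e 0.
      Q (case_nat z (case_nat y (\<lambda>i. case_nat w e (Suc i)))))"
      by (simp add: P)
  qed
qed

lemma sg_conj:
  assumes "sg P" "sg Q" shows "sg (\<lambda>e. P e \<and> Q e)"
proof -
  obtain P' Q' where P: "d0 P'" "\<And>e. P e \<longleftrightarrow> (\<exists>y. P' (case_nat y e))"
    and Q: "d0 Q'" "\<And>e. Q e \<longleftrightarrow> (\<exists>y. Q' (case_nat y e))"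
    using assms unfolding sg_def by metis
  have "sg (\<lambda>e. \<exists>y z. P' (case_nat y e) \<and> Q' (case_nat z e))"
    by (intro sg_ex sg_d0 d0_conj d0_subst[OF P(1)] d0_subst[OF Q(1)] tmf_intros)
  then show ?thesis by (simp add: P Q)
qed

lemma sg_disj:
  assumes "sg P" "sg Q" shows "sg (\<lambda>e. P e \<or> Q e)"
proof -
  obtain P' Q' where P: "d0 P'" "\<And>e. P e \<longleftrightarrow> (\<exists>y. P' (case_nat y e))"
    and Q: "d0 Q'" "\<And>e. Q e \<longleftrightarrow> (\<exists>y. Q' (case_nat y e))"
    using assms unfolding sg_def by metis
  have "sg (\<lambda>e. \<exists>y. P' (case_nat y e) \<or> Q' (case_nat y e))"
    by (intro sg_ex sg_d0 d0_disj d0_subst[OF P(1)] d0_subst[OF Q(1)] tmf_intros)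
  then show ?thesis by (simp add: P Q ex_disj_distrib)
qed

lemma sg_imp:
  assumes "d0 P" "sg Q" shows "sg (\<lambda>e. P e \<longrightarrow> Q e)"
proof -
  have "sg (\<lambda>e. \<not> P e \<or> Q e)" by (intro sg_disj sg_d0 d0_not assms)
  then show ?thesis by (simp only: imp_conv_disj)
qed

lemma sg_formula:
  assumes "sg (\<lambda>e. P (e 0))"
  obtains p where "bounded p"
    "\<And>v. P v \<longleftrightarrow> (\<exists>w. sat sets (case_nat w (case_nat v (mix (\<lambda>_. 0)))) set_var p)"
proof -
  obtain Q where Q: "d0 Q" "\<And>e. P (e 0) \<longleftrightarrow> (\<exists>y. Q (case_nat y e))"
    using assms(1) unfolding sg_def by blast
  obtain q where q: "bounded q" "\<And>e. Q e \<longleftrightarrow> sat sets (mix e) set_var q"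
    using Q(1) unfolding d0_def by blast
  \<comment> \<open>In the mixture the witness and the argument sit at positions 0 and 2. Every
    other position holds a parameter or the padding value 0 and moves up by two.\<close>
  let ?r = "\<lambda>i. if i = 0 then 0 else if i = 2 then 1 else Suc (Suc i)"
  have "P v \<longleftrightarrow> (\<exists>w. sat sets (case_nat w (case_nat v (mix (\<lambda>_. 0)))) set_var (fsub (\<lambda>i. Var (?r i))
      id q))" for v
  proof -
    have "(\<lambda>i. case_nat w (case_nat v (mix (\<lambda>_. 0))) (?r i)) = mix (case_nat w (case_nat v (\<lambda>_.
        0)))" for w
    proof
      fix i show "case_nat w (case_nat v (mix (\<lambda>_. 0))) (?r i) = mix (case_nat w (case_nat v (\<lambda>_.
          0))) i"
      proof (cases "even i")
        case True
        then obtain k where "i = 2 * k" by blast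
        then show ?thesis
          by (cases k; cases "k - 1") (auto simp: mix_def split: nat.split)
      next
        case False
        then show ?thesis by (auto simp: mix_def)
      qed
    qed
    then show ?thesis using Q(2)[of "case_nat v (\<lambda>_. 0)"] by (simp add: sat_fsub q(2))
  qed
  with bounded_fsub[OF q(1)] that show thesis by blast
qed

section \<open>Induction, minimization, comprehension and collection\<close>

lemma sg_induct:
  assumes "sg (\<lambda>e. P (e 0))" "P 0" "\<And>v. P v \<Longrightarrow> P (v + 1)"
  shows "P v"
proof -
  obtain p where p: "bounded p"
    "\<And>v. P v \<longleftrightarrow> (\<exists>w. sat sets (case_nat w (case_nat v (mix (\<lambda>_. 0)))) set_var p)"
    using sg_formula[OF assms(1)] by blast
  from sigma_induct[where P=P, OF p range_set_var assms(2,3)]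
  show ?thesis by blast
qed

lemma d0_induct:
  "d0 (\<lambda>e. P (e 0)) \<Longrightarrow> P 0 \<Longrightarrow> (\<And>v. P v \<Longrightarrow> P (v + 1)) \<Longrightarrow> P v"
  using sg_induct[OF sg_d0] .

text \<open>Without a least element, bounded induction would exclude \<open>P\<close> below every
  \<open>u\<close>, hence everywhere.\<close>

lemma d0_least:
  assumes P: "d0 (\<lambda>e. P (e 0))" and v: "P v"
  shows "\<exists>u. P u \<and> (\<forall>w<u. \<not> P w)"
proof (rule ccontr)
  assume no: "\<not> ?thesis"
  have "\<forall>w<u. \<not> P w" for u
  proof (rule d0_induct[of "\<lambda>u. \<forall>w<u. \<not> P w"])
    show "d0 (\<lambda>e. \<forall>w<e 0. \<not> P w)"
      by (intro d0_ball d0_not tmf_var d0_subst[OF P, of "\<lambda>i e. e i"])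
  next
    fix u assume "\<forall>w<u. \<not> P w"
    with no have "\<not> P u" by blast
    with \<open>\<forall>w<u. \<not> P w\<close> show "\<forall>w<u + 1. \<not> P w" by (auto simp: le_less)
  qed (simp add: mnat_Q7)
  then show False using v by (metis mnat_less_add_1 order_refl)
qed

text \<open>Negating the \<open>Sigma01\<close> definition of the complement gives the
  \<open>Pi01\<close> definition that the axiom asks for.\<close>

lemma comprehension:
  assumes "sg (\<lambda>e. P (e 0))" "sg (\<lambda>e. \<not> P (e 0))"
  shows "{v. P v} \<in> sets"
proof -
  obtain p where p: "bounded p"
    "\<And>v. P v \<longleftrightarrow> (\<exists>w. sat sets (case_nat w (case_nat v (mix (\<lambda>_. 0)))) set_var p)"
    using sg_formula[OF assms(1)] by blast
  obtain q where q: "bounded q"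
    "\<And>v. \<not> P v \<longleftrightarrow> (\<exists>w. sat sets (case_nat w (case_nat v (mix (\<lambda>_. 0)))) set_var q)"
    using sg_formula[OF assms(2)] by blast
  have "comprehension_axiom (ExN p) (AllN (Neg q)) \<in> rca0_open"
    using p q by (intro rca0_open.intros) (auto simp: Sigma01_def Pi01_def intro!: bounded.intros)
  note ax = sat_RCA0[OF this range_set_var, of "mix (\<lambda>_. 0)"]
  have e1: "sat sets (case_nat v (mix (\<lambda>_. 0))) set_var (ExN p) \<longleftrightarrow> P v"
    and e2: "sat sets (case_nat v (mix (\<lambda>_. 0))) set_var (AllN (Neg q)) \<longleftrightarrow> P v" for v
    using p(2)[of v] q(2)[of v] unfolding sat.simps by blast+
  have ax': "sat sets (mix (\<lambda>_. 0)) set_var (ExS (AllN (Iff (Mem (Var 0) 0) (shiftS (ExN p)))))"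
  proof -
    have "sat sets (mix (\<lambda>_. 0)) set_var (AllN (Iff (ExN p) (AllN (Neg q))))"
      using e1 e2 by (simp del: sat.simps(6) add: sat.simps(6)[of _ _ _ "Neg (Imp _ _)"])
    with ax show ?thesis unfolding comprehension_axiom_def by (subst (asm) sat.simps(5)) blast
  qed
  have "\<exists>B\<in>sets. \<forall>v. v \<in> B \<longleftrightarrow> P v"
  proof (rule ccontr)
    assume no: "\<not> ?thesis"
    from ax' obtain B where "B \<in> sets" "\<And>v. v \<in> B \<longleftrightarrow>
        sat sets (case_nat v (mix (\<lambda>_. 0))) set_var (ExN p)"
      unfolding sat.simps sat_shiftS by auto
    then show False using e1 no by blast
  qed
  then obtain B where "B \<in> sets" "\<And>v. v \<in> B \<longleftrightarrow> P v" by blast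
  moreover from this have "B = {v. P v}" by blast
  ultimately show ?thesis by simp
qed

lemma d0_set: "d0 (\<lambda>e. P (e 0)) \<Longrightarrow> {v. P v} \<in> sets"
  by (intro comprehension sg_d0 d0_not)

lemma sg_subst2: "sg (\<lambda>e. P (e 0) (e 1)) \<Longrightarrow> tmf t \<Longrightarrow> tmf u \<Longrightarrow> sg (\<lambda>e. P (t e) (u e))"
  using sg_subst[of "\<lambda>e. P (e 0) (e 1)" "\<lambda>i. if i = 0 then t else u"] by simp

lemma sg_subst1: "sg (\<lambda>e. P (e 0)) \<Longrightarrow> tmf t \<Longrightarrow> sg (\<lambda>e. P (t e))"
  using sg_subst[of "\<lambda>e. P (e 0)" "\<lambda>i. t"] by simp

lemma sg_subst3:
  "sg (\<lambda>e. P (e 0) (e 1) (e 2)) \<Longrightarrow> tmf t \<Longrightarrow> tmf u \<Longrightarrow> tmf v \<Longrightarrow> sg (\<lambda>e. P (t e) (u e) (v e))"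
  using sg_subst[of "\<lambda>e. P (e 0) (e 1) (e 2)" "\<lambda>i. if i = 0 then t else if i = 1 then u else v"]
      by simp

lemma d0_subst2: "d0 (\<lambda>e. P (e 0) (e 1)) \<Longrightarrow> tmf t \<Longrightarrow> tmf u \<Longrightarrow> d0 (\<lambda>e. P (t e) (u e))"
  using d0_subst[of "\<lambda>e. P (e 0) (e 1)" "\<lambda>i. if i = 0 then t else u"] by simp

lemma d0_iff: "d0 P \<Longrightarrow> d0 Q \<Longrightarrow> d0 (\<lambda>e. P e \<longleftrightarrow> Q e)"
  unfolding iff_conv_conj_imp by (intro d0_conj d0_imp)

text \<open>Collection: that a common bound exists for all arguments below \<open>s\<close> is
  itself \<open>Sigma01\<close>, so induction on \<open>s\<close> applies. The guard
  \<open>s \<le> t\<close> confines the step to arguments where \<open>H\<close> provides a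
  witness.\<close>

lemma bounding:
  assumes Q: "d0 (\<lambda>e. Q (e 0) (e 1))" and H: "\<And>y. y < t \<Longrightarrow> \<exists>z. Q z y"
  shows "\<exists>w. \<forall>y<t. \<exists>z<w. Q z (y :: mnat)"
proof -
  have sub: "tmf f \<Longrightarrow> tmf g \<Longrightarrow> d0 (\<lambda>e. Q (f e) (g e))" for f g
    using d0_subst[OF Q, of "\<lambda>i. if i = 0 then f else g"] by simp
  have "t \<le> t \<longrightarrow> (\<exists>w. \<forall>y<t. \<exists>z<w. Q z y)"
  proof (rule sg_induct[of "\<lambda>s. s \<le> t \<longrightarrow> (\<exists>w. \<forall>y<s. \<exists>z<w. Q z y)"])
    show "sg (\<lambda>e. e 0 \<le> t \<longrightarrow> (\<exists>w. \<forall>y<e 0. \<exists>z<w. Q z y))"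
      by (intro sg_imp d0_le sg_ex sg_d0 d0_ball d0_bex tmf_intros sub)
  next
    fix s assume IH: "s \<le> t \<longrightarrow> (\<exists>w. \<forall>y<s. \<exists>z<w. Q z y)"
    show "s + 1 \<le> t \<longrightarrow> (\<exists>w. \<forall>y<s + 1. \<exists>z<w. Q z y)"
    proof
      assume "s + 1 \<le> t"
      then have s: "s < t" by (simp add: mnat_add_1_le)
      then obtain w where w: "\<forall>y<s. \<exists>z<w. Q z y" using IH by auto
      obtain z where z: "Q z s" using H s by blast
      have "\<exists>x<max w (z + 1). Q x y" if "y < s + 1" for y
      proof (cases "y = s")
        case True
        have "z < max w (z + 1)" by (simp add: less_max_iff_disj)
        with z True show ?thesis by blast
      next
        case False
        with that have "y < s" by simp
        with w show ?thesis by (meson less_max_iff_disj)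
      qed
      then show "\<exists>w. \<forall>y<s + 1. \<exists>z<w. Q z y" by blast
    qed
  qed (simp add: mnat_not_less_0)
  then show ?thesis by simp
qed

text \<open>The bounded universal quantifier is absorbed into the matrix once collection has bounded
  all witnesses simultaneously.\<close>

lemma sg_ball:
  assumes "tmf t" and "sg (\<lambda>e. P (e 0) (\<lambda>i. e (Suc i)))"
  shows "sg (\<lambda>e. \<forall>y<t e. P y e)"
proof -
  obtain Q where Q: "d0 Q" "\<And>e. P (e 0) (\<lambda>i. e (Suc i)) \<longleftrightarrow> (\<exists>z. Q (case_nat z e))"
    using assms(2) unfolding sg_def by blast
  have P: "P y e \<longleftrightarrow> (\<exists>z. Q (case_nat z (case_nat y e)))" for y e
    using Q(2)[of "case_nat y e"] by simp
  have "sg (\<lambda>e. \<exists>w. \<forall>y<t e. \<exists>z<w. Q (case_nat z (case_nat y e)))"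
    by (intro sg_ex sg_d0 d0_ball d0_bex tmf_intros d0_subst[OF Q(1)] tmf_subst[OF assms(1)])
  moreover have "(\<forall>y<t e. P y e) \<longleftrightarrow> (\<exists>w. \<forall>y<t e. \<exists>z<w. Q (case_nat z (case_nat y e)))" for e
  proof
    assume "\<forall>y<t e. P y e"
    moreover have "d0 (\<lambda>e'. Q (case_nat (e' 0) (case_nat (e' 1) e)))"
      by (intro d0_subst[OF Q(1)] tmf_intros)
    ultimately show "\<exists>w. \<forall>y<t e. \<exists>z<w. Q (case_nat z (case_nat y e))"
      by (intro bounding) (auto simp: P)
  qed (auto simp: P)
  ultimately show ?thesis by simp
qed

lemmas d0_intros = d0_eq d0_less d0_le d0_mem d0_imp d0_const d0_not d0_conj d0_disj d0_iff
  d0_ball d0_bex d0_ball_le d0_bex_le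

section \<open>Pairing, coded functions and uniformization\<close>

definition pair :: "mnat \<Rightarrow> mnat \<Rightarrow> mnat" where
  "pair a b = (a + b) * (a + b) + a"

lemma tmf_pair: "tmf f \<Longrightarrow> tmf g \<Longrightarrow> tmf (\<lambda>e. pair (f e) (g e))"
  unfolding pair_def by (intro tmf_intros)

text \<open>A code lies between consecutive squares, (a+b)^2 \<le> \<open>pair a b\<close> <
  (a+b+1)^2, so it determines the sum, and with it both components.\<close>

lemma pair_less: "a + b < c + d \<Longrightarrow> pair a b < pair c d"
proof -
  assume *: "a + b < c + d"
  have "pair a b < (a + b + 1) * (a + b + 1)"
    \<comment> \<open>The gap to the next square is a + 2b + 1.\<close>
    unfolding mnat_less_iff by (rule exI[of _ "a + b + b"]) (simp add: pair_def algebra_simps)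
  also have "\<dots> \<le> (c + d) * (c + d)"
    using * by (intro mult_mono) (simp_all add: mnat_add_1_le)
  also have "\<dots> \<le> pair c d" by (simp add: pair_def)
  finally show ?thesis .
qed

lemma pair_inject [simp]: "pair a b = pair c d \<longleftrightarrow> a = c \<and> b = d"
proof
  assume *: "pair a b = pair c d"
  then have s: "a + b = c + d"
    using pair_less[of a b c d] pair_less[of c d a b] by (metis less_irrefl linorder_cases)
  then have "a = c" using * by (simp add: pair_def)
  with s show "a = c \<and> b = d" by simp
qed simp

lemma mnat_le_square: "x \<le> x * (x::mnat)"
proof (cases "x = 0")
  case False
  then have "1 \<le> x" by (simp add: mnat_one_le mnat_pos_iff)
  then show ?thesis using mult_left_mono[of 1 x x] by simp
qed simp

lemma pair_ge: "a \<le> pair a b" "b \<le> pair a b"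
proof -
  have "b \<le> a + b" by simp
  also have "\<dots> \<le> (a + b) * (a + b)" by (rule mnat_le_square)
  also have "\<dots> \<le> pair a b" by (simp add: pair_def)
  finally show "b \<le> pair a b" .
qed (simp add: pair_def)

definition cf :: "(mnat \<Rightarrow> mnat) \<Rightarrow> bool" where
  "cf f \<longleftrightarrow> {z. \<exists>a. z = pair a (f a)} \<in> sets"

text \<open>Function application is not a term of the language. A coded function enters a formula
  through an equation with its value, which is why later predicates name such values by an extra
  quantifier.\<close>

lemma d0_cf: "cf f \<Longrightarrow> tmf t \<Longrightarrow> tmf u \<Longrightarrow> d0 (\<lambda>e. f (t e) = u e)"
proof -
  assume "cf f" "tmf t" "tmf u"
  then have "d0 (\<lambda>e. pair (t e) (u e) \<in> {z. \<exists>a. z = pair a (f a)})"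
    by (intro d0_mem tmf_pair) (simp_all add: cf_def)
  then show ?thesis by (simp add: eq_commute)
qed

text \<open>A total function with a \<open>Sigma01\<close> graph is coded: a number outside the
  graph is no pair, or carries a value different from the computed one.\<close>

lemma sg_cf:
  assumes "sg (\<lambda>e. f (e 0) = e 1)"
  shows "cf f"
  unfolding cf_def
proof (rule comprehension)
  have "sg (\<lambda>e. \<exists>a b. e 0 = pair a b \<and> f a = b)"
    by (intro sg_ex sg_conj sg_d0 d0_eq tmf_pair tmf_var sg_subst2[OF assms])
  then show "sg (\<lambda>e. \<exists>a. e 0 = pair a (f a))" by simp
  have "sg (\<lambda>e. (\<forall>a\<le>e 0. \<forall>b\<le>e 0. e 0 \<noteq> pair a b) \<or>
      (\<exists>a b c. e 0 = pair a b \<and> f a = c \<and> b \<noteq> c))"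
    by (intro sg_disj sg_ex sg_conj sg_d0 d0_ball_le d0_not d0_eq tmf_pair tmf_var sg_subst2[OF
        assms])
  moreover have "(\<nexists>a. z = pair a (f a)) \<longleftrightarrow> (\<forall>a\<le>z. \<forall>b\<le>z. z \<noteq> pair a b) \<or>
      (\<exists>a b c. z = pair a b \<and> f a = c \<and> b \<noteq> c)" for z
  proof (cases "\<exists>a b. z = pair a b")
    case True
    then obtain a b where z: "z = pair a b" by blast
    have "\<not> (\<forall>a\<le>z. \<forall>b\<le>z. z \<noteq> pair a b)" using pair_ge z by blast
    then show ?thesis by (auto simp: z)
  qed auto
  ultimately show "sg (\<lambda>e. \<nexists>a. e 0 = pair a (f a))" by simp
qed

text \<open>The selected value is the one contained in the least code of a value together with a
  witness. Minimizing the value alone would in general leave \<open>Sigma01\<close>.\<close>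

lemma sg_uniform:
  assumes "sg (\<lambda>e. P (e 0) (e 1))"
  obtains P' where "sg (\<lambda>e. P' (e 0) (e 1))" "\<And>x y. P' x y \<Longrightarrow> P x y"
    "\<And>x y y'. P' x y \<Longrightarrow> P' x y' \<Longrightarrow> y = y'" "\<And>x y. P x y \<Longrightarrow> \<exists>y. P' x y"
proof -
  obtain Q0 where Q0: "d0 Q0" "\<And>e. P (e 0) (e 1) \<longleftrightarrow> (\<exists>w. Q0 (case_nat w e))"
    using assms unfolding sg_def by blast
  define Q where "Q w x y = Q0 (case_nat w (case_nat x (case_nat y (\<lambda>_. 0))))" for w x y
  have P: "P x y \<longleftrightarrow> (\<exists>w. Q w x y)" for x y
    using Q0(2)[of "case_nat x (case_nat y (\<lambda>_. 0))"] by (simp add: Q_def)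
  have Qd: "tmf f \<Longrightarrow> tmf g \<Longrightarrow> tmf h \<Longrightarrow> d0 (\<lambda>e. Q (f e) (g e) (h e))" for f g h
    unfolding Q_def by (intro d0_subst[OF Q0(1)] tmf_intros)
  define R where "R z x \<longleftrightarrow> (\<exists>y\<le>z. \<exists>w\<le>z. z = pair y w \<and> Q w x y)" for z x
  have "d0 (\<lambda>e. R (e 0) (e 1))"
    unfolding R_def by (intro d0_bex_le d0_conj d0_eq tmf_pair Qd tmf_var)
  note Rd = d0_subst2[OF this]
  have R: "R z x \<longleftrightarrow> (\<exists>y w. z = pair y w \<and> Q w x y)" for z x
    unfolding R_def using pair_ge by blast
  define P' where "P' x y \<longleftrightarrow> (\<exists>z w. z = pair y w \<and> Q w x y \<and> (\<forall>z'<z. \<not> R z' x))" for x y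
  show thesis
  proof (rule that[of P'])
    show "sg (\<lambda>e. P' (e 0) (e 1))"
      unfolding P'_def by (intro sg_ex sg_d0 d0_conj d0_eq d0_ball d0_not tmf_pair tmf_var Qd Rd)
    show "P x y" if "P' x y" for x y using that by (auto simp: P'_def P)
    show "y = y'" if "P' x y" "P' x y'" for x y y'
    proof -
      obtain w where w: "Q w x y" "\<forall>z'<pair y w. \<not> R z' x" using \<open>P' x y\<close> by (auto simp: P'_def)
      obtain w' where w': "Q w' x y'" "\<forall>z'<pair y' w'. \<not> R z' x" using \<open>P' x y'\<close> by (auto simp:
          P'_def)
      have "R (pair y w) x" "R (pair y' w') x" using w w' by (auto simp: R)
      then have "pair y w = pair y' w'" using w(2) w'(2) by (metis linorder_neqE)
      then show ?thesis by simp
    qed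
    show "\<exists>y. P' x y" if "P x y" for x y
    proof -
      obtain w where "Q w x y" using \<open>P x y\<close> by (auto simp: P)
      then have "R (pair y w) x" by (auto simp: R)
      then obtain z where "R z x" "\<forall>z'<z. \<not> R z' x"
        using d0_least[of "\<lambda>z. R z x", OF Rd[OF tmf_var tmf_const]] by blast
      then show ?thesis by (auto simp: R P'_def)
    qed
  qed
qed

lemma sg_choice:
  assumes "sg (\<lambda>e. P (e 0) (e 1))" "\<And>x. \<exists>y. P x y"
  obtains f where "cf f" "\<And>x. P x (f x)"
proof -
  obtain P' where P': "sg (\<lambda>e. P' (e 0) (e 1))" "\<And>x y. P' x y \<Longrightarrow> P x y"
    "\<And>x y y'. P' x y \<Longrightarrow> P' x y' \<Longrightarrow> y = y'" "\<And>x y. P x y \<Longrightarrow> \<exists>y. P' x y"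
    using sg_uniform[OF assms(1)] by blast
  have "\<exists>f. \<forall>x. P' x (f x)" using assms(2) P'(4) by (intro choice) blast
  then obtain f where f: "\<And>x. P' x (f x)" by blast
  then have "f x = y \<longleftrightarrow> P' x y" for x y using P'(3) by blast
  then have "cf f" using P'(1) by (intro sg_cf) simp
  then show thesis using that f P'(2) by blast
qed

section \<open>Binary codes of finite sets and primitive recursion\<close>

locale exponential =
  fixes ex :: "mnat \<Rightarrow> mnat"
  assumes cf_ex: "cf ex" and ex_0 [simp]: "ex 0 = 1" and ex_add_1 [simp]: "ex (n + 1) = ex n + ex n"
begin

lemma ex_gt: "n < ex n"
proof (rule sg_induct[of "\<lambda>n. n < ex n"])
  have "sg (\<lambda>e. \<exists>p. ex (e 0) = p \<and> e 0 < p)"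
    by (intro sg_ex sg_d0 d0_conj d0_less d0_cf[OF cf_ex] tmf_intros)
  then show "sg (\<lambda>e. e 0 < ex (e 0))" by simp
  fix n assume n: "n < ex n"
  then have "0 < ex n" by (rule order_le_less_trans[OF mnat_zero_le])
  then have "1 \<le> ex n" by (simp only: mnat_one_le)
  with n show "n + 1 < ex (n + 1)" by (simp only: ex_add_1) (rule add_less_le_mono)
qed simp

lemma ex_pos [simp]: "0 < ex n"
  using ex_gt[of n] by (rule order_le_less_trans[OF mnat_zero_le])

text \<open>The factor is kept even because adding an even multiple of \<open>ex i\<close> does not
  disturb the digit at position \<open>i\<close>.\<close>

lemma ex_multiple: "i < j \<Longrightarrow> \<exists>c. ex j = (c + c) * ex i"
proof -
  have "i < j \<longrightarrow> (\<exists>c. ex j = (c + c) * ex i)"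
  proof (rule sg_induct[of "\<lambda>j. i < j \<longrightarrow> (\<exists>c. ex j = (c + c) * ex i)"])
    show "sg (\<lambda>e. i < e 0 \<longrightarrow> (\<exists>c. ex (e 0) = (c + c) * ex i))"
      by (intro sg_imp sg_ex sg_d0 d0_less d0_cf[OF cf_ex] tmf_intros)
    fix j assume IH: "i < j \<longrightarrow> (\<exists>c. ex j = (c + c) * ex i)"
    show "i < j + 1 \<longrightarrow> (\<exists>c. ex (j + 1) = (c + c) * ex i)"
    proof
      assume "i < j + 1"
      then consider "i < j" | "i = j" by (auto simp: le_less)
      then show "\<exists>c. ex (j + 1) = (c + c) * ex i"
      proof cases
        case 1
        then obtain c where "ex j = (c + c) * ex i" using IH by blast
        then have "ex (j + 1) = ((c + c) + (c + c)) * ex i" by (simp only: ex_add_1 distrib_right)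
        then show ?thesis by blast
      next
        case 2
        then have "ex (j + 1) = (1 + 1) * ex i" by (simp only: ex_add_1 distrib_right mult_1)
        then show ?thesis by blast
      qed
    qed
  qed (simp add: mnat_not_less_0)
  then show "i < j \<Longrightarrow> \<exists>c. ex j = (c + c) * ex i" by blast
qed

lemma ex_mono: "i \<le> j \<Longrightarrow> ex i \<le> ex j"
proof (cases "i = j")
  case False
  assume "i \<le> j"
  with False have "i < j" by simp
  then obtain c where c: "ex j = (c + c) * ex i" using ex_multiple by blast
  then have "c + c \<noteq> 0" using ex_pos[of j] by (metis less_irrefl mult_zero_left)
  then have "1 \<le> c + c" by (simp only: mnat_one_le mnat_pos_iff not_False_eq_True)
  then show ?thesis unfolding c using mult_right_mono[of 1 "c + c" "ex i"] by simp
qed simp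

text \<open>\<open>x\<close> is an element of the finite set with code \<open>s\<close> if the binary digit of \<open>s\<close> at position \<open>x\<close> is 1.\<close>

definition elt :: "mnat \<Rightarrow> mnat \<Rightarrow> bool" where
  "elt x s \<longleftrightarrow> (\<exists>p\<le>s. ex x = p \<and> (\<exists>q\<le>s. \<exists>r<p. s = (q + q + 1) * p + r))"

lemma d0_elt: "tmf f \<Longrightarrow> tmf g \<Longrightarrow> d0 (\<lambda>e. elt (f e) (g e))"
proof (rule d0_subst2[of elt])
  show "d0 (\<lambda>e. elt (e 0) (e 1))"
    unfolding elt_def by (intro d0_bex_le d0_bex d0_conj d0_eq d0_cf[OF cf_ex] tmf_intros)
qed

lemma elt_iff: "elt x s \<longleftrightarrow> (\<exists>q r. r < ex x \<and> s = (q + q + 1) * ex x + r)"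
proof
  assume "\<exists>q r. r < ex x \<and> s = (q + q + 1) * ex x + r"
  then obtain q r where r: "r < ex x" and s: "s = (q + q + 1) * ex x + r" by blast
  have "1 \<le> ex x" by (simp only: mnat_one_le ex_pos)
  have "q * 1 \<le> q * ex x" by (rule mult_left_mono[OF \<open>1 \<le> ex x\<close>]) simp
  then have "ex x \<le> s" "q \<le> s"
    unfolding s by (simp_all add: algebra_simps add_increasing add_increasing2)
  then show "elt x s" unfolding elt_def using r s by blast
qed (auto simp: elt_def)

lemma elt_ex_le: "elt x s \<Longrightarrow> ex x \<le> s"
  by (auto simp: elt_def)

lemma elt_less: "elt x s \<Longrightarrow> x < s"
  using elt_ex_le ex_gt less_le_trans by blast

lemma elt_add_multiple:
  assumes "i < j" shows "elt i (s + ex j) \<longleftrightarrow> elt i s"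
proof -
  obtain c where c: "ex j = (c + c) * ex i" using ex_multiple[OF assms] by blast
  show ?thesis
  proof
    assume "elt i s"
    then obtain q r where "r < ex i" "s = (q + q + 1) * ex i + r" by (auto simp: elt_iff)
    then have "r < ex i" "s + ex j = ((q + c) + (q + c) + 1) * ex i + r"
      by (auto simp: c algebra_simps)
    then show "elt i (s + ex j)" unfolding elt_iff by blast
  next
    assume "elt i (s + ex j)"
    then obtain q r where r: "r < ex i" and q: "s + ex j = (q + q + 1) * ex i + r" by (auto simp:
        elt_iff)
    \<comment> \<open>Cancelling \<open>ex j\<close> replaces \<open>q\<close> by q - c, so
      \<open>c \<le> q\<close> has to be known. Otherwise \<open>ex j\<close> alone would exceed the
      sum.\<close>
    have "c \<le> q"
    proof (rule ccontr)
      assume "\<not> c \<le> q"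
      then have "q + 1 \<le> c" by (simp add: mnat_add_1_le)
      then have "((q + 1) + (q + 1)) * ex i \<le> (c + c) * ex i"
        by (intro mult_right_mono add_mono) simp_all
      also have "\<dots> \<le> s + ex j" by (simp add: c)
      also have "\<dots> < (q + q + 1) * ex i + ex i" using r by (simp add: q)
      also have "\<dots> = ((q + 1) + (q + 1)) * ex i" by (simp add: algebra_simps)
      finally show False by simp
    qed
    then obtain d where "q = c + d" by (auto simp: mnat_le_iff)
    then have "s + ex j = ((d + d + 1) * ex i + r) + ex j" using q by (simp add: c algebra_simps)
    then have "s = (d + d + 1) * ex i + r" by (simp only: add_right_cancel)
    then show "elt i s" unfolding elt_iff using r by blast
  qed
qed

text \<open>Induction on \<open>b\<close> decides the digit at position \<open>b\<close>. Keeping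
  \<open>s < ex b\<close> ensures that this digit is still 0 and that no higher one is set.\<close>

lemma set_code:
  assumes A: "A \<in> sets"
  shows "\<exists>s. \<forall>x. elt x s \<longleftrightarrow> x < b \<and> x \<in> A"
proof -
  have "\<exists>s p. ex b = p \<and> s < p \<and> (\<forall>x<b. elt x s \<longleftrightarrow> x \<in> A)"
  proof (rule sg_induct[of "\<lambda>b. \<exists>s p. ex b = p \<and> s < p \<and> (\<forall>x<b. elt x s \<longleftrightarrow> x \<in> A)"])
    show "sg (\<lambda>e. \<exists>s p. ex (e 0) = p \<and> s < p \<and> (\<forall>x<e 0. elt x s \<longleftrightarrow> x \<in> A))"
      by (intro sg_ex sg_d0 d0_conj d0_less d0_cf[OF cf_ex] d0_ball d0_iff d0_elt d0_mem[OF _ A]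
          tmf_intros)
    fix b assume "\<exists>s p. ex b = p \<and> s < p \<and> (\<forall>x<b. elt x s \<longleftrightarrow> x \<in> A)"
    then obtain s where s: "s < ex b" "\<And>x. x < b \<Longrightarrow> elt x s \<longleftrightarrow> x \<in> A" by blast
    show "\<exists>s p. ex (b + 1) = p \<and> s < p \<and> (\<forall>x<b + 1. elt x s \<longleftrightarrow> x \<in> A)"
    proof (cases "b \<in> A")
      case True
      have "elt b (s + ex b)" unfolding elt_iff
        by (intro exI[of _ 0] exI[of _ s]) (simp add: s add.commute)
      then have "\<forall>x<b + 1. elt x (s + ex b) \<longleftrightarrow> x \<in> A"
        using s True by (auto simp: le_less elt_add_multiple)
      moreover have "s + ex b < ex (b + 1)" using s(1) by simp
      ultimately show ?thesis by blast
    next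
      case False
      have "\<not> elt b s" using s(1) elt_ex_le[of b s] by auto
      then have "\<forall>x<b + 1. elt x s \<longleftrightarrow> x \<in> A"
        using s False by (auto simp: le_less)
      moreover have "s < ex (b + 1)" using s(1) by (simp add: add_strict_increasing)
      ultimately show ?thesis by blast
    qed
  qed (auto simp: mnat_not_less_0 intro!: exI[of _ 0])
  then obtain s where s: "s < ex b" "\<And>x. x < b \<Longrightarrow> elt x s \<longleftrightarrow> x \<in> A" by blast
  have "elt x s \<longleftrightarrow> x < b \<and> x \<in> A" for x
  proof (cases "x < b")
    case False
    then have "ex b \<le> ex x" by (intro ex_mono) simp
    then have "\<not> elt x s" using s(1) elt_ex_le[of x s] by auto
    with False show ?thesis by simp
  qed (simp add: s)
  then show ?thesis by blast
qed

lemma elt_adjoin: "\<exists>s'. \<forall>y. elt y s' \<longleftrightarrow> elt y s \<or> y = x"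
proof -
  have "{y. elt y s \<or> y = x} \<in> sets"
    by (intro d0_set d0_disj d0_elt d0_eq tmf_intros)
  then obtain s' where s': "\<And>y. elt y s' \<longleftrightarrow> y < s + x + 1 \<and> (elt y s \<or> y = x)"
    using set_code[of "{y. elt y s \<or> y = x}" "s + x + 1"] by auto
  have "y < s + x + 1" if "elt y s \<or> y = x" for y
    using that elt_less[of y s] by (auto simp: add_increasing2 less_imp_le)
  then show ?thesis using s' by blast
qed

lemma not_elt_0 [simp]: "\<not> elt x 0"
  using elt_less[of x 0] by (auto simp: mnat_not_less_0)

text \<open>\<open>N\<close> is made single-valued by uniformization. A computation is a finite set
  in which every pair except the initial one has a predecessor, and the \<open>n\<close>-th value is
  the one that some computation assigns to \<open>n\<close>. Powers of 2 turn these finite sets into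
  numbers, and the invariant \<open>V\<close> guarantees that a computation can be
  prolonged.\<close>

lemma recursion:
  assumes N: "sg (\<lambda>e. N (e 0) (e 1) (e 2))" and V: "sg (\<lambda>e. V (e 0))" and init: "V u0"
    and step: "\<And>n u. V u \<Longrightarrow> \<exists>v. N n u v" and inv: "\<And>n u v. V u \<Longrightarrow> N n u v \<Longrightarrow> V v"
  obtains f where "cf f" "f 0 = u0" "\<And>n. V (f n)" "\<And>n. N n (f n) (f (n + 1))"
proof -
  have "sg (\<lambda>e. \<exists>n u. e 0 = pair n u \<and> N n u (e 1))"
    by (intro sg_ex sg_conj sg_d0 d0_eq tmf_pair tmf_var sg_subst3[OF N])
  then obtain P where P: "sg (\<lambda>e. P (e 0) (e 1))" "\<And>x y. P x y \<Longrightarrow> \<exists>n u. x = pair n u \<and> N n u y"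
    "\<And>x y y'. P x y \<Longrightarrow> P x y' \<Longrightarrow> y = y'" "\<And>x y. \<exists>n u. x = pair n u \<and> N n u y \<Longrightarrow> \<exists>y. P x y"
    using sg_uniform[of "\<lambda>x y. \<exists>n u. x = pair n u \<and> N n u y"] by blast
  have PN: "N n u v" if "P (pair n u) v" for n u v using P(2)[OF that] by auto
  define valid where "valid s \<longleftrightarrow> (\<forall>z<s. elt z s \<longrightarrow> z = pair 0 u0 \<or>
    (\<exists>i u v. z = pair (i + 1) v \<and> elt (pair i u) s \<and> P (pair i u) v))" for s
  have "sg (\<lambda>e. valid (e 0))"
    unfolding valid_def
    by (intro sg_ball sg_imp sg_disj sg_ex sg_conj sg_d0 d0_elt d0_eq tmf_pair tmf_intros
        sg_subst2[OF P(1)])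
  note valid_sg = sg_subst1[OF this]
  have valid: "z = pair 0 u0 \<or> (\<exists>i u v. z = pair (i + 1) v \<and> elt (pair i u) s \<and> P (pair i u) v)"
    if "valid s" "elt z s" for z s
    using that elt_less[of z s] by (auto simp: valid_def)
  define T where "T n y \<longleftrightarrow> (\<exists>s. valid s \<and> elt (pair n y) s)" for n y
  have T_sg: "sg (\<lambda>e. T (e 0) (e 1))"
    unfolding T_def by (intro sg_ex sg_conj valid_sg sg_d0 d0_elt tmf_pair tmf_var)
  have T_ex: "\<exists>y. T n y \<and> V y" for n
  proof (rule sg_induct[of "\<lambda>n. \<exists>y. T n y \<and> V y"])
    show "sg (\<lambda>e. \<exists>y. T (e 0) y \<and> V y)"
      by (intro sg_ex sg_conj sg_subst2[OF T_sg] sg_subst1[OF V] tmf_var)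
    obtain s where "\<And>y. elt y s \<longleftrightarrow> y = pair 0 u0" using elt_adjoin[of 0 "pair 0 u0"] by auto
    then have "valid s" "elt (pair 0 u0) s" by (auto simp: valid_def)
    then show "\<exists>y. T 0 y \<and> V y" using init by (auto simp: T_def)
    fix n assume "\<exists>y. T n y \<and> V y"
    then obtain y s where y: "V y" and s: "valid s" "elt (pair n y) s" by (auto simp: T_def)
    obtain v where v: "P (pair n y) v" using step[OF y] P(4)[of "pair n y"] by auto
    obtain s' where s': "\<And>z. elt z s' \<longleftrightarrow> elt z s \<or> z = pair (n + 1) v"
      using elt_adjoin[of s "pair (n + 1) v"] by blast
    have "valid s'" unfolding valid_def
    proof (intro allI impI)
      fix z assume "elt z s'"
      then consider "elt z s" | "z = pair (n + 1) v" using s' by blast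
      then show "z = pair 0 u0 \<or> (\<exists>i u v. z = pair (i + 1) v \<and> elt (pair i u) s' \<and> P (pair i u) v)"
      proof cases
        case 1
        from valid[OF s(1) this] show ?thesis using s' by blast
      next
        case 2
        then show ?thesis using s(2) s' v by blast
      qed
    qed
    moreover have "elt (pair (n + 1) v) s'" using s' by blast
    moreover have "V v" using inv[OF y PN[OF v]] .
    ultimately show "\<exists>y. T (n + 1) y \<and> V y" by (auto simp: T_def)
  qed
  have T_unique: "y = y'" if "T n y" "T n y'" for n y y'
  proof -
    obtain s s' where s: "valid s" "elt (pair n y) s" and s': "valid s'" "elt (pair n y') s'"
      using \<open>T n y\<close> \<open>T n y'\<close> by (auto simp: T_def)
    have bd: "y \<le> s" if "elt (pair n y) s" for n y s
      using elt_less[OF that] pair_ge(2)[of y n] by (meson less_imp_le order_trans)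
    \<comment> \<open>The values are bounded by the codes \<open>s\<close> and \<open>s'\<close>, so
      agreement of the two computations is a bounded statement, although \<open>P\<close> itself is
      \<open>Sigma01\<close>.\<close>
    have "\<forall>y\<le>s. \<forall>y'\<le>s'. elt (pair n y) s \<and> elt (pair n y') s' \<longrightarrow> y = y'"
    proof (rule d0_induct[of "\<lambda>n. \<forall>y\<le>s. \<forall>y'\<le>s'. elt (pair n y) s \<and> elt (pair n y') s' \<longrightarrow> y = y'"])
      show "d0 (\<lambda>e. \<forall>y\<le>s. \<forall>y'\<le>s'. elt (pair (e 0) y) s \<and> elt (pair (e 0) y') s' \<longrightarrow> y = y')"
        by (intro d0_ball_le d0_imp d0_conj d0_elt d0_eq tmf_pair tmf_var tmf_const)
      show "\<forall>y\<le>s. \<forall>y'\<le>s'. elt (pair 0 y) s \<and> elt (pair 0 y') s' \<longrightarrow> y = y'"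
        using valid[OF s(1)] valid[OF s'(1)] mnat_Q1 by (metis pair_inject)
      fix n assume IH: "\<forall>y\<le>s. \<forall>y'\<le>s'. elt (pair n y) s \<and> elt (pair n y') s' \<longrightarrow> y = y'"
      have pred: "\<exists>u. elt (pair n u) s \<and> P (pair n u) y" if "valid s" "elt (pair (n + 1) y) s" for
          y s
        using valid[OF that] mnat_Q1[of n] by auto
      show "\<forall>y\<le>s. \<forall>y'\<le>s'. elt (pair (n + 1) y) s \<and> elt (pair (n + 1) y') s' \<longrightarrow> y = y'"
      proof (intro allI impI)
        fix y y' assume "elt (pair (n + 1) y) s \<and> elt (pair (n + 1) y') s'"
        then obtain u u' where "elt (pair n u) s" "P (pair n u) y" "elt (pair n u') s'" "P (pair n
            u') y'"
          using pred[OF s(1)] pred[OF s'(1)] by blast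
        then show "y = y'" using IH bd P(3) by metis
      qed
    qed
    then show ?thesis using s s' bd by blast
  qed
  have "\<exists>f. \<forall>n. T n (f n) \<and> V (f n)" using T_ex by (intro choice) blast
  then obtain f where f: "\<And>n. T n (f n)" "\<And>n. V (f n)" by blast
  have eq: "f n = y \<longleftrightarrow> T n y" for n y using f T_unique by blast
  have "cf f" using T_sg by (intro sg_cf) (simp add: eq)
  moreover have "f 0 = u0"
  proof -
    obtain s where "valid s" "elt (pair 0 (f 0)) s" using f(1)[of 0] by (auto simp: T_def)
    from valid[OF this] show ?thesis using mnat_Q1 by (metis pair_inject)
  qed
  moreover have "N n (f n) (f (n + 1))" for n
  proof -
    obtain s where s: "valid s" "elt (pair (n + 1) (f (n + 1))) s" using f(1)[of "n + 1"] by (auto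
        simp: T_def)
    obtain u where u: "elt (pair n u) s" "P (pair n u) (f (n + 1))"
      using valid[OF s] mnat_Q1[of n] by auto
    have "f n = u" unfolding eq T_def using s(1) u(1) by blast
    then show ?thesis using PN u(2) by blast
  qed
  ultimately show thesis using that f(2) by blast
qed

end

section \<open>Integers and rationals of the model\<close>

definition mintrel :: "mnat \<times> mnat \<Rightarrow> mnat \<times> mnat \<Rightarrow> bool" where
  "mintrel p q \<longleftrightarrow> fst p + snd q = fst q + snd p"

quotient_type mint = "mnat \<times> mnat" / mintrel
  morphisms Rep_mint Abs_mint
proof (rule equivpI)
  show "transp mintrel"
  proof (rule transpI)
    fix p q r assume "mintrel p q" "mintrel q r"
    then have "(fst p + snd r) + (fst q + snd q) = (fst r + snd p) + (fst q + snd q)"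
      unfolding mintrel_def by (metis add.assoc add.commute)
    then show "mintrel p r" by (simp add: mintrel_def)
  qed
qed (auto simp: mintrel_def reflp_def symp_def)

text \<open>One factor is changed at a time: \<open>1\<close> replaces a - b by c - d,
  \<open>2\<close> replaces x - y by u - v, and the intermediate product cancels.\<close>

lemma mint_mult_respects:
  fixes a b c d x y u v :: mnat
  assumes "a + d = c + b" "x + v = u + y"
  shows "a * x + b * y + (c * v + d * u) = c * u + d * v + (a * y + b * x)"
proof -
  have 1: "a * x + b * y + (c * y + d * x) = c * x + d * y + (a * y + b * x)"
  proof -
    have "(a + d) * x + (c + b) * y = (c + b) * x + (a + d) * y" using assms(1) by simp
    then show ?thesis by (simp add: algebra_simps)
  qed
  have 2: "c * x + d * y + (c * v + d * u) = c * u + d * v + (c * y + d * x)"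
  proof -
    have "c * (x + v) + d * (u + y) = c * (u + y) + d * (x + v)" using assms(2) by simp
    then show ?thesis by (simp add: algebra_simps)
  qed
  have "(a * x + b * y + (c * v + d * u)) + (c * x + d * y + (c * y + d * x)) =
    (c * u + d * v + (a * y + b * x)) + (c * x + d * y + (c * y + d * x))"
    using arg_cong2[where f = "(+)", OF 1 2] by (simp add: algebra_simps)
  then show ?thesis by (simp only: add_right_cancel)
qed

instantiation mint :: comm_ring_1
begin
lift_definition zero_mint :: mint is "(0, 0)" .
lift_definition one_mint :: mint is "(1, 0)" .
lift_definition plus_mint :: "mint \<Rightarrow> mint \<Rightarrow> mint" is "\<lambda>p q. (fst p + fst q, snd p + snd q)"
  by (auto simp: mintrel_def) (metis add.assoc add.commute)
lift_definition uminus_mint :: "mint \<Rightarrow> mint" is "\<lambda>p. (snd p, fst p)"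
  by (auto simp: mintrel_def add.commute)
definition minus_mint :: "mint \<Rightarrow> mint \<Rightarrow> mint" where "minus_mint a b = a + (- b)"
lift_definition times_mint :: "mint \<Rightarrow> mint \<Rightarrow> mint"
  is "\<lambda>p q. (fst p * fst q + snd p * snd q, fst p * snd q + snd p * fst q)"
  by (simp add: mintrel_def mint_mult_respects)
instance
proof
  fix a b c :: mint
  show "a * b * c = a * (b * c)" by transfer (simp add: mintrel_def algebra_simps)
  show "a * b = b * a" by transfer (simp add: mintrel_def algebra_simps)
  show "1 * a = a" by transfer (simp add: mintrel_def)
  show "a + b + c = a + (b + c)" by transfer (simp add: mintrel_def algebra_simps)
  show "a + b = b + a" by transfer (simp add: mintrel_def algebra_simps)
  show "0 + a = a" by transfer (simp add: mintrel_def)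
  show "- a + a = 0" by transfer (simp add: mintrel_def algebra_simps)
  show "a - b = a + - b" by (rule minus_mint_def)
  show "(a + b) * c = a * c + b * c" by transfer (simp add: mintrel_def algebra_simps)
  show "(0::mint) \<noteq> 1" by transfer (simp add: mintrel_def)
qed

end

instantiation mint :: linordered_idom
begin

lift_definition less_eq_mint :: "mint \<Rightarrow> mint \<Rightarrow> bool" is "\<lambda>p q. fst p + snd q \<le> fst q + snd p"
proof -
  fix p p' q q' :: "mnat \<times> mnat" assume "mintrel p p'" "mintrel q q'"
  then have e: "fst p + snd p' = fst p' + snd p" "fst q + snd q' = fst q' + snd q" by (auto simp:
      mintrel_def)
  have 1: "(fst p + snd q) + (snd p' + fst q') = (fst p' + snd q') + (snd p + fst q)"
    using arg_cong2[where f = "(+)", OF e(1) e(2)[symmetric]] by (simp add: algebra_simps)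
  have "fst p + snd q \<le> fst q + snd p \<longleftrightarrow>
    (fst p + snd q) + (snd p' + fst q') \<le> (fst q + snd p) + (snd p' + fst q')" by simp
  also have "\<dots> \<longleftrightarrow> (fst p' + snd q') + (snd p + fst q) \<le> (fst q' + snd p') + (snd p + fst q)"
    unfolding 1 by (simp add: algebra_simps)
  also have "\<dots> \<longleftrightarrow> fst p' + snd q' \<le> fst q' + snd p'" by simp
  finally show "fst p + snd q \<le> fst q + snd p \<longleftrightarrow> fst p' + snd q' \<le> fst q' + snd p'" .
qed
definition less_mint :: "mint \<Rightarrow> mint \<Rightarrow> bool" where "less_mint a b \<longleftrightarrow> a \<le> b \<and> a \<noteq> b"
definition abs_mint :: "mint \<Rightarrow> mint" where "abs_mint a = (if a < 0 then - a else a)"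
definition sgn_mint :: "mint \<Rightarrow> mint" where "sgn_mint a = (if a = 0 then 0 else if 0 < a then 1
    else - 1)"

lemma less_mint_abs: "Abs_mint p < Abs_mint q \<longleftrightarrow> fst p + snd q < fst q + snd p"
  by (auto simp: less_mint_def less_eq_mint.abs_eq mint.abs_eq_iff mintrel_def)


instance
proof
  fix a b c :: mint
  show "a \<le> a" by transfer simp
  show "a \<le> b \<Longrightarrow> b \<le> a \<Longrightarrow> a = b" by transfer (simp add: mintrel_def)
  then show "(a < b) = (a \<le> b \<and> \<not> b \<le> a)" by (auto simp: less_mint_def \<open>a \<le> a\<close>)
  show "a \<le> b \<Longrightarrow> b \<le> c \<Longrightarrow> a \<le> c"
  proof transfer
    fix p q r :: "mnat \<times> mnat"
    assume "fst p + snd q \<le> fst q + snd p" "fst q + snd r \<le> fst r + snd q"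
    then have "(fst p + snd q) + (fst q + snd r) \<le> (fst q + snd p) + (fst r + snd q)" by (rule
        add_mono)
    then have "(fst p + snd r) + (fst q + snd q) \<le> (fst r + snd p) + (fst q + snd q)"
      by (simp add: algebra_simps)
    then show "fst p + snd r \<le> fst r + snd p" by simp
  qed
  show "a \<le> b \<or> b \<le> a" by transfer (simp add: linear add.commute)
  show "a \<le> b \<Longrightarrow> c + a \<le> c + b"
  proof transfer
    fix p q r :: "mnat \<times> mnat"
    assume "fst p + snd q \<le> fst q + snd p"
    then have "(fst p + snd q) + (fst r + snd r) \<le> (fst q + snd p) + (fst r + snd r)" by simp
    then show "fst (fst r + fst p, snd r + snd p) + snd (fst r + fst q, snd r + snd q)
       \<le> fst (fst r + fst q, snd r + snd q) + snd (fst r + fst p, snd r + snd p)"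
      by (simp add: algebra_simps)
  qed
  show "\<bar>a\<bar> = (if a < 0 then - a else a)" by (rule abs_mint_def)
  show "sgn a = (if a = 0 then 0 else if 0 < a then 1 else - 1)" by (rule sgn_mint_def)
  show "a < b \<Longrightarrow> 0 < c \<Longrightarrow> c * a < c * b"
  proof (induction a, induction b, induction c)
    fix r q p :: "mnat \<times> mnat"
    assume "Abs_mint p < Abs_mint q" "0 < Abs_mint r"
    then have *: "fst p + snd q < fst q + snd p" "snd r < fst r"
      by (simp_all add: less_mint_abs zero_mint_def)
    then obtain d where d: "fst r = snd r + (d + 1)" using mnat_less_iff by blast
    have "0 < d + 1" by simp
    then have "(d + 1) * (fst p + snd q) < (d + 1) * (fst q + snd p)"
      using *(1) by (intro mult_strict_left_mono)
    then have "snd r * (fst p + snd p + fst q + snd q) + (d + 1) * (fst p + snd q) <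
      snd r * (fst p + snd p + fst q + snd q) + (d + 1) * (fst q + snd p)" by simp
    then show "Abs_mint r * Abs_mint p < Abs_mint r * Abs_mint q"
      by (simp add: times_mint.abs_eq less_mint_abs d algebra_simps)
  qed
qed
end

text \<open>The field of fractions brings ordered field arithmetic. It need not be Archimedean from
  outside, so approximation arguments use the model's own powers of 2.\<close>

type_synonym mrat = "mint fract"

definition of_mnat :: "mnat \<Rightarrow> mrat" where
  "of_mnat a = Fract (Abs_mint (a, 0)) 1"

lemma of_mnat_simps [simp]:
  "of_mnat 0 = 0" "of_mnat 1 = 1" "of_mnat (a + b) = of_mnat a + of_mnat b"
  "of_mnat (a * b) = of_mnat a * of_mnat b"
proof -
  show "of_mnat 0 = 0" by (simp add: of_mnat_def Zero_fract_def zero_mint_def)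
  show "of_mnat 1 = 1" unfolding of_mnat_def One_fract_def one_mint_def ..
  show "of_mnat (a + b) = of_mnat a + of_mnat b" by (simp add: of_mnat_def plus_mint.abs_eq)
  show "of_mnat (a * b) = of_mnat a * of_mnat b" by (simp add: of_mnat_def times_mint.abs_eq)
qed

lemma of_mnat_less [simp]: "of_mnat a < of_mnat b \<longleftrightarrow> a < b"
  by (simp add: of_mnat_def less_mint_abs)

lemma of_mnat_le [simp]: "of_mnat a \<le> of_mnat b \<longleftrightarrow> a \<le> b"
  by (simp add: not_less[symmetric])

lemma of_mnat_eq [simp]: "of_mnat a = of_mnat b \<longleftrightarrow> a = b"
  by (simp add: eq_iff)

lemma of_mnat_eq_0 [simp]: "of_mnat a = 0 \<longleftrightarrow> a = 0"
  using of_mnat_eq[of a 0] by simp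

lemma of_mnat_pos [simp]: "0 < of_mnat a \<longleftrightarrow> 0 < a"
  using of_mnat_less[of 0 a] by simp

lemma of_mnat_nonneg [simp]: "0 \<le> of_mnat a"
  using of_mnat_le[of 0 a] by simp

lemma mrat_cases:
  obtains a b c where "0 < c" "x = (of_mnat a - of_mnat b) / of_mnat c"
proof -
  have rep: "\<exists>a b. z = Abs_mint (a, b)" for z
    by (induction z rule: mint.abs_induct) (metis surj_pair)
  have "\<exists>a b c. 0 < c \<and> x = (of_mnat a - of_mnat b) / of_mnat c"
  proof (induction x rule: fract_induct_pos)
    case (Fract n d)
    obtain a b where n: "n = Abs_mint (a, b)" using rep by blast
    obtain u v where d: "d = Abs_mint (u, v)" using rep by blast
    have "v < u" using Fract by (simp add: d zero_mint_def less_mint_abs)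
    then obtain c where c: "u = v + (c + 1)" using mnat_less_iff by blast
    then have "d = Abs_mint (c + 1, 0)" by (simp add: d mint.abs_eq_iff mintrel_def algebra_simps)
    moreover have "n = Abs_mint (a, 0) - Abs_mint (b, 0)"
      by (simp add: n minus_mint_def uminus_mint.abs_eq plus_mint.abs_eq)
    ultimately have "Fract n d = (of_mnat a - of_mnat b) / of_mnat (c + 1)"
      by (simp add: of_mnat_def del: of_mnat_simps)
    moreover have "0 < c + 1" by simp
    ultimately show ?case by blast
  qed
  then show thesis using that by blast
qed

section \<open>Codes of rationals and definability of rational quantities\<close>

definition qfrac :: "mnat \<Rightarrow> mnat \<Rightarrow> mnat \<Rightarrow> mnat" where
  "qfrac a b c = pair (pair a b) c"

definition isfrac :: "mnat \<Rightarrow> bool" where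
  "isfrac z \<longleftrightarrow> (\<exists>a b c. 0 < c \<and> z = qfrac a b c)"

text \<open>The default value 0 makes \<open>qv\<close> total, so that \<open>qf_qv\<close> can
  treat the value of an arbitrary term.\<close>

definition qv :: "mnat \<Rightarrow> mrat" where
  "qv z = (THE x. if isfrac z then \<exists>a b c. z = qfrac a b c \<and>
      x = (of_mnat a - of_mnat b) / of_mnat c else x = 0)"

lemma qfrac_inject [simp]: "qfrac a b c = qfrac a' b' c' \<longleftrightarrow> a = a' \<and> b = b' \<and> c = c'"
  by (simp add: qfrac_def)

lemma tmf_qfrac: "tmf f \<Longrightarrow> tmf g \<Longrightarrow> tmf h \<Longrightarrow> tmf (\<lambda>e. qfrac (f e) (g e) (h e))"
  unfolding qfrac_def by (intro tmf_pair)

lemma isfrac_qfrac [simp]: "isfrac (qfrac a b c) \<longleftrightarrow> 0 < c"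
  by (auto simp: isfrac_def)

lemma qv_qfrac [simp]: "0 < c \<Longrightarrow> qv (qfrac a b c) = (of_mnat a - of_mnat b) / of_mnat c"
  by (simp add: qv_def)

lemma qv_not_frac: "\<not> isfrac z \<Longrightarrow> qv z = 0"
  by (simp add: qv_def)

lemma qfrac_ge: "a \<le> qfrac a b c" "b \<le> qfrac a b c" "c \<le> qfrac a b c"
  unfolding qfrac_def using pair_ge order_trans by blast+

lemma d0_subst1: "d0 (\<lambda>e. P (e 0)) \<Longrightarrow> tmf t \<Longrightarrow> d0 (\<lambda>e. P (t e))"
  using d0_subst[of "\<lambda>e. P (e 0)" "\<lambda>i. t"] by simp

lemma d0_isfrac: "tmf t \<Longrightarrow> d0 (\<lambda>e. isfrac (t e))"
proof (rule d0_subst1[of isfrac])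
  have "isfrac z \<longleftrightarrow> (\<exists>a\<le>z. \<exists>b\<le>z. \<exists>c\<le>z. 0 < c \<and> z = qfrac a b c)" for z
    unfolding isfrac_def using qfrac_ge by blast
  then show "d0 (\<lambda>e. isfrac (e 0))"
    by (simp only:) (intro d0_intros tmf_qfrac tmf_intros)
qed

definition fle :: "mnat \<Rightarrow> mnat \<Rightarrow> bool" where
  "fle p q \<longleftrightarrow> (\<exists>a b c a' b' c'. 0 < c \<and> 0 < c' \<and> p = qfrac a b c \<and> q = qfrac a' b' c' \<and>
     a * c' + b' * c \<le> a' * c + b * c')"

lemma mrat_le_iff:
  assumes "0 < c" "0 < c'"
  shows "(of_mnat a - of_mnat b) / of_mnat c \<le> (of_mnat a' - of_mnat b') / of_mnat c' \<longleftrightarrow>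
    a * c' + b' * c \<le> a' * c + b * c'"
proof -
  have "(of_mnat a - of_mnat b) / of_mnat c \<le> (of_mnat a' - of_mnat b') / of_mnat c' \<longleftrightarrow>
    of_mnat (a * c' + b' * c) \<le> of_mnat (a' * c + b * c')"
    using assms by (simp add: field_simps del: of_mnat_le)
  then show ?thesis by (simp only: of_mnat_le)
qed

lemma fle_iff: "fle p q \<longleftrightarrow> isfrac p \<and> isfrac q \<and> qv p \<le> qv q"
  by (auto simp: fle_def isfrac_def mrat_le_iff)

lemma d0_fle: "tmf t \<Longrightarrow> tmf u \<Longrightarrow> d0 (\<lambda>e. fle (t e) (u e))"
proof (rule d0_subst2[of fle])
  have "fle p q \<longleftrightarrow> (\<exists>a\<le>p. \<exists>b\<le>p. \<exists>c\<le>p. \<exists>a'\<le>q. \<exists>b'\<le>q. \<exists>c'\<le>q. 0 < c \<and> 0 < c' \<and> p = qfrac a b c \<and>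
     q = qfrac a' b' c' \<and> a * c' + b' * c \<le> a' * c + b * c')" (is "_ \<longleftrightarrow> ?R") for p q
  proof
    assume "fle p q"
    then obtain a b c a' b' c' where "0 < c" "0 < c'" "p = qfrac a b c" "q = qfrac a' b' c'"
      "a * c' + b' * c \<le> a' * c + b * c'" unfolding fle_def by blast
    moreover from this have "a \<le> p" "b \<le> p" "c \<le> p" "a' \<le> q" "b' \<le> q" "c' \<le> q" by (simp_all add:
        qfrac_ge)
    ultimately show ?R by blast
  qed (auto simp: fle_def)
  then show "d0 (\<lambda>e. fle (e 0) (e 1))"
    by (simp only:) (intro d0_intros tmf_qfrac tmf_intros)
qed

definition israt :: "mnat \<Rightarrow> bool" where
  "israt q \<longleftrightarrow> isfrac q \<and> (\<forall>p<q. \<not> (fle p q \<and> fle q p))"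

lemma d0_israt: "tmf t \<Longrightarrow> d0 (\<lambda>e. israt (t e))"
proof (rule d0_subst1[of israt])
  show "d0 (\<lambda>e. israt (e 0))"
    unfolding israt_def by (intro d0_intros d0_isfrac d0_fle tmf_intros)
qed

lemma israt_isfrac: "israt q \<Longrightarrow> isfrac q"
  by (simp add: israt_def)

lemma israt_inj: "israt p \<Longrightarrow> israt q \<Longrightarrow> qv p = qv q \<Longrightarrow> p = q"
  unfolding israt_def fle_iff by (metis linorder_cases order_refl)

text \<open>The least number principle is applied to the fractions equal to a given one.\<close>

lemma code_ex: "\<exists>q. israt q \<and> qv q = x"
proof -
  obtain a b c where c: "0 < c" "x = (of_mnat a - of_mnat b) / of_mnat c" by (rule mrat_cases)
  have x: "isfrac (qfrac a b c)" "qv (qfrac a b c) = x" using c by simp_all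
  let ?f = "qfrac a b c"
  have "d0 (\<lambda>e. fle (e 0) ?f \<and> fle ?f (e 0))" by (intro d0_intros d0_fle tmf_intros)
  moreover have "fle ?f ?f \<and> fle ?f ?f" using x by (simp add: fle_iff)
  ultimately obtain q where "fle q ?f \<and> fle ?f q" "\<forall>w<q. \<not> (fle w ?f \<and> fle ?f w)"
    using d0_least[of "\<lambda>z. fle z ?f \<and> fle ?f z"] by blast
  then have "israt q \<and> qv q = x" unfolding israt_def fle_iff x by auto
  then show ?thesis ..
qed

definition code :: "mrat \<Rightarrow> mnat" where "code x = (THE q. israt q \<and> qv q = x)"

lemma code [simp]: "israt (code x)" "qv (code x) = x" "isfrac (code x)"
proof -
  have "israt (code x) \<and> qv (code x) = x"
    unfolding code_def by (rule theI') (use code_ex israt_inj in blast)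
  then show "israt (code x)" "qv (code x) = x" "isfrac (code x)" by (auto simp: israt_def)
qed

lemma code_qv: "israt q \<Longrightarrow> code (qv q) = q"
  using israt_inj[of "code (qv q)" q] by simp

text \<open>The graph admits every fraction code of the value, so arithmetic on fractions stays
  definable without reduction to least codes.\<close>

definition qf :: "((nat \<Rightarrow> mnat) \<Rightarrow> mrat) \<Rightarrow> bool" where
  "qf f \<longleftrightarrow> sg (\<lambda>e. isfrac (e 0) \<and> f (\<lambda>i. e (Suc i)) = qv (e 0))"

lemma qf_graph:
  assumes "qf f" "tmf t" "\<And>i. tmf (g i)"
  shows "sg (\<lambda>e. isfrac (t e) \<and> f (\<lambda>i. g i e) = qv (t e))"
  using sg_subst[OF assms(1)[unfolded qf_def], of "case_nat t g"] assms(2,3)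
  by (simp split: nat.split)

lemma sg_qless:
  assumes "qf f" "qf g" shows "sg (\<lambda>e. f e < g e)"
proof -
  have "sg (\<lambda>e. \<exists>p q. (isfrac p \<and> f e = qv p) \<and> (isfrac q \<and> g e = qv q) \<and> \<not> fle q p)"
    by (intro sg_ex sg_conj qf_graph[OF assms(1)] qf_graph[OF assms(2)] sg_d0 d0_not d0_fle tmf_var)
  moreover have "f e < g e \<longleftrightarrow> (\<exists>p q. (isfrac p \<and> f e = qv p) \<and> (isfrac q \<and> g e = qv q) \<and>
      \<not> fle q p)" for e
    using code[of "f e"] code[of "g e"] by (auto simp: fle_iff not_le) (metis code)
  ultimately show ?thesis by simp
qed

lemma qf_qv: "tmf t \<Longrightarrow> qf (\<lambda>e. qv (t e))"
proof -
  assume t: "tmf t"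
  have t': "tmf (\<lambda>e. t (\<lambda>i. e (Suc i)))" by (intro tmf_subst[OF t] tmf_var)
  let ?t = "\<lambda>e. t (\<lambda>i. e (Suc i))" and ?z = "qfrac 0 0 1"
  have "sg (\<lambda>e. fle (e 0) (?t e) \<and> fle (?t e) (e 0) \<or> \<not> isfrac (?t e) \<and> fle (e 0) ?z \<and>
      fle ?z (e 0))"
    by (intro sg_d0 d0_intros d0_fle d0_isfrac tmf_var tmf_const t')
  moreover have "isfrac p \<and> qv s = qv p \<longleftrightarrow>
    (fle p s \<and> fle s p \<or> \<not> isfrac s \<and> fle p ?z \<and> fle ?z p)" for p s
    by (cases "isfrac s") (auto simp: fle_iff qv_not_frac)
  ultimately show ?thesis unfolding qf_def by simp
qed

text \<open>It suffices to find some code of the value, as the others are recognized by comparison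
  with it.\<close>

lemma qfI:
  assumes "sg (\<lambda>e. R (e 0) (\<lambda>i. e (Suc i)))"
    and "\<And>p e. R p e \<Longrightarrow> isfrac p \<and> qv p = f e" and "\<And>e. \<exists>p. R p e"
  shows "qf f"
proof -
  have "tmf (case_nat (\<lambda>e. e 0) (\<lambda>i e. e (Suc (Suc i))) j)" for j
    by (cases j) (simp_all add: tmf_var)
  from sg_subst[of _ "\<lambda>j. case_nat (\<lambda>e. e 0) (\<lambda>i e. e (Suc (Suc i))) j", OF assms(1) this]
  have R': "sg (\<lambda>e. R (e 0) (\<lambda>i. e (Suc (Suc i))))" by simp
  have "sg (\<lambda>e. \<exists>p. R p (\<lambda>i. e (Suc i)) \<and> fle (e 0) p \<and> fle p (e 0))"
    by (intro sg_ex sg_conj R' sg_d0 d0_fle tmf_var)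
  moreover have "isfrac z \<and> f e = qv z \<longleftrightarrow> (\<exists>p. R p e \<and> fle z p \<and> fle p z)" for z e
  proof
    assume z: "isfrac z \<and> f e = qv z"
    obtain p where "R p e" using assms(3) by blast
    then show "\<exists>p. R p e \<and> fle z p \<and> fle p z" using z assms(2)[of p e] by (auto simp: fle_iff)
  next
    assume "\<exists>p. R p e \<and> fle z p \<and> fle p z"
    then obtain p where "R p e" "fle z p" "fle p z" by blast
    then show "isfrac z \<and> f e = qv z" using assms(2)[of p e] by (auto simp: fle_iff)
  qed
  ultimately show ?thesis unfolding qf_def by simp
qed

lemma qf_add:
  assumes "qf f" "qf g" shows "qf (\<lambda>e. f e + g e)"
proof (rule qfI[where R = "\<lambda>r e. \<exists>a b c a' b' c'. 0 < c \<and> 0 < c' \<and>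
    (isfrac (qfrac a b c) \<and> f e = qv (qfrac a b c)) \<and> (isfrac (qfrac a' b' c') \<and>
        g e = qv (qfrac a' b' c')) \<and>
    r = qfrac (a * c' + a' * c) (b * c' + b' * c) (c * c')"])
  show "sg (\<lambda>e. \<exists>a b c a' b' c'. 0 < c \<and> 0 < c' \<and>
    (isfrac (qfrac a b c) \<and> f (\<lambda>i. e (Suc i)) = qv (qfrac a b c)) \<and>
    (isfrac (qfrac a' b' c') \<and> g (\<lambda>i. e (Suc i)) = qv (qfrac a' b' c')) \<and>
    e 0 = qfrac (a * c' + a' * c) (b * c' + b' * c) (c * c'))"
    by (intro sg_ex sg_conj qf_graph[OF assms(1)] qf_graph[OF assms(2)] sg_d0 d0_eq d0_less
        tmf_qfrac tmf_intros)
next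
  fix r e assume "\<exists>a b c a' b' c'. 0 < c \<and> 0 < c' \<and>
    (isfrac (qfrac a b c) \<and> f e = qv (qfrac a b c)) \<and> (isfrac (qfrac a' b' c') \<and>
        g e = qv (qfrac a' b' c')) \<and>
    r = qfrac (a * c' + a' * c) (b * c' + b' * c) (c * c')"
  then obtain a b c a' b' c' where c: "0 < c" "0 < c'"
    and f: "f e = qv (qfrac a b c)" "g e = qv (qfrac a' b' c')"
    and r: "r = qfrac (a * c' + a' * c) (b * c' + b' * c) (c * c')" by blast
  show "isfrac r \<and> qv r = f e + g e"
    unfolding f r using c by (simp add: field_simps)
next
  fix e
  obtain a b c where 1: "0 < c" "code (f e) = qfrac a b c" using code(3)[of "f e"] unfolding
      isfrac_def by blast
  obtain a' b' c' where 2: "0 < c'" "code (g e) = qfrac a' b' c'" using code(3)[of "g e"]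
      unfolding isfrac_def by blast
  have "f e = qv (qfrac a b c)" "g e = qv (qfrac a' b' c')" by (simp_all flip: 1(2) 2(2))
  with 1 2 show "\<exists>r a b c a' b' c'. 0 < c \<and> 0 < c' \<and>
    (isfrac (qfrac a b c) \<and> f e = qv (qfrac a b c)) \<and> (isfrac (qfrac a' b' c') \<and>
        g e = qv (qfrac a' b' c')) \<and>
    r = qfrac (a * c' + a' * c) (b * c' + b' * c) (c * c')"
    by (metis isfrac_qfrac)
qed

context exponential
begin

definition hp :: "mnat \<Rightarrow> mrat" where "hp k = 1 / of_mnat (ex k)"

lemma hp_pos [simp]: "0 < hp k"
  by (simp add: hp_def)

lemma hp_nonneg [simp]: "0 \<le> hp k"
  by (simp add: hp_def)

lemma hp_Suc: "hp (k + 1) = hp k / 2"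
  unfolding hp_def ex_add_1 of_mnat_simps by (simp add: field_simps)

lemma hp_mono: "i \<le> j \<Longrightarrow> hp j \<le> hp i"
  unfolding hp_def by (intro divide_left_mono mult_pos_pos) (simp_all add: ex_mono)

text \<open>A positive fraction with denominator c is at least 1/c, and c < 2^c.\<close>

lemma hp_archimedean: "0 < x \<Longrightarrow> \<exists>k. hp k < x"
proof -
  assume x: "0 < x"
  obtain a b c where c: "0 < c" and xe: "x = (of_mnat a - of_mnat b) / of_mnat c" by (rule
      mrat_cases)
  have "b < a"
  proof (rule ccontr)
    assume "\<not> b < a"
    then have "of_mnat a - of_mnat b \<le> 0" by simp
    then have "x \<le> 0" unfolding xe using c by (intro divide_nonpos_pos) auto
    with x show False by simp
  qed
  then have "b + 1 \<le> a" by (simp add: mnat_add_1_le)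
  then have "1 \<le> of_mnat a - of_mnat b"
    using of_mnat_le[of "b + 1" a] by (simp add: algebra_simps)
  then have "1 / of_mnat c \<le> x" unfolding xe by (intro divide_right_mono) auto
  moreover have "hp c < 1 / of_mnat c"
    unfolding hp_def using c by (intro divide_strict_left_mono mult_pos_pos) (simp_all add: ex_gt)
  ultimately show ?thesis by (meson less_le_trans)
qed

lemma qf_hp: "tmf t \<Longrightarrow> qf (\<lambda>e. hp (t e))"
proof -
  assume t: "tmf t"
  have t': "tmf (\<lambda>e. t (\<lambda>i. e (Suc (Suc i))))" by (intro tmf_subst[OF t] tmf_var)
  show ?thesis
  proof (rule qfI[where R = "\<lambda>r e. \<exists>y. ex (t e) = y \<and> r = qfrac 1 0 y"])
    show "sg (\<lambda>e. \<exists>y. ex (t (\<lambda>i. e (Suc i))) = y \<and> e 0 = qfrac 1 0 y)"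
      by (intro sg_ex sg_d0 d0_conj d0_cf[OF cf_ex] d0_eq tmf_qfrac tmf_var tmf_const t')
  qed (auto simp: hp_def)
qed

end

section \<open>Interpreting level formulas in the model\<close>

text \<open>A context lists the values of the numbers and sets bound so far, by level. The relations below
  hold in every extension of the context, as level terms may be placed under further quantifiers. The
  constant \<open>h_c\<close> is the meaning of \<open>c\<close> in the model.\<close>

datatype ctx = Ctx (nd: nat) (nv: "nat \<Rightarrow> mnat") (sd: nat) (sv: "nat \<Rightarrow> mnat set")
  (jn: "nat \<Rightarrow> mnat") (js: "nat \<Rightarrow> mnat set")

definition ext :: "ctx \<Rightarrow> ctx \<Rightarrow> bool" where
  "ext c c' \<longleftrightarrow> nd c \<le> nd c' \<and> sd c \<le> sd c' \<and> (\<forall>i<nd c. nv c' i = nv c i) \<and>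
      (\<forall>i<sd c. sv c' i = sv c i) \<and>
     jn c' = jn c \<and> js c' = js c"

text \<open>The variable bound at level i has index \<open>nd c - Suc i\<close> at depth
  \<open>nd c\<close>, as in the level binders. Indices beyond the depth are free and read from
  \<open>jn\<close>.\<close>

definition nenv :: "ctx \<Rightarrow> nat \<Rightarrow> mnat" where
  "nenv c i = (if i < nd c then nv c (nd c - Suc i) else jn c (i - nd c))"

definition senv :: "ctx \<Rightarrow> nat \<Rightarrow> mnat set" where
  "senv c i = (if i < sd c then sv c (sd c - Suc i) else js c (i - sd c))"

definition TM :: "ctx \<Rightarrow> lterm \<Rightarrow> mnat \<Rightarrow> bool" where
  "TM c t v \<longleftrightarrow> (\<forall>c'. ext c c' \<longrightarrow> teval (nenv c') (t (nd c')) = v)"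

definition SX :: "ctx \<Rightarrow> lset \<Rightarrow> mnat set \<Rightarrow> bool" where
  "SX c X B \<longleftrightarrow> (\<forall>c'. ext c c' \<longrightarrow> senv c' (X (sd c')) = B)"

definition FM :: "ctx \<Rightarrow> lform \<Rightarrow> bool \<Rightarrow> bool" where
  "FM c P b \<longleftrightarrow> (\<forall>c'. ext c c' \<longrightarrow> (sat sets (nenv c') (senv c') (P (nd c') (sd c')) \<longleftrightarrow> b))"

definition CL :: "ctx \<Rightarrow> lclass \<Rightarrow> (mnat \<Rightarrow> bool) \<Rightarrow> bool" where
  "CL c A B \<longleftrightarrow> (\<forall>c' t v. ext c c' \<longrightarrow> TM c' t v \<longrightarrow> FM c' (A t) (B v))"

definition SQ :: "ctx \<Rightarrow> lseq \<Rightarrow> (mnat \<Rightarrow> mnat \<Rightarrow> bool) \<Rightarrow> bool" where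
  "SQ c R S \<longleftrightarrow> (\<forall>c' s a t b. ext c c' \<longrightarrow> TM c' s a \<longrightarrow> TM c' t b \<longrightarrow> FM c' (R s t) (S a b))"

lemma ext_refl: "ext c c"
  by (simp add: ext_def)

lemma ext_step: "ext b c \<Longrightarrow> ext a b \<Longrightarrow> ext a c"
  by (auto simp: ext_def)

lemma TM_mono: "ext b c \<Longrightarrow> TM b t v \<Longrightarrow> TM c t v"
  unfolding TM_def using ext_step by blast

lemma SX_mono: "ext b c \<Longrightarrow> SX b t v \<Longrightarrow> SX c t v"
  unfolding SX_def using ext_step by blast

lemma CL_mono: "ext b c \<Longrightarrow> CL b t v \<Longrightarrow> CL c t v"
  unfolding CL_def using ext_step by blast

lemma SQ_mono: "ext b c \<Longrightarrow> SQ b t v \<Longrightarrow> SQ c t v"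
  unfolding SQ_def using ext_step by blast

lemmas rel_mono = TM_mono SX_mono CL_mono SQ_mono ext_step

lemma CL_D: "CL c A B \<Longrightarrow> ext c c' \<Longrightarrow> TM c' t v \<Longrightarrow> FM c' (A t) (B v)"
  unfolding CL_def by blast

lemma SQ_D: "SQ c R S \<Longrightarrow> ext c c' \<Longrightarrow> TM c' s a \<Longrightarrow> TM c' t b \<Longrightarrow> FM c' (R s t) (S a b)"
  unfolding SQ_def by blast

lemma CL_I: "(\<And>c' t v. ext c c' \<Longrightarrow> TM c' t v \<Longrightarrow> FM c' (A t) (B v)) \<Longrightarrow> CL c A B"
  unfolding CL_def by blast

lemma SQ_I: "(\<And>c' s a t b. ext c c' \<Longrightarrow> TM c' s a \<Longrightarrow> TM c' t b \<Longrightarrow> FM c' (R s t) (S a b)) \<Longrightarrow> SQ c R S"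
  unfolding SQ_def by blast

text \<open>The rules follow the syntax, so the meaning of each defined notion is found by one
  uniform search, which applies the rule for the head symbol and transports hypotheses to extended
  contexts.\<close>

named_theorems rel

lemma TM_ops [rel]:
  "TM c \<^bold>0 0" "TM c \<^bold>1 1"
  "TM c s a \<Longrightarrow> TM c t b \<Longrightarrow> TM c (s \<^bold>+ t) (a + b)"
  "TM c s a \<Longrightarrow> TM c t b \<Longrightarrow> TM c (s \<^bold>\<cdot> t) (a * b)"
  by (auto simp: TM_def l_zero_def l_one_def l_add_def l_mul_def)

lemma FM_atoms [rel]:
  "TM c s a \<Longrightarrow> TM c t b \<Longrightarrow> FM c (s \<^bold>= t) (a = b)"
  "TM c s a \<Longrightarrow> TM c t b \<Longrightarrow> FM c (s \<^bold>< t) (a < b)"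
  "TM c s a \<Longrightarrow> SX c X B \<Longrightarrow> FM c (s \<^bold>\<in> X) (a \<in> B)"
  by (auto simp: TM_def SX_def FM_def l_eq_def l_less_def l_mem_def)

lemma FM_connectives [rel]:
  "FM c P p \<Longrightarrow> FM c (\<^bold>\<not> P) (\<not> p)"
  "FM c P p \<Longrightarrow> FM c Q q \<Longrightarrow> FM c (P \<^bold>\<and> Q) (p \<and> q)"
  "FM c P p \<Longrightarrow> FM c Q q \<Longrightarrow> FM c (P \<^bold>\<or> Q) (p \<or> q)"
  "FM c P p \<Longrightarrow> FM c Q q \<Longrightarrow> FM c (P \<^bold>\<longrightarrow> Q) (p \<longrightarrow> q)"
  by (auto simp: FM_def l_not_def l_and_def l_or_def l_imp_def)

lemma FM_le [rel]: "TM c s a \<Longrightarrow> TM c t b \<Longrightarrow> FM c (s \<^bold>\<le> t) (a \<le> b)"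
  unfolding l_le_def less_eq_mnat_def by (intro rel)

lemma bind_number:
  fixes c v defines "c' \<equiv> Ctx (Suc (nd c)) ((nv c)(nd c := v)) (sd c) (sv c) (jn c) (js c)"
  shows "ext c c'" "TM c' (\<lambda>k. Var (k - Suc (nd c))) v"
    "nenv c' = case_nat v (nenv c)" "senv c' = senv c" "nd c' = Suc (nd c)" "sd c' = sd c"
proof -
  show "TM c' (\<lambda>k. Var (k - Suc (nd c))) v"
    unfolding TM_def
  proof (intro allI impI)
    fix d assume d: "ext c' d"
    then have "nd c < nd d" "nv d (nd c) = v" by (auto simp: ext_def c'_def)
    then show "teval (nenv d) (Var (nd d - Suc (nd c))) = v" by (auto simp: nenv_def)
  qed
  show "nenv c' = case_nat v (nenv c)"
    by (rule ext) (auto simp: nenv_def c'_def split: nat.split)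
qed (auto simp: ext_def c'_def senv_def fun_eq_iff)

lemma bind_set:
  fixes c B defines "c' \<equiv> Ctx (nd c) (nv c) (Suc (sd c)) ((sv c)(sd c := B)) (jn c) (js c)"
  shows "ext c c'" "SX c' (\<lambda>k. k - Suc (sd c)) B"
    "nenv c' = nenv c" "senv c' = case_nat B (senv c)" "nd c' = nd c" "sd c' = Suc (sd c)"
proof -
  show "SX c' (\<lambda>k. k - Suc (sd c)) B"
    unfolding SX_def
  proof (intro allI impI)
    fix d assume d: "ext c' d"
    then have "sd c < sd d" "sv d (sd c) = B" by (auto simp: ext_def c'_def)
    then show "senv d (sd d - Suc (sd c)) = B" by (auto simp: senv_def)
  qed
  show "senv c' = case_nat B (senv c)"
    by (rule ext) (auto simp: senv_def c'_def split: nat.split)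
qed (auto simp: ext_def c'_def nenv_def fun_eq_iff)

lemma sat_bind_number:
  assumes "\<And>c' t v. ext c c' \<Longrightarrow> TM c' t v \<Longrightarrow> FM c' (P t) (Q v)" "ext c d"
  shows "sat sets (case_nat v (nenv d)) (senv d) (P (\<lambda>k. Var (k - Suc (nd d))) (Suc (nd d)) (sd
      d)) \<longleftrightarrow> Q v"
  using assms(1)[OF ext_step[OF bind_number(1)[of d v] assms(2)] bind_number(2)]
  unfolding FM_def using ext_refl bind_number(3-6)[of d v] by metis

lemma sat_bind_set:
  assumes "\<And>c' X B. ext c c' \<Longrightarrow> SX c' X B \<Longrightarrow> FM c' (P X) (Q B)" "ext c d"
  shows "sat sets (nenv d) (case_nat B (senv d)) (P (\<lambda>k. k - Suc (sd d)) (nd d) (Suc (sd d))) \<longleftrightarrow> Q B"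
  using assms(1)[OF ext_step[OF bind_set(1)[of d B] assms(2)] bind_set(2)]
  unfolding FM_def using ext_refl bind_set(3-6)[of d B] by metis

text \<open>The body is a HOL function of the bound term. Its meaning is requested for every term
  that denotes \<open>v\<close> in an extension of the context, and the freshly bound variable is
  one.\<close>

lemma FM_allN [rel]:
  "(\<And>c' t v. ext c c' \<Longrightarrow> TM c' t v \<Longrightarrow> FM c' (P t) (Q v)) \<Longrightarrow> FM c (l_allN P) (\<forall>v. Q v)"
  unfolding FM_def[of c] l_allN_def using sat_bind_number[of c P Q] by simp

lemma FM_exN [rel]:
  "(\<And>c' t v. ext c c' \<Longrightarrow> TM c' t v \<Longrightarrow> FM c' (P t) (Q v)) \<Longrightarrow> FM c (l_exN P) (\<exists>v. Q v)"
  unfolding FM_def[of c] l_exN_def using sat_bind_number[of c P Q] by simp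

lemma FM_allS [rel]:
  "(\<And>c' X B. ext c c' \<Longrightarrow> SX c' X B \<Longrightarrow> FM c' (P X) (Q B)) \<Longrightarrow> FM c (l_allS P) (\<forall>B\<in>sets. Q B)"
  unfolding FM_def[of c] l_allS_def using sat_bind_set[of c P Q] by simp

lemma FM_exS [rel]:
  "(\<And>c' X B. ext c c' \<Longrightarrow> SX c' X B \<Longrightarrow> FM c' (P X) (Q B)) \<Longrightarrow> FM c (l_exS P) (\<exists>B\<in>sets. Q B)"
  unfolding FM_def[of c] l_exS_def using sat_bind_set[of c P Q] by simp

section \<open>Meanings of the defined notions\<close>

lemma TM_pr [rel]:
  assumes "TM c s a" and "TM c t b"
  shows "TM c (pr s t) (pair a b)"
  unfolding pr_def pair_def
  by (insert assms, (assumption | rule ext_refl rel | (rule rel_mono, assumption))+)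

lemma CL_numbers [rel]:
  shows "CL c numbers (\<lambda>a. a = a)"
  unfolding numbers_def
  by (assumption | rule ext_refl rel CL_I |
      (rule rel_mono, assumption))+

lemma CL_elements [rel]:
  assumes "SX c X B"
  shows "CL c (elements X) (\<lambda>a. a \<in> B)"
  unfolding elements_def
  by (insert assms, (assumption | rule ext_refl rel CL_I |
      (rule rel_mono, assumption))+)

definition h_pairs :: "(mnat \<Rightarrow> bool) \<Rightarrow> (mnat \<Rightarrow> bool) \<Rightarrow> mnat \<Rightarrow> bool" where
  "h_pairs A B z \<longleftrightarrow> (\<exists>a b. A a \<and> B b \<and> z = pair a b)"

lemma FM_pairs [rel]:
  assumes "CL c A A'" and "CL c B B'" and "TM c t v"
  shows "FM c (pairs A B t) (h_pairs A' B' v)"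
  unfolding pairs_def h_pairs_def
  by (insert assms, (assumption | rule ext_refl rel CL_D[OF assms(1)] CL_D[OF assms(2)] |
      (rule rel_mono, assumption))+)

lemma CL_pairs [rel]:
  assumes "CL c A A'" and "CL c B B'"
  shows "CL c (pairs A B) (h_pairs A' B')"
  unfolding pairs_def h_pairs_def
  by (insert assms, (assumption | rule ext_refl rel CL_I CL_D[OF assms(1)] CL_D[OF assms(2)] |
      (rule rel_mono, assumption))+)

definition h_is_fun :: "(mnat \<Rightarrow> bool) \<Rightarrow> (mnat \<Rightarrow> bool) \<Rightarrow> mnat set \<Rightarrow> bool" where
  "h_is_fun A B F \<longleftrightarrow> ((\<forall>z. z \<in> F \<longrightarrow> h_pairs A B z) \<and> (\<forall>a. A a \<longrightarrow> (\<exists>b. pair a b \<in> F \<and>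
      (\<forall>d. pair a d \<in> F \<longrightarrow> d = b))))"

lemma FM_is_fun [rel]:
  assumes "CL c A A'" and "CL c B B'" and "SX c F F'"
  shows "FM c (is_fun A B F) (h_is_fun A' B' F')"
  unfolding is_fun_def h_is_fun_def
  by (insert assms, (assumption | rule ext_refl rel CL_D[OF assms(1)] CL_D[OF assms(2)] |
      (rule rel_mono, assumption))+)

definition h_seq :: "mnat set \<Rightarrow> mnat \<Rightarrow> mnat \<Rightarrow> bool" where
  "h_seq F i v \<longleftrightarrow> pair i v \<in> F"

lemma FM_seq [rel]:
  assumes "SX c F B" and "TM c i a" and "TM c v b"
  shows "FM c (seq F i v) (h_seq B a b)"
  unfolding seq_def h_seq_def
  by (insert assms, (assumption | rule ext_refl rel | (rule rel_mono, assumption))+)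

lemma SQ_seq [rel]:
  assumes "SX c F B"
  shows "SQ c (seq F) (h_seq B)"
  unfolding seq_def h_seq_def
  by (insert assms, (assumption | rule ext_refl rel SQ_I |
      (rule rel_mono, assumption))+)

definition h_section :: "mnat set \<Rightarrow> mnat \<Rightarrow> mnat \<Rightarrow> mnat \<Rightarrow> bool" where
  "h_section F d i v \<longleftrightarrow> pair (pair d i) v \<in> F"

lemma SQ_section [rel]:
  assumes "SX c F B" and "TM c d a"
  shows "SQ c (section_seq F d) (h_section B a)"
  unfolding section_seq_def h_section_def
  by (insert assms, (assumption | rule ext_refl rel SQ_I |
      (rule rel_mono, assumption))+)

lemma FM_section [rel]:
  assumes "SX c F B" and "TM c d a'" and "TM c i a" and "TM c v b"
  shows "FM c (section_seq F d i v) (h_section B a' a b)"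
  unfolding section_seq_def h_section_def
  by (insert assms, (assumption | rule ext_refl rel | (rule rel_mono, assumption))+)

lemma TM_fraction [rel]:
  assumes "TM c s a" and "TM c t b" and "TM c u d"
  shows "TM c (fraction s t u) (qfrac a b d)"
  unfolding fraction_def qfrac_def
  by (insert assms, (assumption | rule ext_refl rel | (rule rel_mono, assumption))+)

lemma FM_frac_le [rel]:
  assumes "TM c s a" and "TM c t b"
  shows "FM c (frac_le s t) (fle a b)"
  unfolding frac_le_def fle_def
  by (insert assms, (assumption | rule ext_refl rel | (rule rel_mono, assumption))+)

definition h_frac_eq :: "mnat \<Rightarrow> mnat \<Rightarrow> bool" where
  "h_frac_eq p q \<longleftrightarrow> (fle p q \<and> fle q p)"

lemma FM_frac_eq [rel]:
  assumes "TM c s a" and "TM c t b"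
  shows "FM c (frac_eq s t) (h_frac_eq a b)"
  unfolding frac_eq_def h_frac_eq_def
  by (insert assms, (assumption | rule ext_refl rel | (rule rel_mono, assumption))+)

lemma FM_rat [rel]:
  assumes "TM c s a"
  shows "FM c (rat s) (israt a)"
  unfolding rat_def israt_def isfrac_def h_frac_eq_def[symmetric]
  by (insert assms, (assumption | rule ext_refl rel | (rule rel_mono, assumption))+)

lemma CL_rat [rel]:
  shows "CL c rat israt"
  by (assumption | rule ext_refl rel CL_I |
      (rule rel_mono, assumption))+

lemma TM_rat_zero [rel]:
  shows "TM c rat_zero (qfrac 0 0 1)"
  unfolding rat_zero_def
  by (assumption | rule ext_refl rel | (rule rel_mono, assumption))+

definition h_pos_rat :: "mnat \<Rightarrow> bool" where
  "h_pos_rat q \<longleftrightarrow> (israt q \<and> \<not> fle q (qfrac 0 0 1))"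

lemma FM_pos_rat [rel]:
  assumes "TM c s a"
  shows "FM c (pos_rat s) (h_pos_rat a)"
  unfolding pos_rat_def h_pos_rat_def
  by (insert assms, (assumption | rule ext_refl rel | (rule rel_mono, assumption))+)

lemma CL_pos_rat [rel]:
  shows "CL c pos_rat h_pos_rat"
  by (assumption | rule ext_refl rel CL_I |
      (rule rel_mono, assumption))+

definition h_rat_add :: "mnat \<Rightarrow> mnat \<Rightarrow> mnat \<Rightarrow> bool" where
  "h_rat_add p q r \<longleftrightarrow> (israt r \<and> (\<exists>a b c a' b' c'. 0 < c \<and> 0 < c' \<and> p = qfrac a b c \<and>
      q = qfrac a' b' c' \<and> h_frac_eq r (qfrac (a * c' + a' * c) (b * c' + b' * c) (c * c'))))"

lemma FM_rat_add [rel]: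
  assumes "TM c s a" and "TM c t b" and "TM c u d"
  shows "FM c (rat_add s t u) (h_rat_add a b d)"
  unfolding rat_add_def h_rat_add_def
  by (insert assms, (assumption | rule ext_refl rel | (rule rel_mono, assumption))+)

definition h_pow2 :: "mnat \<Rightarrow> mnat \<Rightarrow> bool" where
  "h_pow2 k e \<longleftrightarrow> (\<exists>E\<in>sets. h_is_fun (\<lambda>x. x = x) (\<lambda>x. x = x) E \<and> h_seq E 0 1 \<and> (\<forall>i v. h_seq E i v \<longrightarrow>
      h_seq E (i + 1) (v + v)) \<and> h_seq E k e)"

lemma FM_pow2 [rel]:
  assumes "TM c s a" and "TM c t b"
  shows "FM c (pow2 s t) (h_pow2 a b)"
  unfolding pow2_def h_pow2_def
  by (insert assms, (assumption | rule ext_refl rel | (rule rel_mono, assumption))+)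

definition h_half_pow :: "mnat \<Rightarrow> mnat \<Rightarrow> bool" where
  "h_half_pow k q \<longleftrightarrow> (israt q \<and> (\<exists>e. h_pow2 k e \<and> h_frac_eq q (qfrac 1 0 e)))"

lemma FM_half_pow [rel]:
  assumes "TM c s a" and "TM c t b"
  shows "FM c (half_pow s t) (h_half_pow a b)"
  unfolding half_pow_def h_half_pow_def
  by (insert assms, (assumption | rule ext_refl rel | (rule rel_mono, assumption))+)

definition h_fast_cauchy :: "(mnat \<Rightarrow> mnat \<Rightarrow> bool) \<Rightarrow> bool" where
  "h_fast_cauchy R \<longleftrightarrow> (\<forall>i j p q. i \<le> j \<and> R i p \<and> R j q \<longrightarrow> (\<exists>e u v. h_half_pow i e \<and>
      h_rat_add p e u \<and> h_rat_add q e v \<and> fle p v \<and> fle q u))"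

lemma FM_fast_cauchy [rel]:
  assumes "SQ c R R'"
  shows "FM c (fast_cauchy R) (h_fast_cauchy R')"
  unfolding fast_cauchy_def h_fast_cauchy_def
  by (insert assms, (assumption | rule ext_refl rel SQ_D[OF assms(1)] |
      (rule rel_mono, assumption))+)

definition h_real_le :: "(mnat \<Rightarrow> mnat \<Rightarrow> bool) \<Rightarrow> (mnat \<Rightarrow> mnat \<Rightarrow> bool) \<Rightarrow> bool" where
  "h_real_le R S \<longleftrightarrow> (\<forall>k p q. R k p \<and> S k q \<longrightarrow> (\<exists>e u v. h_half_pow k e \<and> h_rat_add q e u \<and>
      h_rat_add u e v \<and> fle p v))"

lemma FM_real_le [rel]:
  assumes "SQ c R R'" and "SQ c S S'"
  shows "FM c (real_le R S) (h_real_le R' S')"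
  unfolding real_le_def h_real_le_def
  by (insert assms, (assumption | rule ext_refl rel SQ_D[OF assms(1)] SQ_D[OF assms(2)] |
      (rule rel_mono, assumption))+)

lemma FM_real_less [rel]:
  assumes "SQ c R R'" and "SQ c S S'"
  shows "FM c (real_less R S) (\<not> h_real_le S' R')"
  unfolding real_less_def
  by (insert assms, (assumption | rule ext_refl rel | (rule rel_mono, assumption))+)

definition h_real_eq :: "(mnat \<Rightarrow> mnat \<Rightarrow> bool) \<Rightarrow> (mnat \<Rightarrow> mnat \<Rightarrow> bool) \<Rightarrow> bool" where
  "h_real_eq R S \<longleftrightarrow> (h_real_le R S \<and> h_real_le S R)"

lemma FM_real_eq [rel]:
  assumes "SQ c R R'" and "SQ c S S'"
  shows "FM c (real_eq R S) (h_real_eq R' S')"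
  unfolding real_eq_def h_real_eq_def
  by (insert assms, (assumption | rule ext_refl rel | (rule rel_mono, assumption))+)

definition h_of_rat :: "mnat \<Rightarrow> mnat \<Rightarrow> mnat \<Rightarrow> bool" where
  "h_of_rat r k q \<longleftrightarrow> q = r"

lemma SQ_real_of_rat [rel]:
  assumes "TM c s a"
  shows "SQ c (real_of_rat s) (h_of_rat a)"
  unfolding real_of_rat_def h_of_rat_def
  by (insert assms, (assumption | rule ext_refl rel SQ_I |
      (rule rel_mono, assumption))+)

lemma SQ_real_zero [rel]:
  shows "SQ c real_zero (h_of_rat (qfrac 0 0 1))"
  unfolding real_zero_def
  by (assumption | rule ext_refl rel | (rule rel_mono, assumption))+

definition h_real_add :: "(mnat \<Rightarrow> mnat \<Rightarrow> bool) \<Rightarrow> (mnat \<Rightarrow> mnat \<Rightarrow> bool) \<Rightarrow> mnat \<Rightarrow> mnat \<Rightarrow> bool" where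
  "h_real_add R S k r \<longleftrightarrow> (\<exists>p q. R (k + 1) p \<and> S (k + 1) q \<and> h_rat_add p q r)"

lemma SQ_real_add [rel]:
  assumes "SQ c R R'" and "SQ c S S'"
  shows "SQ c (real_add R S) (h_real_add R' S')"
  unfolding real_add_def h_real_add_def
  by (insert assms, (assumption | rule ext_refl rel SQ_I SQ_D[OF assms(1)] SQ_D[OF assms(2)] |
      (rule rel_mono, assumption))+)

definition h_real_max :: "(mnat \<Rightarrow> mnat \<Rightarrow> bool) \<Rightarrow> (mnat \<Rightarrow> mnat \<Rightarrow> bool) \<Rightarrow> mnat \<Rightarrow> mnat \<Rightarrow> bool" where
  "h_real_max R S k r \<longleftrightarrow> (\<exists>p q. R k p \<and> S k q \<and> ((fle p q \<and> r = q) \<or> (fle q p \<and> r = p)))"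

lemma SQ_real_max [rel]:
  assumes "SQ c R R'" and "SQ c S S'"
  shows "SQ c (real_max R S) (h_real_max R' S')"
  unfolding real_max_def h_real_max_def
  by (insert assms, (assumption | rule ext_refl rel SQ_I SQ_D[OF assms(1)] SQ_D[OF assms(2)] |
      (rule rel_mono, assumption))+)

abbreviation h_dist :: "mnat set \<Rightarrow> mnat \<Rightarrow> mnat \<Rightarrow> mnat \<Rightarrow> mnat \<Rightarrow> bool" where
  "h_dist D a b \<equiv> h_section D (pair a b)"

lemma SQ_dist_code [rel]:
  assumes "SX c D E" and "TM c s a" and "TM c t b"
  shows "SQ c (dist_code D s t) (h_dist E a b)"
  unfolding dist_code_def
  by (insert assms, (assumption | rule ext_refl rel | (rule rel_mono, assumption))+)

lemma FM_dist_code [rel]: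
  assumes "SX c D E" and "TM c s a" and "TM c t b" and "TM c i d" and "TM c v f"
  shows "FM c (dist_code D s t i v) (h_dist E a b d f)"
  unfolding dist_code_def
  by (insert assms, (assumption | rule ext_refl rel | (rule rel_mono, assumption))+)

definition h_csm_space :: "mnat set \<Rightarrow> mnat set \<Rightarrow> bool" where
  "h_csm_space X D \<longleftrightarrow>
     ((\<exists>a. a \<in> X) &
      h_is_fun (h_pairs (h_pairs (\<lambda>x. x \<in> X) (\<lambda>x. x \<in> X)) (\<lambda>x. x = x)) israt D &
      (\<forall>a b. a \<in> X \<and> b \<in> X \<longrightarrow> h_fast_cauchy (h_dist D a b)) &
      (\<forall>a. a \<in> X \<longrightarrow> h_real_eq (h_dist D a a) (h_of_rat (qfrac 0 0 1))) &
      (\<forall>a b. a \<in> X \<and> b \<in> X \<longrightarrow>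
         h_real_eq (h_dist D a b) (h_dist D b a) \<and> h_real_le (h_of_rat (qfrac 0 0 1)) (h_dist D a
             b)) &
      (\<forall>a b c. a \<in> X \<and> b \<in> X \<and> c \<in> X \<longrightarrow>
         h_real_le (h_dist D a c) (h_real_add (h_dist D a b) (h_dist D b c))))"

lemma FM_csm_space [rel]:
  assumes "SX c X X'" and "SX c D D'"
  shows "FM c (csm_space X D) (h_csm_space X' D')"
  unfolding csm_space_def h_csm_space_def
  by (insert assms, (assumption | rule ext_refl rel | (rule rel_mono, assumption))+)

definition h_converges_fast :: "mnat set \<Rightarrow> (mnat \<Rightarrow> mnat \<Rightarrow> bool) \<Rightarrow> bool" where
  "h_converges_fast D x \<longleftrightarrow> (\<forall>i j a b e. i \<le> j \<and> x i a \<and> x j b \<and> h_half_pow i e \<longrightarrow>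
      h_real_le (h_dist D a b) (h_of_rat e))"

lemma FM_converges_fast [rel]:
  assumes "SX c D D'" and "SQ c R R'"
  shows "FM c (converges_fast D R) (h_converges_fast D' R')"
  unfolding converges_fast_def h_converges_fast_def
  by (insert assms, (assumption | rule ext_refl rel SQ_D[OF assms(2)] |
      (rule rel_mono, assumption))+)

definition h_point :: "mnat set \<Rightarrow> mnat set \<Rightarrow> mnat set \<Rightarrow> bool" where
  "h_point X D x \<longleftrightarrow> (h_is_fun (\<lambda>x. x = x) (\<lambda>a. a \<in> X) x \<and> h_converges_fast D (h_seq x))"

lemma FM_point [rel]:
  assumes "SX c X X'" and "SX c D D'" and "SX c x x'"
  shows "FM c (point X D x) (h_point X' D' x')"
  unfolding point_def h_point_def
  by (insert assms, (assumption | rule ext_refl rel | (rule rel_mono, assumption))+)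

lemma SQ_const_point [rel]:
  assumes "TM c s a"
  shows "SQ c (const_point s) (h_of_rat a)"
  unfolding const_point_def h_of_rat_def
  by (insert assms, (assumption | rule ext_refl rel SQ_I |
      (rule rel_mono, assumption))+)

definition h_point_dist :: "mnat set \<Rightarrow> (mnat \<Rightarrow> mnat \<Rightarrow> bool) \<Rightarrow> (mnat \<Rightarrow> mnat \<Rightarrow> bool) \<Rightarrow> mnat \<Rightarrow> mnat \<Rightarrow>
    bool" where
  "h_point_dist D x y k q \<longleftrightarrow> (\<exists>a b. x (k + 1 + 1) a \<and> y (k + 1 + 1) b \<and> h_dist D a b (k + 1 + 1) q)"

lemma SQ_point_dist [rel]:
  assumes "SX c D D'" and "SQ c R R'" and "SQ c S S'"
  shows "SQ c (point_dist D R S) (h_point_dist D' R' S')"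
  unfolding point_dist_def h_point_dist_def
  by (insert assms, (assumption | rule ext_refl rel SQ_I SQ_D[OF assms(2)] SQ_D[OF assms(3)] |
      (rule rel_mono, assumption))+)

definition h_point_eq :: "mnat set \<Rightarrow> mnat set \<Rightarrow> mnat set \<Rightarrow> bool" where
  "h_point_eq D x y \<longleftrightarrow> h_real_eq (h_point_dist D (h_seq x) (h_seq y)) (h_of_rat (qfrac 0 0 1))"

lemma FM_point_eq [rel]:
  assumes "SX c D D'" and "SX c x x'" and "SX c y y'"
  shows "FM c (point_eq D x y) (h_point_eq D' x' y')"
  unfolding point_eq_def h_point_eq_def
  by (insert assms, (assumption | rule ext_refl rel | (rule rel_mono, assumption))+)

definition h_ultrametric :: "mnat set \<Rightarrow> mnat set \<Rightarrow> bool" where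
  "h_ultrametric X D \<longleftrightarrow> (\<forall>x\<in>sets. \<forall>y\<in>sets. \<forall>z\<in>sets. h_point X D x \<and> h_point X D y \<and> h_point X D z \<longrightarrow>
      h_real_le (h_point_dist D (h_seq x) (h_seq y)) (h_real_max (h_point_dist D (h_seq x) (h_seq
      z)) (h_point_dist D (h_seq z) (h_seq y))))"

lemma FM_ultrametric [rel]:
  assumes "SX c X X'" and "SX c D D'"
  shows "FM c (ultrametric X D) (h_ultrametric X' D')"
  unfolding ultrametric_def h_ultrametric_def
  by (insert assms, (assumption | rule ext_refl rel | (rule rel_mono, assumption))+)

definition h_ball_seq :: "mnat set \<Rightarrow> mnat set \<Rightarrow> mnat set \<Rightarrow> mnat set \<Rightarrow> bool" where
  "h_ball_seq X D C R \<longleftrightarrow>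
     (h_is_fun (h_pairs (\<lambda>x. x = x) (\<lambda>x. x = x)) (\<lambda>a. a \<in> X) C &
      (\<forall>i. h_converges_fast D (h_section C i)) &
      h_is_fun (h_pairs (\<lambda>x. x = x) (\<lambda>x. x = x)) israt R &
      (\<forall>i. h_fast_cauchy (h_section R i) \<and> \<not> h_real_le (h_section R i) (h_of_rat (qfrac 0 0 1))))"

lemma FM_ball_seq [rel]:
  assumes "SX c X X'" and "SX c D D'" and "SX c C C'" and "SX c R R'"
  shows "FM c (ball_seq X D C R) (h_ball_seq X' D' C' R')"
  unfolding ball_seq_def h_ball_seq_def
  by (insert assms, (assumption | rule ext_refl rel | (rule rel_mono, assumption))+)

definition h_ball_prec :: "mnat set \<Rightarrow> (mnat \<Rightarrow> mnat \<Rightarrow> bool) \<Rightarrow> (mnat \<Rightarrow> mnat \<Rightarrow> bool) \<Rightarrow> (mnat \<Rightarrow> mnat \<Rightarrow>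
    bool) \<Rightarrow> (mnat \<Rightarrow> mnat \<Rightarrow> bool) \<Rightarrow> bool" where
  "h_ball_prec D x r y s \<longleftrightarrow> h_real_le (h_real_max (h_point_dist D x y) r) s"

lemma FM_ball_prec [rel]:
  assumes "SX c D D'" and "SQ c x x'" and "SQ c r r'" and "SQ c y y'" and "SQ c s s'"
  shows "FM c (ball_prec D x r y s) (h_ball_prec D' x' r' y' s')"
  unfolding ball_prec_def h_ball_prec_def
  by (insert assms, (assumption | rule ext_refl rel | (rule rel_mono, assumption))+)

definition h_in_ball :: "mnat set \<Rightarrow> (mnat \<Rightarrow> mnat \<Rightarrow> bool) \<Rightarrow> (mnat \<Rightarrow> mnat \<Rightarrow> bool) \<Rightarrow> (mnat \<Rightarrow> mnat \<Rightarrow>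
    bool) \<Rightarrow> bool" where
  "h_in_ball D y x r \<longleftrightarrow> h_real_le (h_point_dist D x y) r"

lemma FM_in_ball [rel]:
  assumes "SX c D D'" and "SQ c y y'" and "SQ c x x'" and "SQ c r r'"
  shows "FM c (in_ball D y x r) (h_in_ball D' y' x' r')"
  unfolding in_ball_def h_in_ball_def
  by (insert assms, (assumption | rule ext_refl rel | (rule rel_mono, assumption))+)

definition h_spherically_complete :: "mnat set \<Rightarrow> mnat set \<Rightarrow> bool" where
  "h_spherically_complete X D \<longleftrightarrow> (\<forall>C\<in>sets. \<forall>R\<in>sets. h_ball_seq X D C R \<and>
      (\<forall>i. h_ball_prec D (h_section C (i + 1)) (h_section R (i + 1)) (h_section C i) (h_section R
      i)) \<longrightarrow> (\<exists>x\<in>sets. h_point X D x \<and> (\<forall>i. h_in_ball D (h_seq x) (h_section C i) (h_section R i))))"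

lemma FM_spherically_complete [rel]:
  assumes "SX c X X'" and "SX c D D'"
  shows "FM c (spherically_complete X D) (h_spherically_complete X' D')"
  unfolding spherically_complete_def h_spherically_complete_def
  by (insert assms, (assumption | rule ext_refl rel | (rule rel_mono, assumption))+)

definition h_code_rel :: "mnat set \<Rightarrow> mnat \<Rightarrow> mnat \<Rightarrow> mnat \<Rightarrow> mnat \<Rightarrow> bool" where
  "h_code_rel F a r b s \<longleftrightarrow> (\<exists>n. pair (pair (pair (pair n a) r) b) s \<in> F)"

lemma FM_code_rel [rel]:
  assumes "SX c F F'" and "TM c a a'" and "TM c r r'" and "TM c b b'" and "TM c s s'"
  shows "FM c (code_rel F a r b s) (h_code_rel F' a' r' b' s')"
  unfolding code_rel_def h_code_rel_def
  by (insert assms, (assumption | rule ext_refl rel | (rule rel_mono, assumption))+)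

definition h_ball_less :: "mnat set \<Rightarrow> mnat \<Rightarrow> mnat \<Rightarrow> mnat \<Rightarrow> mnat \<Rightarrow> bool" where
  "h_ball_less D a' r' a r \<longleftrightarrow> \<not> h_real_le (h_of_rat r) (h_real_add (h_dist D a a') (h_of_rat r'))"

lemma FM_ball_less [rel]:
  assumes "SX c D D'" and "TM c a a'" and "TM c r r'" and "TM c b b'" and "TM c s s'"
  shows "FM c (ball_less D a r b s) (h_ball_less D' a' r' b' s')"
  unfolding ball_less_def h_ball_less_def
  by (insert assms, (assumption | rule ext_refl rel | (rule rel_mono, assumption))+)

definition h_continuous_code :: "mnat set \<Rightarrow> mnat set \<Rightarrow> mnat set \<Rightarrow> bool" where
  "h_continuous_code X D F \<longleftrightarrow>
     ((\<forall>z. z \<in> F \<longrightarrow> h_pairs (h_pairs (h_pairs (h_pairs (\<lambda>x. x = x) (\<lambda>x. x \<in> X)) h_pos_rat) (\<lambda>x. x \<in>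
         X)) h_pos_rat z) &
      (\<forall>a r b s b' s'. h_code_rel F a r b s \<and> h_code_rel F a r b' s' \<longrightarrow>
         h_real_le (h_dist D b b') (h_real_add (h_of_rat s) (h_of_rat s'))) &
      (\<forall>a r b s a' r'. h_code_rel F a r b s \<and> a' \<in> X \<and> h_pos_rat r' \<and> h_ball_less D a' r' a r \<longrightarrow>
         h_code_rel F a' r' b s) &
      (\<forall>a r b s b' s'. h_code_rel F a r b s \<and> b' \<in> X \<and> h_pos_rat s' \<and> h_ball_less D b s b' s' \<longrightarrow>
         h_code_rel F a r b' s'))"

lemma FM_continuous_code [rel]:
  assumes "SX c X X'" and "SX c D D'" and "SX c F F'"
  shows "FM c (continuous_code X D F) (h_continuous_code X' D' F')"
  unfolding continuous_code_def h_continuous_code_def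
  by (insert assms, (assumption | rule ext_refl rel | (rule rel_mono, assumption))+)

definition h_in_domain :: "mnat set \<Rightarrow> mnat set \<Rightarrow> mnat set \<Rightarrow> bool" where
  "h_in_domain D F x \<longleftrightarrow> (\<forall>e. h_pos_rat e \<longrightarrow> (\<exists>a r b s. h_code_rel F a r b s &
           \<not> h_real_le (h_of_rat r) (h_point_dist D (h_seq x) (h_of_rat a)) \<and>
               \<not> h_real_le (h_of_rat e) (h_of_rat s)))"

lemma FM_in_domain [rel]:
  assumes "SX c D D'" and "SX c F F'" and "SX c x x'"
  shows "FM c (in_domain D F x) (h_in_domain D' F' x')"
  unfolding in_domain_def h_in_domain_def
  by (insert assms, (assumption | rule ext_refl rel | (rule rel_mono, assumption))+)

definition h_total_function :: "mnat set \<Rightarrow> mnat set \<Rightarrow> mnat set \<Rightarrow> bool" where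
  "h_total_function X D F \<longleftrightarrow> (\<forall>x\<in>sets. h_point X D x \<longrightarrow> h_in_domain D F x)"

lemma FM_total_function [rel]:
  assumes "SX c X X'" and "SX c D D'" and "SX c F F'"
  shows "FM c (total_function X D F) (h_total_function X' D' F')"
  unfolding total_function_def h_total_function_def
  by (insert assms, (assumption | rule ext_refl rel | (rule rel_mono, assumption))+)

definition h_is_value :: "mnat set \<Rightarrow> mnat set \<Rightarrow> mnat set \<Rightarrow> mnat set \<Rightarrow> mnat set \<Rightarrow> bool" where
  "h_is_value X D F x y \<longleftrightarrow> (h_point X D y \<and> (\<forall>a r b s. h_code_rel F a r b s &
         \<not> h_real_le (h_of_rat r) (h_point_dist D (h_seq x) (h_of_rat a)) \<longrightarrow>
             h_real_le (h_point_dist D (h_seq y) (h_of_rat b)) (h_of_rat s)))"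

lemma FM_is_value [rel]:
  assumes "SX c X X'" and "SX c D D'" and "SX c F F'" and "SX c x x'" and "SX c y y'"
  shows "FM c (is_value X D F x y) (h_is_value X' D' F' x' y')"
  unfolding is_value_def h_is_value_def
  by (insert assms, (assumption | rule ext_refl rel | (rule rel_mono, assumption))+)

definition h_strictly_contracting :: "mnat set \<Rightarrow> mnat set \<Rightarrow> mnat set \<Rightarrow> bool" where
  "h_strictly_contracting X D F \<longleftrightarrow> (\<forall>x\<in>sets. \<forall>y\<in>sets. \<forall>u\<in>sets. \<forall>v\<in>sets. h_point X D x \<and>
      h_point X D y \<and> \<not> h_point_eq D x y &
        h_is_value X D F x u \<and> h_is_value X D F y v \<longrightarrow>
            \<not> h_real_le (h_point_dist D (h_seq x) (h_seq y)) (h_point_dist D (h_seq u) (h_seq v)))"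

lemma FM_strictly_contracting [rel]:
  assumes "SX c X X'" and "SX c D D'" and "SX c F F'"
  shows "FM c (strictly_contracting X D F) (h_strictly_contracting X' D' F')"
  unfolding strictly_contracting_def h_strictly_contracting_def
  by (insert assms, (assumption | rule ext_refl rel | (rule rel_mono, assumption))+)

definition h_fixed_point :: "mnat set \<Rightarrow> mnat set \<Rightarrow> mnat set \<Rightarrow> mnat set \<Rightarrow> bool" where
  "h_fixed_point X D F x \<longleftrightarrow> (h_point X D x \<and> (\<exists>y\<in>sets. h_is_value X D F x y \<and> h_point_eq D y x))"

lemma FM_fixed_point [rel]:
  assumes "SX c X X'" and "SX c D D'" and "SX c F F'" and "SX c x x'"
  shows "FM c (fixed_point X D F x) (h_fixed_point X' D' F' x')"
  unfolding fixed_point_def h_fixed_point_def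
  by (insert assms, (assumption | rule ext_refl rel | (rule rel_mono, assumption))+)

text \<open>With all notions interpreted, what remains is a statement of HOL about the members of
  \<open>sets\<close>.\<close>

lemma goal_reduction:
  assumes "\<And>X D F. X \<in> sets \<Longrightarrow> D \<in> sets \<Longrightarrow> F \<in> sets \<Longrightarrow> h_csm_space X D \<Longrightarrow> h_ultrametric X D \<Longrightarrow>
    h_spherically_complete X D \<Longrightarrow> h_continuous_code X D F \<Longrightarrow> h_total_function X D F \<Longrightarrow>
    h_strictly_contracting X D F \<Longrightarrow>
    \<exists>x\<in>sets. h_fixed_point X D F x \<and> (\<forall>y\<in>sets. h_fixed_point X D F y \<longrightarrow> h_point_eq D y x)"
  shows "RCA0 \<turnstile> goal"
proof (rule sat_goal)
  fix e :: "nat \<Rightarrow> mnat" and A :: "nat \<Rightarrow> mnat set"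
  let ?c = "Ctx 0 (\<lambda>_. 0) 0 (\<lambda>_. {}) e A"
  let ?P = "\<^bold>\<forall>\<^sub>S X D F.
       csm_space X D \<^bold>\<and> ultrametric X D \<^bold>\<and> spherically_complete X D \<^bold>\<and>
       continuous_code X D F \<^bold>\<and> total_function X D F \<^bold>\<and> strictly_contracting X D F \<^bold>\<longrightarrow>
       (\<^bold>\<exists>\<^sub>S x. fixed_point X D F x \<^bold>\<and> (\<^bold>\<forall>\<^sub>S y. fixed_point X D F y \<^bold>\<longrightarrow> point_eq D y x))"
  have "FM ?c ?P (\<forall>X\<in>sets. \<forall>D\<in>sets. \<forall>F\<in>sets.
       h_csm_space X D \<and> h_ultrametric X D \<and> h_spherically_complete X D &
       h_continuous_code X D F \<and> h_total_function X D F \<and> h_strictly_contracting X D F \<longrightarrow>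
       (\<exists>x\<in>sets. h_fixed_point X D F x \<and> (\<forall>y\<in>sets. h_fixed_point X D F y \<longrightarrow> h_point_eq D y x)))"
    by (assumption | rule ext_refl rel | (rule rel_mono, assumption))+
  then have "FM ?c ?P True" using assms by (auto simp: FM_def)
  then have "sat sets (nenv ?c) (senv ?c) (?P (nd ?c) (sd ?c))"
    unfolding FM_def using ext_refl by blast
  moreover have "nenv ?c = e" "senv ?c = A" by (simp_all add: nenv_def senv_def fun_eq_iff)
  ultimately show "sat sets e A goal" unfolding goal_def sentence_def by simp
qed

section \<open>Reals\<close>

lemma h_frac_eq_iff: "h_frac_eq p q \<longleftrightarrow> isfrac p \<and> isfrac q \<and> qv p = qv q"
  by (auto simp: h_frac_eq_def fle_iff)

lemma h_rat_add_iff: "h_rat_add p q r \<longleftrightarrow> isfrac p \<and> isfrac q \<and> r = code (qv p + qv q)"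
proof
  assume "h_rat_add p q r"
  then obtain a b c a' b' c' where *: "israt r" "0 < c" "0 < c'" "p = qfrac a b c" "q = qfrac a'
      b' c'"
    "qv r = qv (qfrac (a * c' + a' * c) (b * c' + b' * c) (c * c'))"
    unfolding h_rat_add_def h_frac_eq_iff by blast
  then have "qv r = qv p + qv q" by (simp add: field_simps)
  then show "isfrac p \<and> isfrac q \<and> r = code (qv p + qv q)" using * code_qv[of r] by simp
next
  assume *: "isfrac p \<and> isfrac q \<and> r = code (qv p + qv q)"
  then obtain a b c a' b' c' where c: "0 < c" "0 < c'" "p = qfrac a b c" "q = qfrac a' b' c'"
    unfolding isfrac_def by blast
  then have "qv p + qv q = qv (qfrac (a * c' + a' * c) (b * c' + b' * c) (c * c'))"
    by (simp add: field_simps)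
  then show "h_rat_add p q r" unfolding h_rat_add_def h_frac_eq_iff using * c
    by (metis code isfrac_qfrac mult_pos_pos)
qed

lemma qfrac_zero: "qfrac 0 0 1 = code 0"
proof -
  have "israt (qfrac 0 0 1)"
    unfolding israt_def fle_iff
  proof (intro conjI allI impI)
    fix p assume "p < qfrac 0 0 1"
    \<comment> \<open>The code \<open>qfrac 0 0 1\<close> is the number 1, so only 0 is smaller, and
      0 codes no fraction since a denominator is at most its code.\<close>
    then have "p < 0 + 1" by (simp add: qfrac_def pair_def)
    then have "p = 0" by (simp only: mnat_less_add_1) (simp add: le_less)
    moreover have "\<not> isfrac 0" unfolding isfrac_def by (metis qfrac_ge(3) leD)
    ultimately show "\<not> ((isfrac p \<and> isfrac (qfrac 0 0 1) \<and> qv p \<le> qv (qfrac 0 0 1)) \<and>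
      isfrac (qfrac 0 0 1) \<and> isfrac p \<and> qv (qfrac 0 0 1) \<le> qv p)" by simp
  qed simp
  moreover have "qv (qfrac 0 0 1) = 0" by simp
  ultimately show ?thesis using code_qv by metis
qed

lemma h_pos_rat_iff: "h_pos_rat q \<longleftrightarrow> israt q \<and> 0 < qv q"
  unfolding h_pos_rat_def qfrac_zero fle_iff by (auto simp: israt_def)

text \<open>Real arithmetic of the language is relational. \<open>rep\<close> replaces such a
  relation by the sequence of rationals whose codes it returns, so that comparisons become
  inequalities in a field.\<close>

definition rep :: "(mnat \<Rightarrow> mnat \<Rightarrow> bool) \<Rightarrow> (mnat \<Rightarrow> mrat) \<Rightarrow> bool" where
  "rep R \<rho> \<longleftrightarrow> (\<forall>k q. R k q \<longleftrightarrow> q = code (\<rho> k))"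

lemma rep_of_rat: "rep (h_of_rat (code x)) (\<lambda>_. x)"
  by (simp add: rep_def h_of_rat_def)

lemma rep_add: "rep R \<rho> \<Longrightarrow> rep S \<sigma> \<Longrightarrow> rep (h_real_add R S) (\<lambda>k. \<rho> (k + 1) + \<sigma> (k + 1))"
  by (simp add: rep_def h_real_add_def h_rat_add_iff)

lemma rep_max: "rep R \<rho> \<Longrightarrow> rep S \<sigma> \<Longrightarrow> rep (h_real_max R S) (\<lambda>k. max (\<rho> k) (\<sigma> k))"
  by (auto simp: rep_def h_real_max_def fle_iff max_def)

text \<open>Being given by reals, the metric witnesses the existence of powers of 2.\<close>

lemma exponential_exists:
  assumes "h_csm_space X D"
  obtains ex where "exponential ex" "\<And>k e. h_pow2 k e \<longleftrightarrow> ex k = e"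
proof -
  obtain a where a: "a \<in> X" using assms by (auto simp: h_csm_space_def)
  have "h_pairs (h_pairs (\<lambda>x. x \<in> X) (\<lambda>x. x \<in> X)) (\<lambda>x. x = x) (pair (pair a a) 0)"
    using a by (auto simp: h_pairs_def)
  then obtain p where "pair (pair (pair a a) 0) p \<in> D"
    using assms unfolding h_csm_space_def h_is_fun_def by blast
  then have "h_dist D a a 0 p" by (simp add: h_section_def)
  moreover have "h_fast_cauchy (h_dist D a a)" using assms a by (simp add: h_csm_space_def)
  \<comment> \<open>The Cauchy condition for i = j = 0 asserts that the 0-th power of 1/2 exists,
    and its definition brings a coded doubling function along.\<close>
  ultimately obtain e where "h_half_pow 0 e" unfolding h_fast_cauchy_def by blast
  then obtain E where E: "E \<in> sets" "h_is_fun (\<lambda>x. x = x) (\<lambda>x. x = x) E" "h_seq E 0 1"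
    "\<And>i v. h_seq E i v \<Longrightarrow> h_seq E (i + 1) (v + v)"
    unfolding h_half_pow_def h_pow2_def by blast
  have "\<exists>b. pair k b \<in> E \<and> (\<forall>d. pair k d \<in> E \<longrightarrow> d = b)" for k
    using E(2) by (auto simp: h_is_fun_def)
  then have "\<exists>ex. \<forall>k. pair k (ex k) \<in> E \<and> (\<forall>d. pair k d \<in> E \<longrightarrow> d = ex k)" by (intro choice) blast
  then obtain ex where ex: "\<And>k d. pair k d \<in> E \<longleftrightarrow> d = ex k" by blast
  have E_eq: "E = {z. \<exists>a. z = pair a (ex a)}"
    using E(2) ex by (auto simp: h_is_fun_def h_pairs_def)
  then have cf: "cf ex" using E(1) by (simp add: cf_def)
  have ex': "ex 0 = 1" "ex (k + 1) = ex k + ex k" for k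
    using E(3,4) ex by (auto simp: h_seq_def)
  have "h_pow2 k e \<longleftrightarrow> ex k = e" for k e
  proof
    show "h_pow2 k e" if "ex k = e"
      unfolding h_pow2_def using E that ex by (intro bexI[of _ E]) (auto simp: h_seq_def)
    assume "h_pow2 k e"
    then obtain E' where E': "E' \<in> sets" "h_is_fun (\<lambda>x. x = x) (\<lambda>x. x = x) E'" "h_seq E' 0 1"
      "\<And>i v. h_seq E' i v \<Longrightarrow> h_seq E' (i + 1) (v + v)" "h_seq E' k e"
      unfolding h_pow2_def by blast
    \<comment> \<open>Two coded functions with the same recursion agree by induction. Agreement is
      written as membership of a pair to make it \<open>Sigma01\<close>.\<close>
    have "\<exists>v. ex k = v \<and> pair k v \<in> E'" for k
    proof (rule sg_induct[of "\<lambda>k. \<exists>v. ex k = v \<and> pair k v \<in> E'"])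
      show "sg (\<lambda>e. \<exists>v. ex (e 0) = v \<and> pair (e 0) v \<in> E')"
        by (intro sg_ex sg_d0 d0_conj d0_cf[OF cf] d0_mem[OF _ E'(1)] tmf_pair tmf_var)
    qed (use E'(3,4) ex' in \<open>auto simp: h_seq_def\<close>)
    then have "pair k (ex k) \<in> E'" by blast
    with E'(2,5) show "ex k = e" unfolding h_is_fun_def h_seq_def by metis
  qed
  then show thesis using that[of ex] cf ex' by (simp add: exponential_def)
qed

section \<open>Comparison of reals through their cuts\<close>

context exponential
begin

definition fc :: "(mnat \<Rightarrow> mrat) \<Rightarrow> bool" where
  "fc \<rho> \<longleftrightarrow> (\<forall>i j. i \<le> j \<longrightarrow> \<rho> i \<le> \<rho> j + hp i \<and> \<rho> j \<le> \<rho> i + hp i)"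

text \<open>The lower cut of the real number given by \<open>\<rho>\<close>; reals are compared by inclusion.\<close>

definition cut :: "(mnat \<Rightarrow> mrat) \<Rightarrow> mrat set" where
  "cut \<rho> = {q. \<exists>k. q + hp k < \<rho> k}"

lemma hp_small: "0 < \<epsilon> \<Longrightarrow> \<exists>k\<ge>K. hp k < \<epsilon>"
proof -
  assume "0 < \<epsilon>"
  then obtain k where "hp k < \<epsilon>" using hp_archimedean by blast
  moreover have "hp (max k K) \<le> hp k" by (rule hp_mono) simp
  ultimately show ?thesis by (intro exI[of _ "max k K"]) simp
qed

lemma cut_down: "q \<in> cut \<rho> \<Longrightarrow> q' \<le> q \<Longrightarrow> q' \<in> cut \<rho>"
  unfolding cut_def by (auto intro: le_less_trans[OF add_right_mono])

lemma cut_open: "q \<in> cut \<rho> \<Longrightarrow> \<exists>q'>q. q' \<in> cut \<rho>"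
proof -
  assume "q \<in> cut \<rho>"
  then obtain k where k: "q + hp k < \<rho> k" by (auto simp: cut_def)
  then obtain q' where "q < q'" "q' < \<rho> k - hp k" using dense[of q "\<rho> k - hp k"] by (auto simp:
      less_diff_eq)
  then show ?thesis unfolding cut_def by (intro exI[of _ q']) (auto simp: less_diff_eq)
qed

lemma cut_linear: "cut \<rho> \<subseteq> cut \<sigma> \<or> cut \<sigma> \<subseteq> cut \<rho>"
  using cut_down by (meson linear subset_iff)

text \<open>By the Cauchy condition one witness yields a positive gap at all later indices.
  Arguments can then move to an index where the approximation errors are smaller than the
  gap.\<close>

lemma cut_late:
  assumes "fc \<rho>" "q \<in> cut \<rho>"
  obtains \<epsilon> K where "0 < \<epsilon>" "\<And>k. K \<le> k \<Longrightarrow> q + \<epsilon> \<le> \<rho> k"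
proof -
  obtain k where k: "q + hp k < \<rho> k" using assms(2) by (auto simp: cut_def)
  show thesis
  proof (rule that[of "\<rho> k - hp k - q" k])
    show "q + (\<rho> k - hp k - q) \<le> \<rho> j" if "k \<le> j" for j
      using assms(1) that unfolding fc_def by (auto simp: algebra_simps)
  qed (use k in \<open>simp add: algebra_simps\<close>)
qed

lemma cutI_late:
  assumes "0 < \<epsilon>" "\<And>k. K \<le> k \<Longrightarrow> q + \<epsilon> \<le> \<rho> k"
  shows "q \<in> cut \<rho>"
proof -
  obtain k where "K \<le> k" "hp k < \<epsilon>" using hp_small[OF assms(1)] by blast
  then have "q + hp k < \<rho> k" using assms(2)[of k] by linarith
  then show ?thesis by (auto simp: cut_def)
qed

definition le :: "(mnat \<Rightarrow> mrat) \<Rightarrow> (mnat \<Rightarrow> mrat) \<Rightarrow> bool" where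
  "le \<rho> \<sigma> \<longleftrightarrow> (\<forall>k. \<rho> k \<le> \<sigma> k + hp k + hp k)"

text \<open>Turns the indexwise comparison with tolerance into inclusion. Were it to fail at
  \<open>k\<close>, then \<open>\<sigma> k + hp k\<close> would lie in the cut of \<rho> but not in
  that of \<sigma>.\<close>

lemma le_iff_cut:
  assumes "fc \<rho>" "fc \<sigma>" shows "le \<rho> \<sigma> \<longleftrightarrow> cut \<rho> \<subseteq> cut \<sigma>"
proof
  assume le: "le \<rho> \<sigma>"
  show "cut \<rho> \<subseteq> cut \<sigma>"
  proof
    fix q assume "q \<in> cut \<rho>"
    then obtain \<epsilon> K where \<epsilon>: "0 < \<epsilon>" "\<And>k. K \<le> k \<Longrightarrow> q + \<epsilon> \<le> \<rho> k" using cut_late[OF assms(1)] by blast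
    \<comment> \<open>A quarter of the gap, so that the tolerance \<open>hp k + hp k\<close> uses up
      at most half of \<epsilon>.\<close>
    obtain K' where K': "K \<le> K'" "hp K' < \<epsilon> / 4" using hp_small[of "\<epsilon> / 4" K] \<epsilon>(1) by auto
    show "q \<in> cut \<sigma>"
    proof (rule cutI_late)
      show "0 < \<epsilon> / 2" using \<epsilon> by simp
      fix k assume "K' \<le> k"
      then have "hp k \<le> hp K'" "K \<le> k" using K' hp_mono by auto
      moreover have "\<rho> k \<le> \<sigma> k + hp k + hp k" using le by (simp add: le_def)
      ultimately show "q + \<epsilon> / 2 \<le> \<sigma> k" using \<epsilon>(2)[of k] K' by (simp add: field_simps)
    qed
  qed
next
  assume sub: "cut \<rho> \<subseteq> cut \<sigma>"
  show "le \<rho> \<sigma>"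
    unfolding le_def
  proof (intro allI, rule ccontr)
    fix k assume "\<not> \<rho> k \<le> \<sigma> k + hp k + hp k"
    then have "\<sigma> k + hp k \<in> cut \<rho>" unfolding cut_def not_le by blast
    with sub obtain m where m: "\<sigma> k + hp k + hp m < \<sigma> m" by (auto simp: cut_def)
    have "\<sigma> m \<le> \<sigma> k + hp k + hp m"
    proof (cases "k \<le> m")
      case True
      then have "\<sigma> m \<le> \<sigma> k + hp k" using assms(2) by (simp add: fc_def)
      then show ?thesis using hp_pos[of m] by linarith
    next
      case False
      then have "\<sigma> m \<le> \<sigma> k + hp m" using assms(2) by (simp add: fc_def)
      then show ?thesis using hp_pos[of k] by linarith
    qed
    with m show False by simp
  qed
qed

lemma fc_const: "fc (\<lambda>_. x)"
  by (simp add: fc_def)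

lemma fc_max: "fc \<rho> \<Longrightarrow> fc \<sigma> \<Longrightarrow> fc (\<lambda>k. max (\<rho> k) (\<sigma> k))"
  unfolding fc_def max_def
  by (intro allI impI) (smt (verit) add_right_mono order_trans linorder_not_le less_imp_le)

lemma cut_max: "cut (\<lambda>k. max (\<rho> k) (\<sigma> k)) = cut \<rho> \<union> cut \<sigma>"
  by (auto simp: cut_def less_max_iff_disj)

lemma cut_const: "cut (\<lambda>_. x) = {..<x}"
proof (intro set_eqI iffI)
  fix q assume "q \<in> {..<x}"
  then show "q \<in> cut (\<lambda>_. x)" by (intro cutI_late[of "x - q"]) auto
next
  fix q assume "q \<in> cut (\<lambda>_. x)"
  then obtain k where "q + hp k < x" by (auto simp: cut_def)
  then show "q \<in> {..<x}" using hp_pos[of k] by (simp only: lessThan_iff)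
qed

text \<open>\<open>U \<notin> cut \<rho>\<close> is read as: the real is at most \<open>U\<close>.
  Upper bounds on distances are expressed in this way from here on.\<close>

lemma not_cut: "U \<notin> cut \<rho> \<longleftrightarrow> (\<forall>k. \<rho> k \<le> U + hp k)"
  by (auto simp: cut_def not_less)

lemma not_cut_approx: "fc \<rho> \<Longrightarrow> \<rho> k + hp k \<notin> cut \<rho>"
proof
  assume "fc \<rho>" "\<rho> k + hp k \<in> cut \<rho>"
  then obtain \<epsilon> K where \<epsilon>: "0 < \<epsilon>" "\<And>j. K \<le> j \<Longrightarrow> \<rho> k + hp k + \<epsilon> \<le> \<rho> j" using cut_late by blast
  have "\<rho> (max k K) \<le> \<rho> k + hp k" using \<open>fc \<rho>\<close> by (simp add: fc_def)
  with \<epsilon>(2)[of "max k K"] \<epsilon>(1) show False by simp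
qed

lemma less_const_iff:
  assumes "fc \<rho>"
  shows "\<not> le (\<lambda>_. r) \<rho> \<longleftrightarrow> (\<exists>q<r. q \<notin> cut \<rho>)"
  unfolding le_iff_cut[OF fc_const assms] cut_const by auto

end

section \<open>The metric on the dense set\<close>

locale pow_space = exponential ex for ex +
  fixes X D :: "mnat set"
  assumes pow2: "h_pow2 k e \<longleftrightarrow> ex k = e" and csm: "h_csm_space X D"
    and X_set: "X \<in> sets" and D_set: "D \<in> sets"
begin

lemma half_pow: "h_half_pow k q \<longleftrightarrow> q = code (hp k)"
proof -
  have "h_half_pow k q \<longleftrightarrow> israt q \<and> qv q = hp k"
    unfolding h_half_pow_def pow2 h_frac_eq_iff by (auto simp: hp_def israt_isfrac)
  then show ?thesis using code_qv by (metis code(1,2))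
qed

lemma real_le_iff: "rep R \<rho> \<Longrightarrow> rep S \<sigma> \<Longrightarrow> h_real_le R S \<longleftrightarrow> le \<rho> \<sigma>"
  by (simp add: rep_def h_real_le_def half_pow h_rat_add_iff fle_iff le_def add.assoc)

lemma fast_cauchy_iff: "rep R \<rho> \<Longrightarrow> h_fast_cauchy R \<longleftrightarrow> fc \<rho>"
  by (simp add: rep_def h_fast_cauchy_def half_pow h_rat_add_iff fle_iff fc_def)

definition \<delta> :: "mnat \<Rightarrow> mnat \<Rightarrow> mnat \<Rightarrow> mrat" where
  "\<delta> a b k = qv (THE v. pair (pair (pair a b) k) v \<in> D)"

lemma dist_iff:
  assumes "a \<in> X" "b \<in> X"
  shows "pair (pair (pair a b) k) v \<in> D \<longleftrightarrow> v = code (\<delta> a b k)"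
proof -
  have f: "h_is_fun (h_pairs (h_pairs (\<lambda>x. x \<in> X) (\<lambda>x. x \<in> X)) (\<lambda>x. x = x)) israt D"
    using csm by (simp add: h_csm_space_def)
  have "h_pairs (h_pairs (\<lambda>x. x \<in> X) (\<lambda>x. x \<in> X)) (\<lambda>x. x = x) (pair (pair a b) k)"
    using assms by (auto simp: h_pairs_def)
  then obtain w where w: "pair (pair (pair a b) k) w \<in> D"
    "\<And>d. pair (pair (pair a b) k) d \<in> D \<Longrightarrow> d = w"
    using f unfolding h_is_fun_def by blast
  then have the: "(THE v. pair (pair (pair a b) k) v \<in> D) = w" by blast
  have "israt w" using f w(1) unfolding h_is_fun_def h_pairs_def by auto
  then have "code (\<delta> a b k) = w" by (simp add: \<delta>_def the code_qv)
  then show ?thesis using w by blast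
qed

lemma rep_dist: "a \<in> X \<Longrightarrow> b \<in> X \<Longrightarrow> rep (h_dist D a b) (\<delta> a b)"
  by (simp add: rep_def h_section_def dist_iff)

lemma fc_\<delta>: "a \<in> X \<Longrightarrow> b \<in> X \<Longrightarrow> fc (\<delta> a b)"
  using csm fast_cauchy_iff[OF rep_dist] by (simp add: h_csm_space_def)

lemma \<delta>_self: "a \<in> X \<Longrightarrow> 0 \<notin> cut (\<delta> a a)"
proof -
  assume a: "a \<in> X"
  then have "h_real_le (h_dist D a a) (h_of_rat (code 0))"
    using csm by (simp add: h_csm_space_def h_real_eq_def qfrac_zero)
  then show ?thesis using real_le_iff[OF rep_dist[OF a a] rep_of_rat]
    by (auto simp: le_iff_cut[OF fc_\<delta>[OF a a] fc_const] cut_const)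
qed

lemma \<delta>_nonneg: "a \<in> X \<Longrightarrow> b \<in> X \<Longrightarrow> q < 0 \<Longrightarrow> q \<in> cut (\<delta> a b)"
proof -
  assume a: "a \<in> X" "b \<in> X" "q < 0"
  then have "h_real_le (h_of_rat (code 0)) (h_dist D a b)"
    using csm by (simp add: h_csm_space_def qfrac_zero)
  then show ?thesis using real_le_iff[OF rep_of_rat rep_dist[OF a(1,2)]] a(3)
    by (auto simp: le_iff_cut[OF fc_const fc_\<delta>[OF a(1,2)]] cut_const)
qed

lemma \<delta>_sym: "a \<in> X \<Longrightarrow> b \<in> X \<Longrightarrow> cut (\<delta> a b) = cut (\<delta> b a)"
proof -
  have "cut (\<delta> a b) \<subseteq> cut (\<delta> b a)" if "a \<in> X" "b \<in> X" for a b
  proof -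
    have "h_real_le (h_dist D a b) (h_dist D b a)"
      using csm that by (simp add: h_csm_space_def h_real_eq_def)
    then show ?thesis using that by (simp add: real_le_iff[OF rep_dist rep_dist] le_iff_cut fc_\<delta>)
  qed
  then show "a \<in> X \<Longrightarrow> b \<in> X \<Longrightarrow> cut (\<delta> a b) = cut (\<delta> b a)" by blast
qed

text \<open>Formulating the inequality with rational upper bounds avoids a sum of cuts.\<close>

lemma \<delta>_triangle:
  assumes X: "a \<in> X" "b \<in> X" "c \<in> X" and U: "U \<notin> cut (\<delta> a b)" and V: "V \<notin> cut (\<delta> b c)"
  shows "U + V \<notin> cut (\<delta> a c)"
proof
  assume "U + V \<in> cut (\<delta> a c)"
  then obtain \<epsilon> K where \<epsilon>: "0 < \<epsilon>" "\<And>k. K \<le> k \<Longrightarrow> U + V + \<epsilon> \<le> \<delta> a c k"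
    using cut_late[OF fc_\<delta>] X by blast
  \<comment> \<open>The bounds at index k + 1 cost half of \<open>hp k\<close> each and the
    tolerance costs \<open>hp k\<close> twice: three times \<open>hp k\<close> in all, less than
    \<epsilon>.\<close>
  obtain k where k: "K \<le> k" "hp k < \<epsilon> / 4" using hp_small[of "\<epsilon> / 4"] \<epsilon>(1) by auto
  have "h_real_le (h_dist D a c) (h_real_add (h_dist D a b) (h_dist D b c))"
    using csm X by (simp add: h_csm_space_def)
  then have "\<delta> a c k \<le> \<delta> a b (k + 1) + \<delta> b c (k + 1) + hp k + hp k"
    using real_le_iff[OF rep_dist rep_add[OF rep_dist rep_dist]] X by (simp add: le_def)
  moreover have "\<delta> a b (k + 1) \<le> U + hp (k + 1)" "\<delta> b c (k + 1) \<le> V + hp (k + 1)"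
    using U V by (simp_all add: not_cut)
  ultimately show False using \<epsilon>(2)[OF k(1)] k(2) hp_pos[of k] unfolding hp_Suc by linarith
qed

end

section \<open>Points\<close>

definition graph :: "(mnat \<Rightarrow> mnat) \<Rightarrow> mnat set" where
  "graph f = {z. \<exists>a. z = pair a (f a)}"

definition fseq :: "(mnat \<Rightarrow> mnat) \<Rightarrow> mnat \<Rightarrow> mnat \<Rightarrow> bool" where
  "fseq f i v \<longleftrightarrow> v = f i"

lemma cf_graph: "cf f \<longleftrightarrow> graph f \<in> sets"
  by (simp add: cf_def graph_def)

lemma pair_graph [simp]: "pair a b \<in> graph f \<longleftrightarrow> b = f a"
  by (auto simp: graph_def)

lemma h_seq_graph: "h_seq (graph f) = fseq f"
  by (auto simp: fun_eq_iff h_seq_def fseq_def)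

lemma h_of_rat_fseq: "h_of_rat a = fseq (\<lambda>_. a)"
  by (auto simp: fun_eq_iff h_of_rat_def fseq_def)

lemma cf_const: "cf (\<lambda>_. a)"
  by (intro sg_cf sg_d0 d0_eq tmf_intros)

lemma h_is_fun_graph: "h_is_fun (\<lambda>x. x = x) P x \<longleftrightarrow> (\<exists>f. x = graph f \<and> (\<forall>i. P (f i)))"
proof
  assume f: "h_is_fun (\<lambda>x. x = x) P x"
  then have "\<exists>b. pair k b \<in> x \<and> (\<forall>d. pair k d \<in> x \<longrightarrow> d = b)" for k
    by (auto simp: h_is_fun_def)
  then have "\<exists>f. \<forall>k. pair k (f k) \<in> x \<and> (\<forall>d. pair k d \<in> x \<longrightarrow> d = f k)" by (intro choice) blast
  then obtain g where g: "\<And>k d. pair k d \<in> x \<longleftrightarrow> d = g k" by blast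
  have pairs: "\<exists>a b. P b \<and> z = pair a b" if "z \<in> x" for z
    using f that by (auto simp: h_is_fun_def h_pairs_def)
  have "x = graph g"
  proof (intro set_eqI iffI)
    fix z assume z: "z \<in> x"
    then obtain a b where "z = pair a b" using pairs by blast
    with z g show "z \<in> graph g" by simp
  qed (use g in \<open>auto simp: graph_def\<close>)
  moreover have "P (g i)" for i using pairs[of "pair i (g i)"] g by auto
  ultimately show "\<exists>f. x = graph f \<and> (\<forall>i. P (f i))" by blast
next
  assume "\<exists>f. x = graph f \<and> (\<forall>i. P (f i))"
  then show "h_is_fun (\<lambda>x. x = x) P x" by (auto simp: h_is_fun_def h_pairs_def graph_def)
qed

context pow_space
begin

text \<open>This is the convergence condition alone; membership in the model is added in
  \<open>Pt\<close>. Symmetry and approximation hold for all such sequences, whereas the ultrametric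
  law is assumed for coded points.\<close>

definition fast :: "(mnat \<Rightarrow> mnat) \<Rightarrow> bool" where
  "fast \<xi> \<longleftrightarrow> (\<forall>i. \<xi> i \<in> X) \<and> (\<forall>i j. i \<le> j \<longrightarrow> hp i \<notin> cut (\<delta> (\<xi> i) (\<xi> j)))"

definition Pt :: "(mnat \<Rightarrow> mnat) \<Rightarrow> bool" where
  "Pt \<xi> \<longleftrightarrow> cf \<xi> \<and> fast \<xi>"

definition pd :: "(mnat \<Rightarrow> mnat) \<Rightarrow> (mnat \<Rightarrow> mnat) \<Rightarrow> mnat \<Rightarrow> mrat" where
  "pd \<xi> \<eta> k = \<delta> (\<xi> (k + 1 + 1)) (\<eta> (k + 1 + 1)) (k + 1 + 1)"

text \<open>As for cuts in general, \<open>q \<notin> d \<xi> \<eta>\<close> says that the distance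
  is at most \<open>q\<close>. In particular \<open>0 \<notin> d \<xi> \<eta>\<close> is equality of
  points.\<close>

definition d :: "(mnat \<Rightarrow> mnat) \<Rightarrow> (mnat \<Rightarrow> mnat) \<Rightarrow> mrat set" where
  "d \<xi> \<eta> = cut (pd \<xi> \<eta>)"

abbreviation cp :: "mnat \<Rightarrow> mnat \<Rightarrow> mnat" where "cp a \<equiv> (\<lambda>_. a)"

lemma fastD: "fast \<xi> \<Longrightarrow> \<xi> i \<in> X"
  by (simp add: fast_def)

lemma Pt_fast: "Pt \<xi> \<Longrightarrow> fast \<xi>"
  by (simp add: Pt_def)

lemma fast_cp: "a \<in> X \<Longrightarrow> fast (cp a)"
  unfolding fast_def using \<delta>_self cut_down hp_nonneg by blast

lemma Pt_cp: "a \<in> X \<Longrightarrow> Pt (cp a)"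
  by (simp add: Pt_def fast_cp cf_const)

lemma le_const_iff: "fc \<rho> \<Longrightarrow> le \<rho> (\<lambda>_. x) \<longleftrightarrow> x \<notin> cut \<rho>"
  unfolding le_iff_cut[OF _ fc_const] cut_const using cut_down by (auto simp: not_less[symmetric])

lemma converges_fast_iff:
  assumes "\<And>i. \<xi> i \<in> X"
  shows "h_converges_fast D (fseq \<xi>) \<longleftrightarrow> fast \<xi>"
  using assms
  by (simp add: h_converges_fast_def fast_def fseq_def half_pow real_le_iff[OF rep_dist rep_of_rat]
      le_const_iff fc_\<delta>)

lemma h_point_iff: "x \<in> sets \<Longrightarrow> h_point X D x \<longleftrightarrow> (\<exists>\<xi>. Pt \<xi> \<and> x = graph \<xi>)"
  unfolding h_point_def h_is_fun_graph Pt_def cf_graph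
  using converges_fast_iff h_seq_graph fastD by metis

lemma rep_pd: "fast \<xi> \<Longrightarrow> fast \<eta> \<Longrightarrow> rep (h_point_dist D (fseq \<xi>) (fseq \<eta>)) (pd \<xi> \<eta>)"
  unfolding rep_def h_point_dist_def fseq_def h_section_def
  by (simp add: dist_iff fastD pd_def)

lemma fast_sym: "fast \<xi> \<Longrightarrow> i \<le> j \<Longrightarrow> hp i \<notin> cut (\<delta> (\<xi> j) (\<xi> i))"
  using \<delta>_sym fastD by (metis fast_def)

lemma fc_pd:
  assumes "fast \<xi>" "fast \<eta>" shows "fc (pd \<xi> \<eta>)"
proof -
  \<comment> \<open>Passing from index i to index j costs \<open>hp n\<close> for each of the two
    points and \<open>hp i\<close>, \<open>hp j\<close> for the rational approximations, together at
    most four times \<open>hp n\<close>. The shift by two in \<open>pd\<close> compensates for the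
    factor 4.\<close>
  have *: "\<delta> (\<xi> i) (\<eta> i) i \<le> \<delta> (\<xi> j) (\<eta> j) j + 4 * hp n"
    if "hp i \<le> hp n" "hp j \<le> hp n" "hp n \<notin> cut (\<delta> (\<xi> i) (\<xi> j))" "hp n \<notin> cut (\<delta> (\<eta> j) (\<eta> i))" for i
        j n
  proof -
    let ?r = "\<delta> (\<xi> j) (\<eta> j) j + hp j"
    have X: "\<xi> i \<in> X" "\<xi> j \<in> X" "\<eta> i \<in> X" "\<eta> j \<in> X" using assms fastD by auto
    have "?r \<notin> cut (\<delta> (\<xi> j) (\<eta> j))" using X by (intro not_cut_approx fc_\<delta>)
    then have "hp n + ?r \<notin> cut (\<delta> (\<xi> i) (\<eta> j))"
      using X that(3) \<delta>_triangle[of "\<xi> i" "\<xi> j" "\<eta> j"] by blast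
    then have "hp n + ?r + hp n \<notin> cut (\<delta> (\<xi> i) (\<eta> i))"
      using X that(4) \<delta>_triangle[of "\<xi> i" "\<eta> j" "\<eta> i"] by blast
    then have "\<delta> (\<xi> i) (\<eta> i) i \<le> hp n + ?r + hp n + hp i" by (simp add: not_cut)
    with that show ?thesis by linarith
  qed
  have h: "hp i = 4 * hp (i + 1 + 1)" for i by (simp only: hp_Suc)
  show ?thesis
    unfolding fc_def
  proof (intro allI impI)
    fix i j :: mnat assume ij: "i \<le> j"
    let ?i = "i + 1 + 1" and ?j = "j + 1 + 1"
    have le: "?i \<le> ?j" using ij by simp
    have "hp ?j \<le> hp ?i" by (rule hp_mono[OF le])
    moreover have "hp ?i \<notin> cut (\<delta> (\<xi> ?i) (\<xi> ?j))" "hp ?i \<notin> cut (\<delta> (\<eta> ?i) (\<eta> ?j))"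
      "hp ?i \<notin> cut (\<delta> (\<xi> ?j) (\<xi> ?i))" "hp ?i \<notin> cut (\<delta> (\<eta> ?j) (\<eta> ?i))"
      using assms le fast_sym unfolding fast_def by blast+
    ultimately have "\<delta> (\<xi> ?i) (\<eta> ?i) ?i \<le> \<delta> (\<xi> ?j) (\<eta> ?j) ?j + 4 * hp ?i"
      "\<delta> (\<xi> ?j) (\<eta> ?j) ?j \<le> \<delta> (\<xi> ?i) (\<eta> ?i) ?i + 4 * hp ?i"
      using *[of ?i ?i ?j] *[of ?j ?i ?i] by simp_all
    then show "pd \<xi> \<eta> i \<le> pd \<xi> \<eta> j + hp i \<and> pd \<xi> \<eta> j \<le> pd \<xi> \<eta> i + hp i"
      unfolding pd_def h[of i] by blast
  qed
qed

lemma le_Suc_Suc: "k \<le> k + 1 + (1 :: mnat)"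
  by (simp add: add.assoc)

lemma hp_Suc_Suc: "hp (k + 1 + 1) \<le> hp k"
  by (rule hp_mono) (rule le_Suc_Suc)

lemma d_down: "q \<in> d \<xi> \<eta> \<Longrightarrow> q' \<le> q \<Longrightarrow> q' \<in> d \<xi> \<eta>"
  unfolding d_def by (rule cut_down)

lemma d_up: "q \<notin> d \<xi> \<eta> \<Longrightarrow> q \<le> q' \<Longrightarrow> q' \<notin> d \<xi> \<eta>"
  using d_down by blast

lemma d_open: "q \<in> d \<xi> \<eta> \<Longrightarrow> \<exists>q'>q. q' \<in> d \<xi> \<eta>"
  unfolding d_def by (rule cut_open)

lemma d_linear: "d \<xi> \<eta> \<subseteq> d \<xi>' \<eta>' \<or> d \<xi>' \<eta>' \<subseteq> d \<xi> \<eta>"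
  unfolding d_def by (rule cut_linear)

lemma d_sym:
  assumes "fast \<xi>" "fast \<eta>" shows "d \<xi> \<eta> = d \<eta> \<xi>"
proof -
  have "d \<xi> \<eta> \<subseteq> d \<eta> \<xi>" if "fast \<xi>" "fast \<eta>" for \<xi> \<eta>
    unfolding d_def le_iff_cut[OF fc_pd[OF that] fc_pd[OF that(2,1)], symmetric] le_def
  proof
    fix k :: mnat
    let ?k = "k + 1 + 1"
    have X: "\<xi> ?k \<in> X" "\<eta> ?k \<in> X" using that fastD by auto
    then have "\<delta> (\<eta> ?k) (\<xi> ?k) ?k + hp ?k \<notin> cut (\<delta> (\<xi> ?k) (\<eta> ?k))"
      using not_cut_approx[OF fc_\<delta>] \<delta>_sym by metis
    then have "\<delta> (\<xi> ?k) (\<eta> ?k) ?k \<le> \<delta> (\<eta> ?k) (\<xi> ?k) ?k + hp ?k + hp ?k" unfolding not_cut by blast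
    then show "pd \<xi> \<eta> k \<le> pd \<eta> \<xi> k + hp k + hp k"
      unfolding pd_def using hp_Suc_Suc[of k] by linarith
  qed
  with assms show ?thesis by blast
qed

lemma d_neg:
  assumes "fast \<xi>" "fast \<eta>" "q < 0" shows "q \<in> d \<xi> \<eta>"
proof -
  obtain k where k: "hp k < - q / 2" using hp_archimedean[of "- q / 2"] assms(3) by auto
  let ?k = "k + 1 + 1"
  have "\<delta> (\<xi> ?k) (\<eta> ?k) ?k + hp ?k \<notin> cut (\<delta> (\<xi> ?k) (\<eta> ?k))"
    using assms fastD by (intro not_cut_approx fc_\<delta>) auto
  then have "0 \<le> \<delta> (\<xi> ?k) (\<eta> ?k) ?k + hp ?k"
    using \<delta>_nonneg[of "\<xi> ?k" "\<eta> ?k"] assms fastD not_less by metis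
  then have "q + hp k < pd \<xi> \<eta> k" unfolding pd_def using k hp_Suc_Suc[of k] by linarith
  then show ?thesis by (auto simp: d_def cut_def)
qed

lemma d_nonneg: "fast \<xi> \<Longrightarrow> fast \<eta> \<Longrightarrow> q \<notin> d \<xi> \<eta> \<Longrightarrow> 0 \<le> q"
  using d_neg not_less by blast

lemma d_self: "fast \<xi> \<Longrightarrow> 0 \<notin> d \<xi> \<xi>"
proof -
  assume f: "fast \<xi>"
  have "pd \<xi> \<xi> k \<le> 0 + hp k" for k
    using \<delta>_self[OF fastD[OF f], of "k + 1 + 1"] hp_Suc_Suc[of k] unfolding not_cut pd_def
    by (meson add_left_mono order_trans)
  then show ?thesis by (simp add: d_def not_cut)
qed

lemma d_cp: "a \<in> X \<Longrightarrow> b \<in> X \<Longrightarrow> d (cp a) (cp b) = cut (\<delta> a b)"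
proof (intro equalityI subsetI)
  fix q assume X: "a \<in> X" "b \<in> X" and q: "q \<in> cut (\<delta> a b)"
  then obtain \<epsilon> K where \<epsilon>: "0 < \<epsilon>" "\<And>k. K \<le> k \<Longrightarrow> q + \<epsilon> \<le> \<delta> a b k"
    using cut_late[OF fc_\<delta>] by blast
  show "q \<in> d (cp a) (cp b)"
    unfolding d_def
  proof (rule cutI_late[OF \<epsilon>(1)])
    fix k assume "K \<le> k"
    then have "K \<le> k + 1 + 1" using le_Suc_Suc by (rule order_trans)
    then show "q + \<epsilon> \<le> pd (cp a) (cp b) k" unfolding pd_def by (rule \<epsilon>(2))
  qed
next
  fix q assume X: "a \<in> X" "b \<in> X" and q: "q \<in> d (cp a) (cp b)"
  then obtain k where "q + hp k < \<delta> a b (k + 1 + 1)" by (auto simp: d_def cut_def pd_def)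
  then have "q + hp (k + 1 + 1) < \<delta> a b (k + 1 + 1)" using hp_Suc_Suc[of k] by linarith
  then show "q \<in> cut (\<delta> a b)" by (auto simp: cut_def)
qed

lemma d_approx:
  assumes "fast \<xi>" shows "hp n \<notin> d \<xi> (cp (\<xi> n))"
proof
  assume "hp n \<in> d \<xi> (cp (\<xi> n))"
  then obtain \<epsilon> K where \<epsilon>: "0 < \<epsilon>" "\<And>k. K \<le> k \<Longrightarrow> hp n + \<epsilon> \<le> pd \<xi> (cp (\<xi> n)) k"
    unfolding d_def using cut_late[OF fc_pd] assms fast_cp fastD by blast
  obtain k where k: "max K n \<le> k" "hp k < \<epsilon>" using hp_small[OF \<epsilon>(1)] by blast
  have "n \<le> k + 1 + 1" using k(1) le_Suc_Suc[of k] by (meson max.boundedE order_trans)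
  then have "hp n \<notin> cut (\<delta> (\<xi> (k + 1 + 1)) (\<xi> n))" using assms by (intro fast_sym)
  then have "pd \<xi> (cp (\<xi> n)) k \<le> hp n + hp (k + 1 + 1)" by (simp add: not_cut pd_def)
  with \<epsilon>(2)[of k] k hp_Suc_Suc[of k] show False by simp
qed

text \<open>A form of d(\<xi>, a) < r with an explicit index as witness, so that membership of a
  point in an open ball can be searched for.\<close>

definition lt :: "(mnat \<Rightarrow> mnat) \<Rightarrow> mnat \<Rightarrow> mrat \<Rightarrow> bool" where
  "lt \<xi> a r \<longleftrightarrow> (\<exists>k. pd \<xi> (cp a) k + hp k + hp k < r)"

lemma lt_real_less:
  assumes "fast \<xi>" "a \<in> X" "israt r"
  shows "\<not> h_real_le (h_of_rat r) (h_point_dist D (fseq \<xi>) (fseq (cp a))) \<longleftrightarrow> lt \<xi> a (qv r)"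
proof -
  obtain x where r: "r = code x" using assms(3) code_qv by metis
  show ?thesis
    unfolding r using real_le_iff[OF rep_of_rat rep_pd[OF assms(1) fast_cp[OF assms(2)]]]
    by (simp add: le_def lt_def not_le)
qed

lemma lt_iff:
  assumes "fast \<xi>" "a \<in> X"
  shows "lt \<xi> a r \<longleftrightarrow> (\<exists>q<r. q \<notin> d \<xi> (cp a))"
  using less_const_iff[OF fc_pd[OF assms(1) fast_cp[OF assms(2)]], of r]
  by (simp add: le_def lt_def not_le d_def)

lemma h_point_eq_iff:
  assumes "fast \<xi>" "fast \<eta>"
  shows "h_point_eq D (graph \<xi>) (graph \<eta>) \<longleftrightarrow> 0 \<notin> d \<xi> \<eta>"
proof -
  note f = fc_pd[OF assms]
  have "h_point_eq D (graph \<xi>) (graph \<eta>) \<longleftrightarrow> le (pd \<xi> \<eta>) (\<lambda>_. 0) \<and> le (\<lambda>_. 0) (pd \<xi> \<eta>)"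
    unfolding h_point_eq_def h_real_eq_def h_seq_graph qfrac_zero
    using real_le_iff[OF rep_pd[OF assms] rep_of_rat] real_le_iff[OF rep_of_rat rep_pd[OF assms]]
        by simp
  also have "\<dots> \<longleftrightarrow> 0 \<notin> d \<xi> \<eta>"
    unfolding le_const_iff[OF f] le_iff_cut[OF fc_const f] cut_const
    using d_neg[OF assms] by (auto simp: d_def)
  finally show ?thesis .
qed

end

locale ultra_space = pow_space +
  assumes ultra: "h_ultrametric X D"
begin

text \<open>The union of two cuts is the cut of the maximum.\<close>

lemma d_ultra:
  assumes "Pt \<xi>" "Pt \<eta>" "Pt \<zeta>"
  shows "d \<xi> \<eta> \<subseteq> d \<xi> \<zeta> \<union> d \<zeta> \<eta>"
proof -
  note f = assms[THEN Pt_fast]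
  have s: "graph \<xi> \<in> sets" "graph \<eta> \<in> sets" "graph \<zeta> \<in> sets"
    using assms by (auto simp: Pt_def cf_graph)
  have "h_point X D (graph \<xi>)" "h_point X D (graph \<eta>)" "h_point X D (graph \<zeta>)"
    using s assms by (auto simp: h_point_iff)
  then have "h_real_le (h_point_dist D (fseq \<xi>) (fseq \<eta>))
      (h_real_max (h_point_dist D (fseq \<xi>) (fseq \<zeta>)) (h_point_dist D (fseq \<zeta>) (fseq \<eta>)))"
    using ultra s unfolding h_ultrametric_def h_seq_graph[symmetric] by blast
  then have "le (pd \<xi> \<eta>) (\<lambda>k. max (pd \<xi> \<zeta> k) (pd \<zeta> \<eta> k))"
    using f by (simp add: real_le_iff[OF rep_pd rep_max[OF rep_pd rep_pd]])
  then show ?thesis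
    using f by (simp add: le_iff_cut fc_pd fc_max cut_max d_def)
qed

lemma d_ultra_mem:
  "Pt \<xi> \<Longrightarrow> Pt \<eta> \<Longrightarrow> Pt \<zeta> \<Longrightarrow> q \<notin> d \<xi> \<zeta> \<Longrightarrow> q \<notin> d \<zeta> \<eta> \<Longrightarrow> q \<notin> d \<xi> \<eta>"
  using d_ultra by blast

end

section \<open>The fixed point\<close>

locale contraction = ultra_space +
  fixes F :: "mnat set"
  assumes F_set: "F \<in> sets" and cont: "h_continuous_code X D F" and total: "h_total_function X D F"
    and contr: "h_strictly_contracting X D F" and sph: "h_spherically_complete X D"
begin

section \<open>Values of the coded function\<close>

lemma code_relD:
  assumes "h_code_rel F a r b s"
  shows "a \<in> X" "b \<in> X" "israt r" "0 < qv r" "israt s" "0 < qv s"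
proof -
  have "\<forall>z. z \<in> F \<longrightarrow> h_pairs (h_pairs (h_pairs (h_pairs (\<lambda>x. x = x) (\<lambda>x. x \<in> X)) h_pos_rat) (\<lambda>x. x
      \<in> X)) h_pos_rat z"
    using cont unfolding h_continuous_code_def by (elim conjE)
  then show "a \<in> X" "b \<in> X" "israt r" "0 < qv r" "israt s" "0 < qv s"
    using assms unfolding h_code_rel_def h_pairs_def h_pos_rat_iff by fastforce+
qed

lemma code_rel_dist:
  assumes "h_code_rel F a r b s" "h_code_rel F a r b' s'"
  shows "qv s + qv s' \<notin> d (cp b) (cp b')"
proof -
  have X: "b \<in> X" "b' \<in> X" "israt s" "israt s'" using assms code_relD by blast+
  have "\<forall>a r b s b' s'. h_code_rel F a r b s \<and> h_code_rel F a r b' s' \<longrightarrow>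
      h_real_le (h_dist D b b') (h_real_add (h_of_rat s) (h_of_rat s'))"
    using cont unfolding h_continuous_code_def by (elim conjE)
  then have "h_real_le (h_dist D b b') (h_real_add (h_of_rat (code (qv s))) (h_of_rat (code (qv
      s'))))"
    using assms X by (simp only: code_qv)
  then show ?thesis
    using X real_le_iff[OF rep_dist rep_add[OF rep_of_rat rep_of_rat]]
    by (simp add: le_const_iff fc_\<delta> d_cp)
qed

text \<open>Translates the shrinking condition of the code from \<open>h_ball_less\<close> to a
  rational bound \<open>q\<close> on the distance of the centres.\<close>

lemma code_rel_shrink:
  assumes c: "h_code_rel F a r b s" and X: "a' \<in> X" "0 < r'" and q:
      "q \<notin> d (cp a) (cp a')" "q + r' < qv r"
  shows "h_code_rel F a' (code r') b s"
proof -
  have a: "a \<in> X" "israt r" using code_relD[OF c] by auto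
  \<comment> \<open>Three errors of at most \<open>hp k\<close> must fit: one from approximating the
    distance and two from the tolerance in \<open>le\<close>.\<close>
  obtain k where k: "hp k < (qv r - q - r') / 3" using hp_archimedean[of "(qv r - q - r') / 3"]
      q(2) by auto
  have "\<delta> a a' (k + 1) \<le> q + hp (k + 1)" using q(1) a X by (simp add: d_cp not_cut)
  moreover have "hp (k + 1) \<le> hp k" by (rule hp_mono) simp
  moreover have "hp k + hp k + hp k < qv r - q - r'" using k by (simp add: field_simps)
  ultimately have "\<delta> a a' (k + 1) + r' + hp k + hp k < qv r" by linarith
  then have "\<not> le (\<lambda>_. qv r) (\<lambda>k. \<delta> a a' (k + 1) + r')" by (auto simp: le_def not_le)
  then have "\<not> h_real_le (h_of_rat (code (qv r))) (h_real_add (h_dist D a a') (h_of_rat (code r')))"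
    using real_le_iff[OF rep_of_rat rep_add[OF rep_dist[OF a(1) X(1)] rep_of_rat]] by simp
  then have "h_ball_less D a' (code r') a r" using a by (simp add: h_ball_less_def code_qv)
  moreover have "h_pos_rat (code r')" using X by (simp add: h_pos_rat_iff)
  moreover have "\<forall>a r b s a' r'. h_code_rel F a r b s \<and> a' \<in> X \<and> h_pos_rat r' \<and>
      h_ball_less D a' r' a r \<longrightarrow> h_code_rel F a' r' b s"
    using cont unfolding h_continuous_code_def by (elim conjE)
  ultimately show ?thesis using c X by blast
qed

text \<open>Two balls of the code around \<xi> have a common small ball centred at an approximation
  of \<xi>, and for that ball the compatibility of images is part of the code.\<close>

lemma code_rel_dist':
  assumes \<xi>: "Pt \<xi>" and c: "h_code_rel F a r b s" "h_code_rel F a' r' b' s'"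
    and l: "lt \<xi> a (qv r)" "lt \<xi> a' (qv r')"
  shows "qv s + qv s' \<notin> d (cp b) (cp b')"
proof -
  note D = code_relD[OF c(1)] code_relD[OF c(2)]
  have f: "fast \<xi>" using \<xi> by (rule Pt_fast)
  obtain p where p: "p < qv r" "p \<notin> d \<xi> (cp a)" using l(1) lt_iff[OF f D(1)] by blast
  obtain p' where p': "p' < qv r'" "p' \<notin> d \<xi> (cp a')" using l(2) lt_iff[OF f D(7)] by blast
  \<comment> \<open>Twice \<open>hp n\<close> must stay below \<open>qv r - p\<close> and below
    \<open>qv r\<close>, because the new centre is within \<open>max p (hp n)\<close> of the old
    one.\<close>
  have "0 < min (min (qv r - p) (qv r)) (min (qv r' - p') (qv r')) / 2" using D p p' by simp
  then obtain n where n: "hp n < min (min (qv r - p) (qv r)) (min (qv r' - p') (qv r')) / 2"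
    using hp_archimedean by blast
  have X: "\<xi> n \<in> X" using f by (rule fastD)
  have *: "h_code_rel F (\<xi> n) (code (hp n)) b s"
    if c: "h_code_rel F a r b s" and p: "p \<notin> d \<xi> (cp a)" and n:
        "hp n < (qv r - p) / 2" "hp n < qv r / 2" for a r b s p
  proof (rule code_rel_shrink[OF c X hp_pos])
    have a: "a \<in> X" using code_relD[OF c] by blast
    have "max p (hp n) \<notin> d \<xi> (cp a)" using p by (rule d_up) simp
    then have 1: "max p (hp n) \<notin> d (cp a) \<xi>" using d_sym[OF f fast_cp[OF a]] by simp
    have 2: "max p (hp n) \<notin> d \<xi> (cp (\<xi> n))" using d_approx[OF f] by (rule d_up) simp
    show "max p (hp n) \<notin> d (cp a) (cp (\<xi> n))"
      by (rule d_ultra_mem[OF Pt_cp[OF a] Pt_cp[OF X] \<xi> 1 2])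
    have "p + (hp n + hp n) < qv r" "hp n + hp n < qv r" using n by (simp_all add: field_simps)
    moreover from this have "p + hp n < qv r" using hp_pos[of n] by linarith
    ultimately show "max p (hp n) + hp n < qv r" by (simp add: max_def)
  qed
  have "h_code_rel F (\<xi> n) (code (hp n)) b s" using *[OF c(1) p(2)] n by simp
  moreover have "h_code_rel F (\<xi> n) (code (hp n)) b' s'" using *[OF c(2) p'(2)] n by simp
  ultimately show ?thesis by (rule code_rel_dist)
qed

lemma domain:
  assumes \<xi>: "Pt \<xi>" and "0 < \<epsilon>"
  obtains a r b s where "h_code_rel F a r b s" "lt \<xi> a (qv r)" "qv s < \<epsilon>"
proof -
  have "graph \<xi> \<in> sets" "h_point X D (graph \<xi>)"
    using \<xi> h_point_iff by (auto simp: Pt_def cf_graph)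
  then have "h_in_domain D F (graph \<xi>)" using total by (simp add: h_total_function_def)
  moreover have "h_pos_rat (code \<epsilon>)" using assms by (simp add: h_pos_rat_iff)
  ultimately obtain a r b s where c: "h_code_rel F a r b s"
    and l: "\<not> h_real_le (h_of_rat r) (h_point_dist D (fseq \<xi>) (fseq (cp a)))"
    and s: "\<not> h_real_le (h_of_rat (code \<epsilon>)) (h_of_rat s)"
    unfolding h_in_domain_def h_seq_graph h_of_rat_fseq[symmetric] by blast
  note D = code_relD[OF c]
  have "lt \<xi> a (qv r)" using l lt_real_less[OF Pt_fast[OF \<xi>] D(1,3)] by simp
  moreover have "qv s < \<epsilon>"
    using s real_le_iff[OF rep_of_rat[of \<epsilon>] rep_of_rat[of "qv s"]] D(5)
    by (auto simp: code_qv le_iff_cut[OF fc_const fc_const] cut_const not_le[symmetric])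
  ultimately show thesis using that c by blast
qed

definition val :: "(mnat \<Rightarrow> mnat) \<Rightarrow> (mnat \<Rightarrow> mnat) \<Rightarrow> bool" where
  "val \<xi> \<eta> \<longleftrightarrow> Pt \<eta> \<and> (\<forall>a r b s. h_code_rel F a r b s \<longrightarrow> lt \<xi> a (qv r) \<longrightarrow> qv s \<notin> d \<eta> (cp b))"

lemma val_Pt: "val \<xi> \<eta> \<Longrightarrow> Pt \<eta>"
  by (simp add: val_def)

lemma h_is_value_iff:
  assumes \<xi>: "Pt \<xi>" and \<eta>: "Pt \<eta>"
  shows "h_is_value X D F (graph \<xi>) (graph \<eta>) \<longleftrightarrow> val \<xi> \<eta>"
proof -
  have "graph \<eta> \<in> sets" "h_point X D (graph \<eta>)"
    using \<eta> h_point_iff by (auto simp: Pt_def cf_graph)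
  moreover have "(\<not> h_real_le (h_of_rat r) (h_point_dist D (fseq \<xi>) (fseq (cp a))) \<longleftrightarrow>
      lt \<xi> a (qv r)) \<and>
    (h_real_le (h_point_dist D (fseq \<eta>) (fseq (cp b))) (h_of_rat s) \<longleftrightarrow> qv s \<notin> d \<eta> (cp b))"
    if "h_code_rel F a r b s" for a r b s
  proof
    note D = code_relD[OF that]
    note f = Pt_fast[OF \<eta>] fast_cp[OF D(2)]
    show "\<not> h_real_le (h_of_rat r) (h_point_dist D (fseq \<xi>) (fseq (cp a))) \<longleftrightarrow> lt \<xi> a (qv r)"
      by (rule lt_real_less[OF Pt_fast[OF \<xi>] D(1,3)])
    show "h_real_le (h_point_dist D (fseq \<eta>) (fseq (cp b))) (h_of_rat s) \<longleftrightarrow> qv s \<notin> d \<eta> (cp b)"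
      using real_le_iff[OF rep_pd[OF f] rep_of_rat[of "qv s"]] D(5)
      by (simp add: code_qv le_const_iff fc_pd[OF f] d_def)
  qed
  ultimately show ?thesis
    using \<eta> unfolding h_is_value_def val_def h_seq_graph h_of_rat_fseq[of b for b]
    by (metis h_of_rat_fseq)
qed

text \<open>The k-th term of the value is the centre of an image ball of radius below
  \<open>hp (k + 1 + 1)\<close>. Any two such balls are compatible by \<open>code_rel_dist'\<close>,
  so the terms converge fast whichever balls are selected.\<close>

lemma value_exists:
  assumes \<xi>: "Pt \<xi>" shows "\<exists>\<eta>. val \<xi> \<eta>"
proof -
  have cf: "cf \<xi>" and f: "fast \<xi>" using \<xi> by (auto simp: Pt_def)
  \<comment> \<open>All witnesses are spelled out so that the selection is visibly
    \<open>Sigma01\<close>. The index \<open>j\<close> confirms that \<xi> lies in the ball.\<close>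
  define P where "P k y \<longleftrightarrow> (\<exists>c r s n j u w. pair (pair (pair (pair n c) r) y) s \<in> F \<and>
    \<xi> (j + 1 + 1) = u \<and> pair (pair (pair u c) (j + 1 + 1)) w \<in> D \<and>
    qv w + hp j + hp j < qv r \<and> qv s < hp (k + 1 + 1))" for k y
  have P: "P k y \<longleftrightarrow> (\<exists>c r s. h_code_rel F c r y s \<and> lt \<xi> c (qv r) \<and> qv s < hp (k + 1 + 1))" for k y
  proof -
    have "(\<exists>j u w. \<xi> (j + 1 + 1) = u \<and> pair (pair (pair u c) (j + 1 + 1)) w \<in> D \<and>
      qv w + hp j + hp j < qv r) \<longleftrightarrow> lt \<xi> c (qv r)" if "h_code_rel F c r y s" for c r s
      using code_relD(1)[OF that] fastD[OF f] by (simp add: dist_iff lt_def pd_def)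
    then show ?thesis unfolding P_def h_code_rel_def by blast
  qed
  have "sg (\<lambda>e. P (e 0) (e 1))"
    unfolding P_def
    by (intro sg_ex sg_conj sg_qless qf_add qf_hp qf_qv sg_d0 d0_mem[OF _ F_set] d0_mem[OF _ D_set]
        d0_cf[OF cf] tmf_pair tmf_intros)
  moreover have "\<exists>y. P k y" for k
    unfolding P using domain[OF \<xi> hp_pos] by metis
  ultimately obtain \<eta> where \<eta>: "cf \<eta>" "\<And>k. P k (\<eta> k)" using sg_choice[of P] by blast
  have X: "\<eta> k \<in> X" for k using \<eta>(2)[of k] code_relD unfolding P by blast
  have "hp i \<notin> d (cp (\<eta> i)) (cp (\<eta> j))" if "i \<le> j" for i j
  proof -
    obtain c r s where 1: "h_code_rel F c r (\<eta> i) s" "lt \<xi> c (qv r)" "qv s < hp (i + 1 + 1)"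
      using \<eta>(2)[of i] unfolding P by blast
    obtain c' r' s' where 2: "h_code_rel F c' r' (\<eta> j) s'" "lt \<xi> c' (qv r')" "qv s' < hp (j + 1 +
        1)"
      using \<eta>(2)[of j] unfolding P by blast
    have "hp (j + 1 + 1) \<le> hp (i + 1 + 1)" using that by (intro hp_mono add_right_mono)
    moreover have "hp (i + 1 + 1) = hp i / 4" by (simp only: hp_Suc)
    ultimately have "qv s + qv s' \<le> hp i" using 1 2 hp_pos[of i] by linarith
    then show ?thesis using code_rel_dist'[OF \<xi> 1(1) 2(1) 1(2) 2(2)] d_up by blast
  qed
  then have "fast \<eta>" unfolding fast_def using X by (simp add: d_cp)
  then have Pt: "Pt \<eta>" using \<eta>(1) by (simp add: Pt_def)
  have "qv s \<notin> d \<eta> (cp b)" if c: "h_code_rel F a r b s" "lt \<xi> a (qv r)" for a r b s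
  proof
    note D = code_relD[OF c(1)]
    assume "qv s \<in> d \<eta> (cp b)"
    then obtain s2 where s2: "qv s < s2" "s2 \<in> d \<eta> (cp b)" using d_open by blast
    obtain k where k: "hp k < min (qv s) (s2 - qv s)"
      using hp_archimedean[of "min (qv s) (s2 - qv s)"] D s2 by auto
    obtain c' r' s' where 1: "h_code_rel F c' r' (\<eta> k) s'" "lt \<xi> c' (qv r')" "qv s' < hp (k + 1 +
        1)"
      using \<eta>(2)[of k] unfolding P by blast
    have "hp (k + 1 + 1) \<le> hp k" by (rule hp_Suc_Suc)
    then have le: "qv s' + qv s \<le> s2" "hp k \<le> s2" using k 1(3) s2 by auto
    have "s2 \<notin> d (cp (\<eta> k)) (cp b)"
      using code_rel_dist'[OF \<xi> 1(1) c(1) 1(2) c(2)] le(1) by (rule d_up)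
    moreover have "s2 \<notin> d \<eta> (cp (\<eta> k))" using d_approx[OF \<open>fast \<eta>\<close>] le(2) by (rule d_up)
    ultimately show False using s2(2) d_ultra_mem[OF Pt Pt_cp[OF D(2)] Pt_cp[OF X]] by blast
  qed
  then show ?thesis using Pt unfolding val_def by blast
qed

lemma value_less:
  assumes \<xi>: "Pt \<xi>" "Pt \<xi>'" and v: "val \<xi> \<eta>" "val \<xi>' \<eta>'" and "0 \<in> d \<xi> \<xi>'"
  shows "\<not> d \<xi> \<xi>' \<subseteq> d \<eta> \<eta>'"
proof -
  note P = val_Pt[OF v(1)] val_Pt[OF v(2)]
  have s: "graph \<xi> \<in> sets" "graph \<xi>' \<in> sets" "graph \<eta> \<in> sets" "graph \<eta>' \<in> sets"
    using \<xi> P by (auto simp: Pt_def cf_graph)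
  note f = \<xi>[THEN Pt_fast] P[THEN Pt_fast]
  have "h_point X D (graph \<xi>)" "h_point X D (graph \<xi>')" using \<xi> s h_point_iff by auto
  moreover have "\<not> h_point_eq D (graph \<xi>) (graph \<xi>')" using assms f by (simp add: h_point_eq_iff)
  moreover have "h_is_value X D F (graph \<xi>) (graph \<eta>)" "h_is_value X D F (graph \<xi>') (graph \<eta>')"
    using v P \<xi> by (simp_all add: h_is_value_iff)
  ultimately have "\<not> h_real_le (h_point_dist D (fseq \<xi>) (fseq \<xi>')) (h_point_dist D (fseq \<eta>) (fseq
      \<eta>'))"
    using contr s unfolding h_strictly_contracting_def h_seq_graph[symmetric] by blast
  then show "\<not> d \<xi> \<xi>' \<subseteq> d \<eta> \<eta>'"
    using f by (simp add: real_le_iff[OF rep_pd rep_pd] le_iff_cut fc_pd d_def)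
qed

text \<open>Strict contraction speaks of distinct points. For points at distance 0 the code is used
  instead: a ball containing one contains the other, so both values lie in common image balls of
  arbitrarily small radius.\<close>

lemma value_le:
  assumes \<xi>: "Pt \<xi>" "Pt \<xi>'" and v: "val \<xi> \<eta>" "val \<xi>' \<eta>'"
  shows "d \<eta> \<eta>' \<subseteq> d \<xi> \<xi>'"
proof (cases "0 \<in> d \<xi> \<xi>'")
  case True
  then show ?thesis using value_less[OF \<xi> v] d_linear by blast
next
  case False
  note P = val_Pt[OF v(1)] val_Pt[OF v(2)]
  note f = \<xi>[THEN Pt_fast] P[THEN Pt_fast]
  show ?thesis
  proof
    fix q assume q: "q \<in> d \<eta> \<eta>'"
    show "q \<in> d \<xi> \<xi>'"
    proof (rule ccontr)
      assume "q \<notin> d \<xi> \<xi>'"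
      then have "0 \<le> q" using d_nonneg f by blast
      obtain q2 where q2: "q < q2" "q2 \<in> d \<eta> \<eta>'" using d_open[OF q] by blast
      then have "0 < q2" using \<open>0 \<le> q\<close> by simp
      then obtain a r b s where c: "h_code_rel F a r b s" "lt \<xi> a (qv r)" "qv s < q2"
        using domain[OF \<xi>(1)] by blast
      note D = code_relD[OF c(1)]
      obtain p where p: "p < qv r" "p \<notin> d \<xi> (cp a)" using c(2) lt_iff[OF f(1) D(1)] by blast
      have "max p 0 \<notin> d \<xi> (cp a)" using p(2) by (rule d_up) simp
      moreover have "max p 0 \<notin> d \<xi>' \<xi>" using False d_sym[OF f(1,2)] d_up by (metis max.cobounded2)
      ultimately have "max p 0 \<notin> d \<xi>' (cp a)" using d_ultra_mem[OF \<xi>(2) Pt_cp[OF D(1)] \<xi>(1)] by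
          blast
      moreover have "max p 0 < qv r" using p D by simp
      ultimately have "lt \<xi>' a (qv r)" using lt_iff[OF f(2) D(1)] by blast
      then have "qv s \<notin> d \<eta> (cp b)" "qv s \<notin> d \<eta>' (cp b)" using v c unfolding val_def by blast+
      then have "qv s \<notin> d \<eta> \<eta>'"
        using d_ultra_mem[OF P(1) P(2) Pt_cp[OF D(2)]] d_sym[OF f(4) fast_cp[OF D(2)]] by simp
      then show False using q2(2) c(3) d_up less_imp_le by blast
    qed
  qed
qed

end

section \<open>Semidecidable comparisons and the stages\<close>

context contraction
begin

text \<open>\<open>dlt\<close> and \<open>dgt\<close> are the confirmable forms of d(a, b) < r and
  d(a, b) > r. By \<open>dlt_dgt\<close>, two distinct thresholds make one of them succeed.\<close>

definition dlt :: "mnat \<Rightarrow> mnat \<Rightarrow> mnat \<Rightarrow> bool" where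
  "dlt a b r \<longleftrightarrow> (\<exists>k v. pair (pair (pair a b) k) v \<in> D \<and> qv v + hp k < qv r)"

definition dgt :: "mnat \<Rightarrow> mnat \<Rightarrow> mnat \<Rightarrow> bool" where
  "dgt a b r \<longleftrightarrow> (\<exists>k v. pair (pair (pair a b) k) v \<in> D \<and> qv r + hp k < qv v)"

text \<open>With \<open>\<phi>(b) = d(b, f(b))\<close>, the relations \<open>\<phi>(b) < s\<close> and \<open>\<phi>(b) > s\<close>.\<close>

definition phlt :: "mnat \<Rightarrow> mnat \<Rightarrow> bool" where
  "phlt b s \<longleftrightarrow> (\<exists>n c r y q j w k v. pair (pair (pair (pair n c) r) y) q \<in> F \<and>
     pair (pair (pair b c) (j + 1 + 1)) w \<in> D \<and> qv w + hp j + hp j < qv r \<and>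
     pair (pair (pair b y) k) v \<in> D \<and> qv v + hp k + qv q < qv s)"

definition phgt :: "mnat \<Rightarrow> mnat \<Rightarrow> bool" where
  "phgt b s \<longleftrightarrow> (\<exists>n c r y q j w k v. pair (pair (pair (pair n c) r) y) q \<in> F \<and>
     pair (pair (pair b c) (j + 1 + 1)) w \<in> D \<and> qv w + hp j + hp j < qv r \<and>
     pair (pair (pair b y) k) v \<in> D \<and> qv s + hp k + qv q < qv v)"

lemma sg_dlt: "sg (\<lambda>e. dlt (e 0) (e 1) (e 2))"
  unfolding dlt_def by (intro sg_ex sg_conj sg_qless qf_add qf_hp qf_qv sg_d0 d0_mem[OF _ D_set]
      tmf_pair tmf_intros)

lemma sg_dgt: "sg (\<lambda>e. dgt (e 0) (e 1) (e 2))"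
  unfolding dgt_def by (intro sg_ex sg_conj sg_qless qf_add qf_hp qf_qv sg_d0 d0_mem[OF _ D_set]
      tmf_pair tmf_intros)

lemma sg_phlt: "sg (\<lambda>e. phlt (e 0) (e 1))"
  unfolding phlt_def
  by (intro sg_ex sg_conj sg_qless qf_add qf_hp qf_qv sg_d0 d0_mem[OF _ D_set] d0_mem[OF _ F_set]
      tmf_pair tmf_intros)

lemma sg_phgt: "sg (\<lambda>e. phgt (e 0) (e 1))"
  unfolding phgt_def
  by (intro sg_ex sg_conj sg_qless qf_add qf_hp qf_qv sg_d0 d0_mem[OF _ D_set] d0_mem[OF _ F_set]
      tmf_pair tmf_intros)

lemma dlt_iff: "a \<in> X \<Longrightarrow> b \<in> X \<Longrightarrow> dlt a b r \<longleftrightarrow> (\<exists>k. \<delta> a b k + hp k < qv r)"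
  by (simp add: dlt_def dist_iff)

lemma dgt_iff: "a \<in> X \<Longrightarrow> b \<in> X \<Longrightarrow> dgt a b r \<longleftrightarrow> qv r \<in> d (cp a) (cp b)"
  by (simp add: dgt_def dist_iff d_cp cut_def)

text \<open>The search looks for a ball that contains b and whose image is within
  \<open>qv q\<close> of \<open>y\<close>, and adds this error to the k-th upper estimate of d(b,
  y).\<close>

lemma phlt_iff:
  assumes "b \<in> X"
  shows "phlt b s \<longleftrightarrow> (\<exists>c r y q k. h_code_rel F c r y q \<and> lt (cp b) c (qv r) \<and>
      \<delta> b y k + hp k + qv q < qv s)"
proof -
  have 1: "(\<exists>j w. pair (pair (pair b c) (j + 1 + 1)) w \<in> D \<and> qv w + hp j + hp j < qv r) \<longleftrightarrow>
      lt (cp b) c (qv r)"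
    and 2: "(\<exists>v. pair (pair (pair b y) k) v \<in> D \<and> qv v + hp k + qv q < qv s) \<longleftrightarrow>
        \<delta> b y k + hp k + qv q < qv s"
    if "h_code_rel F c r y q" for c r y q k
    using code_relD(1,2)[OF that] assms by (simp_all add: dist_iff lt_def pd_def)
  have "phlt b s \<longleftrightarrow> (\<exists>c r y q k. h_code_rel F c r y q \<and>
    (\<exists>j w. pair (pair (pair b c) (j + 1 + 1)) w \<in> D \<and> qv w + hp j + hp j < qv r) \<and>
    (\<exists>v. pair (pair (pair b y) k) v \<in> D \<and> qv v + hp k + qv q < qv s))"
    unfolding phlt_def h_code_rel_def by blast
  then show ?thesis by (simp only: 1 2 cong: conj_cong)
qed

lemma phgt_iff:
  assumes "b \<in> X"
  shows "phgt b s \<longleftrightarrow> (\<exists>c r y q k. h_code_rel F c r y q \<and> lt (cp b) c (qv r) \<and>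
      qv s + hp k + qv q < \<delta> b y k)"
proof -
  have 1: "(\<exists>j w. pair (pair (pair b c) (j + 1 + 1)) w \<in> D \<and> qv w + hp j + hp j < qv r) \<longleftrightarrow>
      lt (cp b) c (qv r)"
    and 2: "(\<exists>v. pair (pair (pair b y) k) v \<in> D \<and> qv s + hp k + qv q < qv v) \<longleftrightarrow>
        qv s + hp k + qv q < \<delta> b y k"
    if "h_code_rel F c r y q" for c r y q k
    using code_relD(1,2)[OF that] assms by (simp_all add: dist_iff lt_def pd_def)
  have "phgt b s \<longleftrightarrow> (\<exists>c r y q k. h_code_rel F c r y q \<and>
    (\<exists>j w. pair (pair (pair b c) (j + 1 + 1)) w \<in> D \<and> qv w + hp j + hp j < qv r) \<and>
    (\<exists>v. pair (pair (pair b y) k) v \<in> D \<and> qv s + hp k + qv q < qv v))"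
    unfolding phgt_def h_code_rel_def by blast
  then show ?thesis by (simp only: 1 2 cong: conj_cong)
qed

lemma dlt_dgt: "a \<in> X \<Longrightarrow> b \<in> X \<Longrightarrow> qv t < qv r \<Longrightarrow> dgt a b t \<or> dlt a b r"
proof -
  assume X: "a \<in> X" "b \<in> X" and "qv t < qv r"
  then obtain k where k: "hp k < (qv r - qv t) / 2" using hp_archimedean[of "(qv r - qv t) / 2"]
      by auto
  then have k2: "hp k + hp k < qv r - qv t" by (simp add: field_simps)
  show ?thesis
  proof (cases "\<delta> a b k + hp k < qv r")
    case False
    with k2 have "qv t + hp k < \<delta> a b k" by linarith
    then show ?thesis using X by (auto simp: dgt_iff d_cp cut_def)
  qed (use X in \<open>auto simp: dlt_iff\<close>)
qed

lemma dlt_bound: "a \<in> X \<Longrightarrow> b \<in> X \<Longrightarrow> dlt a b r \<Longrightarrow> qv r \<notin> d (cp a) (cp b)"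
proof -
  assume X: "a \<in> X" "b \<in> X" and "dlt a b r"
  then obtain k where "\<delta> a b k + hp k < qv r" by (auto simp: dlt_iff)
  moreover have "\<delta> a b k + hp k \<notin> d (cp a) (cp b)" using X by (simp add: d_cp not_cut_approx fc_\<delta>)
  ultimately show ?thesis using d_up by (meson less_imp_le)
qed

lemma phlt_phgt:
  assumes b: "b \<in> X" and "qv s' < qv s" shows "phlt b s \<or> phgt b s'"
proof -
  \<comment> \<open>With both errors below a quarter of the gap, failure of the upper test at
    \<open>s\<close> leaves an approximate distance above \<open>qv s' + hp k + qv q\<close>, which
    is the lower test.\<close>
  have "0 < (qv s - qv s') / 4" using assms(2) by simp
  then obtain c r y q where c: "h_code_rel F c r y q" "lt (cp b) c (qv r)" and q:
      "qv q < (qv s - qv s') / 4"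
    using domain[OF Pt_cp[OF b]] by blast
  obtain k where k: "hp k < (qv s - qv s') / 4" using hp_archimedean[OF \<open>0 < (qv s - qv s') / 4\<close>]
      by blast
  show ?thesis
  proof (cases "\<delta> b y k + hp k + qv q < qv s")
    case True
    then show ?thesis unfolding phlt_iff[OF b] using c by blast
  next
    case False
    have "4 * hp k < qv s - qv s'" "4 * qv q < qv s - qv s'" using k q by (simp_all add:
        field_simps)
    with False have "qv s' + hp k + qv q < \<delta> b y k" by linarith
    then show ?thesis unfolding phgt_iff[OF b] using c by blast
  qed
qed

text \<open>A confirmed strict bound leaves room for a smaller rational one: this provides the
  threshold \<open>t\<close> of a stage.\<close>

lemma phlt_less:
  assumes "b \<in> X" "phlt b s" obtains t where "israt t" "qv t < qv s" "phlt b t"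
proof -
  obtain c r y q k where c: "h_code_rel F c r y q" "lt (cp b) c (qv r)" "\<delta> b y k + hp k + qv q <
      qv s"
    using assms(2) unfolding phlt_iff[OF assms(1)] by blast
  obtain x where "\<delta> b y k + hp k + qv q < x" "x < qv s" using dense[OF c(3)] by blast
  moreover from this have "phlt b (code x)" unfolding phlt_iff[OF assms(1)] code(2) using c(1,2)
      by blast
  ultimately show thesis using that[of "code x"] by simp
qed

text \<open>Both d(b, y) and d(y, f(b)) are at most \<open>qv s\<close>, hence so is d(b, f(b)).
  Positivity comes from the radius \<open>qv q\<close> of the image ball.\<close>

lemma phlt_bound:
  assumes b: "b \<in> X" "phlt b s" and v: "val (cp b) \<beta>"
  shows "qv s \<notin> d (cp b) \<beta>" "0 < qv s"
proof -
  obtain c r y q k where c: "h_code_rel F c r y q" "lt (cp b) c (qv r)" "\<delta> b y k + hp k + qv q <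
      qv s"
    using b(2) unfolding phlt_iff[OF b(1)] by blast
  note D = code_relD[OF c(1)]
  have \<beta>: "Pt \<beta>" by (rule val_Pt[OF v])
  have 1: "\<delta> b y k + hp k \<notin> d (cp b) (cp y)" using b D by (simp add: d_cp not_cut_approx fc_\<delta>)
  then have 0: "0 \<le> \<delta> b y k + hp k" using d_nonneg[OF fast_cp[OF b(1)] fast_cp[OF D(2)]] by blast
  have 2: "qv q \<notin> d (cp y) \<beta>"
    unfolding d_sym[OF fast_cp[OF D(2)] Pt_fast[OF \<beta>]] using v c unfolding val_def by blast
  have "\<delta> b y k + hp k \<le> qv s" "qv q \<le> qv s" using c(3) 0 D(6) by linarith+
  then show "qv s \<notin> d (cp b) \<beta>"
    using d_ultra_mem[OF Pt_cp[OF b(1)] \<beta> Pt_cp[OF D(2)]] d_up[OF 1] d_up[OF 2] by blast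
  show "0 < qv s" using c(3) 0 D(6) by linarith
qed

text \<open>If d(b, f(b)) were at most \<open>qv s\<close>, then \<open>y\<close>, being within
  \<open>qv q\<close> of f(b), would be within \<open>qv s + qv q\<close> of b.\<close>

lemma phgt_bound:
  assumes b: "b \<in> X" "phgt b s" and v: "val (cp b) \<beta>"
  shows "qv s \<in> d (cp b) \<beta>"
proof (rule ccontr)
  assume no: "qv s \<notin> d (cp b) \<beta>"
  obtain c r y q k where c: "h_code_rel F c r y q" "lt (cp b) c (qv r)" "qv s + hp k + qv q < \<delta> b
      y k"
    using b(2) unfolding phgt_iff[OF b(1)] by blast
  note D = code_relD[OF c(1)]
  have \<beta>: "Pt \<beta>" by (rule val_Pt[OF v])
  have "qv s + qv q + hp k < \<delta> b y k" using c(3) by (simp add: algebra_simps)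
  then have "qv s + qv q \<in> d (cp b) (cp y)" using b D by (auto simp: d_cp cut_def)
  moreover have "0 \<le> qv s" using no d_nonneg[OF fast_cp[OF b(1)] Pt_fast[OF \<beta>]] by blast
  then have le: "qv s \<le> qv s + qv q" "qv q \<le> qv s + qv q" using D(6) by simp_all
  have "qv q \<notin> d \<beta> (cp y)" using v c unfolding val_def by blast
  then have "qv s + qv q \<notin> d \<beta> (cp y)" using le(2) by (rule d_up)
  moreover have "qv s + qv q \<notin> d (cp b) \<beta>" using no le(1) by (rule d_up)
  ultimately show False using d_ultra_mem[OF Pt_cp[OF b(1)] Pt_cp[OF D(2)] \<beta>] by blast
qed

definition task :: "mnat \<Rightarrow> mnat \<Rightarrow> mnat \<Rightarrow> mnat \<Rightarrow> bool" where
  "task n b s' s \<longleftrightarrow> n = pair b (pair s' s) \<and> b \<in> X \<and> israt s' \<and> israt s \<and> \<not> fle s s'"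

lemma d0_task: "tmf f \<Longrightarrow> tmf g \<Longrightarrow> tmf h \<Longrightarrow> tmf i \<Longrightarrow> d0 (\<lambda>e. task (f e) (g e) (h e) (i e))"
  unfolding task_def by (intro d0_intros d0_mem[OF _ X_set] d0_israt d0_fle tmf_pair)

text \<open>Stage \<open>n\<close> of the construction turns the ball with centre \<open>a\<close> and radius \<open>r > \<phi>(a)\<close>, coded by
  the state \<open>u\<close>, into a smaller one. If \<open>n\<close> proposes the centre \<open>b\<close> then either \<open>b\<close> is excluded from
  the new ball, or \<open>b\<close> becomes the new centre, or \<open>b\<close> is of no use as \<open>r \<le> s\<close> or \<open>\<phi>(b) > s'\<close>.\<close>

definition move :: "mnat \<Rightarrow> mnat \<Rightarrow> mnat \<Rightarrow> bool" where
  "move n u u' \<longleftrightarrow> (\<exists>a r a' r'. u = pair a r \<and> u' = pair a' r' \<and>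
     ((\<forall>b\<le>n. \<forall>s'\<le>n. \<forall>s\<le>n. \<not> task n b s' s) \<and> a' = a \<and> r' = r \<or>
      (\<exists>b s' s. task n b s' s \<and>
        (israt r' \<and> phlt a r' \<and> qv r' < qv r \<and> dgt a b r' \<and> a' = a \<or>
         dlt a b r \<and> phlt b s \<and> qv s < qv r \<and> a' = b \<and> r' = s \<or>
         (fle r s \<or> phgt b s') \<and> a' = a \<and> r' = r))))"

text \<open>That \<open>n\<close> codes no task is a negative condition, but it is bounded since the
  components of a triple are at most its code. All other conditions are confirmed by search.\<close>

lemma sg_move: "sg (\<lambda>e. move (e 0) (e 1) (e 2))"
  unfolding move_def
  by (intro sg_ex sg_conj sg_disj sg_subst3[OF sg_dgt] sg_subst3[OF sg_dlt] sg_subst2[OF sg_phlt]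
      sg_subst2[OF sg_phgt] sg_qless qf_qv sg_d0 d0_ball_le d0_not d0_task d0_israt d0_fle d0_eq
      tmf_pair tmf_intros)

definition state :: "mnat \<Rightarrow> bool" where
  "state u \<longleftrightarrow> (\<exists>a r. u = pair a r \<and> a \<in> X \<and> israt r \<and> phlt a r)"

lemma sg_state: "sg (\<lambda>e. state (e 0))"
  unfolding state_def
  by (intro sg_ex sg_conj sg_subst2[OF sg_phlt] sg_d0 d0_mem[OF _ X_set] d0_israt d0_eq tmf_pair
      tmf_intros)

lemma move_pair: "move n (pair a r) (pair a' r') \<longleftrightarrow>
     (\<forall>b\<le>n. \<forall>s'\<le>n. \<forall>s\<le>n. \<not> task n b s' s) \<and> a' = a \<and> r' = r \<or>
      (\<exists>b s' s. task n b s' s \<and>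
        (israt r' \<and> phlt a r' \<and> qv r' < qv r \<and> dgt a b r' \<and> a' = a \<or>
         dlt a b r \<and> phlt b s \<and> qv s < qv r \<and> a' = b \<and> r' = s \<or>
         (fle r s \<or> phgt b s') \<and> a' = a \<and> r' = r))"
  by (simp add: move_def)

lemma task_bound: "task n b s' s \<Longrightarrow> b \<le> n \<and> s' \<le> n \<and> s \<le> n"
  unfolding task_def using pair_ge order_trans by metis

lemma move_exists: "state u \<Longrightarrow> \<exists>u'. move n u u'"
proof -
  assume "state u"
  then obtain a r where u: "u = pair a r" "a \<in> X" "israt r" "phlt a r" unfolding state_def by blast
  show ?thesis
  proof (cases "\<exists>b s' s. task n b s' s")
    case False
    then have "move n u (pair a r)" unfolding u move_pair by blast
    then show ?thesis ..
  next
    case True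
    then obtain b s' s where t: "task n b s' s" by blast
    then have b: "b \<in> X" and s: "isfrac s" "qv s' < qv s"
      by (auto simp: task_def fle_iff israt_isfrac)
    obtain r' where r': "israt r'" "qv r' < qv r" "phlt a r'" using phlt_less[OF u(2,4)] by blast
    have "qv s < qv r \<or> fle r s"
      unfolding fle_iff using s(1) israt_isfrac[OF u(3)] by (simp add: not_less[symmetric])
    \<comment> \<open>The two tests with double thresholds, for d(a, b) and for \<phi>(b), and the
      decidable comparison of \<open>s\<close> with the radius leave these three outcomes.\<close>
    then consider "dgt a b r'" | "dlt a b r" "phlt b s" "qv s < qv r" | "fle r s \<or> phgt b s'"
      using dlt_dgt[OF u(2) b r'(2)] phlt_phgt[OF b s(2)] by blast
    then show ?thesis
    proof cases
      case 1
      then have "move n u (pair a r')" unfolding u move_pair using t r' by blast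
      then show ?thesis ..
    next
      case 2
      then have "move n u (pair b s)" unfolding u move_pair using t by blast
      then show ?thesis ..
    next
      case 3
      then have "move n u (pair a r)" unfolding u move_pair using t by blast
      then show ?thesis ..
    qed
  qed
qed

lemma move_state: "state u \<Longrightarrow> move n u u' \<Longrightarrow> state u'"
  unfolding state_def by (elim exE conjE, hypsubst) (auto simp: move_def task_def)

section \<open>The run of the construction and a point common to its balls\<close>

lemma run_exists:
  obtains a r where "cf a" "cf r" "\<And>n. a n \<in> X" "\<And>n. israt (r n)" "\<And>n. phlt (a n) (r n)"
    "\<And>n. move n (pair (a n) (r n)) (pair (a (n + 1)) (r (n + 1)))"
proof -
  obtain a0 where a0: "a0 \<in> X" using csm by (auto simp: h_csm_space_def)
  obtain c r y q where c: "h_code_rel F c r y q" "lt (cp a0) c (qv r)"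
    using domain[OF Pt_cp[OF a0] zero_less_one] by metis
  \<comment> \<open>\<open>\<delta> a0 y 0 + hp 0 + qv q\<close> bounds \<phi>(a0) from above, and
    adding 1 makes the bound strict.\<close>
  have "phlt a0 (code (\<delta> a0 y 0 + hp 0 + qv q + 1))"
    unfolding phlt_iff[OF a0] using c by (metis code(2) less_add_one)
  then have init: "state (pair a0 (code (\<delta> a0 y 0 + hp 0 + qv q + 1)))" using a0 by (auto simp:
      state_def)
  obtain f where f: "cf f" "\<And>n. state (f n)" "\<And>n. move n (f n) (f (n + 1))"
    by (rule recursion[OF sg_move sg_state init]) (use move_exists move_state in blast)+
  have "\<exists>a. \<forall>n. \<exists>r. f n = pair (a n) r \<and> a n \<in> X \<and> israt r \<and> phlt (a n) r"
    using f(2) unfolding state_def by (intro choice) blast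
  then obtain a where "\<And>n. \<exists>r. f n = pair (a n) r \<and> a n \<in> X \<and> israt r \<and> phlt (a n) r" by blast
  then have "\<exists>r. \<forall>n. f n = pair (a n) (r n) \<and> a n \<in> X \<and> israt (r n) \<and> phlt (a n) (r n)"
    by (intro choice) blast
  then obtain r where ar: "\<And>n. f n = pair (a n) (r n)" "\<And>n. a n \<in> X" "\<And>n. israt (r n)" "\<And>n. phlt
      (a n) (r n)"
    by blast
  have "sg (\<lambda>e. \<exists>u v. f (e 0) = u \<and> u = pair (e 1) v)" "sg (\<lambda>e. \<exists>u v. f (e 0) = u \<and>
      u = pair v (e 1))"
    by (intro sg_ex sg_d0 d0_conj d0_cf[OF f(1)] d0_eq tmf_pair tmf_var)+
  then have "cf a" "cf r" by (auto intro!: sg_cf simp: ar eq_commute)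
  then show thesis using that ar f(3) by simp
qed

text \<open>The centre changes only in the second kind of move, which has confirmed that
  \<open>b\<close> is within the radius. Where the centre stays, the radius is positive by
  \<open>phlt_bound\<close>.\<close>

lemma move_nested:
  assumes m: "move n (pair a r) (pair a' r')" and X: "a \<in> X" "phlt a r"
  shows "qv r' \<le> qv r" "qv r \<notin> d (cp a') (cp a)"
proof -
  obtain \<alpha> where "val (cp a) \<alpha>" using value_exists[OF Pt_cp[OF X(1)]] by blast
  then have "0 < qv r" using phlt_bound[OF X] by blast
  then have self: "qv r \<notin> d (cp a) (cp a)" using d_self[OF fast_cp[OF X(1)]] d_up less_imp_le by
      metis
  have "qv r \<notin> d (cp b) (cp a)" if "dlt a b r" "b \<in> X" for b
    using dlt_bound[OF X(1) that(2,1)] d_sym[OF fast_cp[OF X(1)] fast_cp[OF that(2)]] by simp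
  then show "qv r' \<le> qv r" "qv r \<notin> d (cp a') (cp a)"
    using m self unfolding move_def task_def by auto
qed

text \<open>Centres in the dense set and rational radii are constant sequences, so two sequences of
  numbers already code a sequence of balls.\<close>

lemma h_section_const: "h_section {z. \<exists>i k. z = pair (pair i k) (f i)} i = h_of_rat (f i)"
  by (auto simp: fun_eq_iff h_section_def h_of_rat_def)

lemma section_set:
  assumes "cf f" shows "{z. \<exists>i k. z = pair (pair i k) (f i)} \<in> sets"
proof -
  have "d0 (\<lambda>e. \<exists>i\<le>e 0. \<exists>k\<le>e 0. \<exists>v\<le>e 0. e 0 = pair (pair i k) v \<and> f i = v)"
    by (intro d0_bex_le d0_conj d0_eq d0_cf[OF assms] tmf_pair tmf_var)
  moreover have "(\<exists>i k. z = pair (pair i k) (f i)) \<longleftrightarrow> (\<exists>i\<le>z. \<exists>k\<le>z. \<exists>v\<le>z. z = pair (pair i k) v \<and>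
      f i = v)" for z
  proof
    assume "\<exists>i k. z = pair (pair i k) (f i)"
    then obtain i k where z: "z = pair (pair i k) (f i)" by blast
    have "pair i k \<le> z" "f i \<le> z" using pair_ge z by auto
    moreover have "i \<le> pair i k" "k \<le> pair i k" by (rule pair_ge)+
    ultimately show "\<exists>i\<le>z. \<exists>k\<le>z. \<exists>v\<le>z. z = pair (pair i k) v \<and> f i = v"
      using z order_trans by blast
  qed blast
  ultimately show ?thesis by (intro d0_set) simp
qed

lemma section_fun:
  "(\<And>i. P (f i)) \<Longrightarrow> h_is_fun (h_pairs (\<lambda>x. x = x) (\<lambda>x. x = x)) P {z. \<exists>i k. z = pair (pair i k) (f
      i)}"
  unfolding h_is_fun_def h_pairs_def by auto

lemma limit_exists:
  assumes "cf a" "cf r" and X: "\<And>n. a n \<in> X" and r: "\<And>n. israt (r n)" "\<And>n. 0 < qv (r n)"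
    and nested: "\<And>n. qv (r (n + 1)) \<le> qv (r n)" "\<And>n. qv (r n) \<notin> d (cp (a (n + 1))) (cp (a n))"
  obtains \<xi> where "Pt \<xi>" "\<And>n. qv (r n) \<notin> d \<xi> (cp (a n))"
proof -
  let ?C = "{z. \<exists>i k. z = pair (pair i k) (a i)}" and ?R = "{z. \<exists>i k. z = pair (pair i k) (r i)}"
  have repr: "rep (h_of_rat (r i)) (\<lambda>_. qv (r i))" for i
    using rep_of_rat[of "qv (r i)"] r(1) by (simp add: code_qv)
  have "h_ball_seq X D ?C ?R"
    unfolding h_ball_seq_def h_section_const
  proof (intro conjI allI)
    show "h_is_fun (h_pairs (\<lambda>x. x = x) (\<lambda>x. x = x)) (\<lambda>a. a \<in> X) ?C"
      by (rule section_fun) (rule X)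
    show "h_is_fun (h_pairs (\<lambda>x. x = x) (\<lambda>x. x = x)) israt ?R"
      by (rule section_fun) (rule r(1))
    fix i
    show "h_converges_fast D (h_of_rat (a i))"
      unfolding h_of_rat_fseq using converges_fast_iff[of "cp (a i)"] fast_cp[OF X] X by simp
    show "h_fast_cauchy (h_of_rat (r i))" unfolding fast_cauchy_iff[OF repr] by (rule fc_const)
    show "\<not> h_real_le (h_of_rat (r i)) (h_of_rat (qfrac 0 0 1))"
      unfolding qfrac_zero real_le_iff[OF repr rep_of_rat] le_const_iff[OF fc_const] cut_const
      using r(2) by simp
  qed
  moreover have "h_ball_prec D (h_section ?C (i + 1)) (h_section ?R (i + 1)) (h_section ?C i)
      (h_section ?R i)" for i
    unfolding h_ball_prec_def h_section_const h_of_rat_fseq[of "a n" for n]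
      real_le_iff[OF rep_max[OF rep_pd[OF fast_cp[OF X] fast_cp[OF X]] repr] repr]
      le_const_iff[OF fc_max[OF fc_pd[OF fast_cp[OF X] fast_cp[OF X]] fc_const]] cut_max cut_const
    using nested[of i] by (simp add: d_def not_less)
  moreover have "?C \<in> sets" "?R \<in> sets" using assms by (auto intro: section_set)
  ultimately obtain x where x: "x \<in> sets" "h_point X D x"
    "\<And>i. h_in_ball D (h_seq x) (h_section ?C i) (h_section ?R i)"
    using sph unfolding h_spherically_complete_def by blast
  then obtain \<xi> where \<xi>: "Pt \<xi>" "x = graph \<xi>" using h_point_iff by blast
  have "qv (r n) \<notin> d \<xi> (cp (a n))" for n
    using x(3)[of n] unfolding h_in_ball_def h_section_const \<xi>(2) h_seq_graph h_of_rat_fseq[of "a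
        n"]
      real_le_iff[OF rep_pd[OF fast_cp[OF X] Pt_fast[OF \<xi>(1)]] repr]
      le_const_iff[OF fc_pd[OF fast_cp[OF X] Pt_fast[OF \<xi>(1)]]]
    using d_sym[OF fast_cp[OF X] Pt_fast[OF \<xi>(1)]] by (simp add: d_def)
  with \<xi>(1) show thesis using that by blast
qed

section \<open>The fixed point: existence and uniqueness\<close>

lemma fixed_point_exists:
  obtains \<xi> \<eta> where "Pt \<xi>" "val \<xi> \<eta>" "0 \<notin> d \<eta> \<xi>"
proof -
  obtain a r where ar: "cf a" "cf r" "\<And>n. a n \<in> X" "\<And>n. israt (r n)" "\<And>n. phlt (a n) (r n)"
    "\<And>n. move n (pair (a n) (r n)) (pair (a (n + 1)) (r (n + 1)))"
    using run_exists by blast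
  note X = ar(3)
  have ph: "0 < qv (r n) \<and> qv (r n) \<notin> d (cp (a n)) \<alpha>" if "val (cp (a n)) \<alpha>" for n \<alpha>
    using phlt_bound[OF X ar(5) that] by blast
  have pos: "0 < qv (r n)" for n using ph value_exists[OF Pt_cp[OF X]] by blast
  obtain \<xi> where \<xi>: "Pt \<xi>" and ball: "\<And>n. qv (r n) \<notin> d \<xi> (cp (a n))"
    using limit_exists[OF ar(1-4) pos move_nested[OF ar(6) X ar(5)]] by blast
  obtain \<eta> where v: "val \<xi> \<eta>" using value_exists[OF \<xi>] by blast
  have \<eta>: "Pt \<eta>" by (rule val_Pt[OF v])
  obtain \<zeta> where w: "val \<eta> \<zeta>" using value_exists[OF \<eta>] by blast
  have \<zeta>: "Pt \<zeta>" by (rule val_Pt[OF w])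
  note f = Pt_fast[OF \<xi>] Pt_fast[OF \<eta>] Pt_fast[OF \<zeta>]
  \<comment> \<open>Along \<xi>, \<open>a n\<close>, f(\<open>a n\<close>), \<eta> each distance is
    at most the radius: the first since \<xi> lies in the ball, the second by the invariant, the
    third by contraction.\<close>
  have radius: "qv (r n) \<notin> d \<xi> \<eta>" for n
  proof -
    obtain \<alpha> where \<alpha>: "val (cp (a n)) \<alpha>" using value_exists[OF Pt_cp[OF X]] by blast
    have "qv (r n) \<notin> d \<alpha> \<eta>"
      using value_le[OF Pt_cp[OF X] \<xi> \<alpha> v] ball[of n] d_sym[OF f(1) fast_cp[OF X]] by auto
    then have "qv (r n) \<notin> d (cp (a n)) \<eta>"
      using d_ultra_mem[OF Pt_cp[OF X] \<eta> val_Pt[OF \<alpha>]] ph[OF \<alpha>] by blast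
    then show ?thesis using d_ultra_mem[OF \<xi> \<eta> Pt_cp[OF X]] ball[of n] by blast
  qed
  have "0 \<notin> d \<xi> \<eta>"
  proof
    assume "0 \<in> d \<xi> \<eta>"
    \<comment> \<open>\<open>q\<close> is at least d(\<eta>, \<zeta>) and below d(\<xi>, \<eta>).
      Openness of the cut and density insert s1 < s2 strictly above \<open>q\<close>, still below
      d(\<xi>, \<eta>); they act as s' and s.\<close>
    then obtain q where q: "q \<in> d \<xi> \<eta>" "q \<notin> d \<eta> \<zeta>" using value_less[OF \<xi> \<eta> v w] by blast
    then have "0 \<le> q" using d_nonneg[OF f(2,3)] by blast
    obtain s2 where s2: "q < s2" "s2 \<in> d \<xi> \<eta>" using d_open[OF q(1)] by blast
    obtain s1 where s1: "q < s1" "s1 < s2" using dense[OF s2(1)] by blast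
    have "0 < s1" using s1 \<open>0 \<le> q\<close> by simp
    have s1': "s1 \<notin> d \<eta> \<zeta>" using q(2) s1(1) d_up by (meson less_imp_le)
    obtain k where k: "hp k < s1" using hp_archimedean[OF \<open>0 < s1\<close>] by blast
    define b where "b = \<eta> k"
    have b: "b \<in> X" using fastD[OF f(2)] by (simp add: b_def)
    have near: "s1 \<notin> d \<eta> (cp b)" using d_approx[OF f(2),
        of k] k d_up unfolding b_def by (meson less_imp_le)
    obtain \<beta> where \<beta>: "val (cp b) \<beta>" using value_exists[OF Pt_cp[OF b]] by blast
    \<comment> \<open>With \<zeta> = f(\<eta>) and \<beta> = f(b), all distances along b, \<eta>,
      \<zeta>, \<beta> are at most \<open>s1\<close>, so \<phi>(b) > s' can never be
      confirmed.\<close>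
    have "s1 \<notin> d \<zeta> \<beta>" using value_le[OF \<eta> Pt_cp[OF b] w \<beta>] near by blast
    then have "s1 \<notin> d \<eta> \<beta>" using d_ultra_mem[OF \<eta> val_Pt[OF \<beta>] \<zeta>] s1' by blast
    then have "s1 \<notin> d (cp b) \<beta>"
      using d_ultra_mem[OF Pt_cp[OF b] val_Pt[OF \<beta>] \<eta>] near d_sym[OF f(2) fast_cp[OF b]] by simp
    then have no: "\<not> phgt b (code s1)" using phgt_bound[OF b _ \<beta>] by fastforce
    define n where "n = pair b (pair (code s1) (code s2))"
    have t: "task n b (code s1) (code s2)" using b s1 by (simp add: task_def n_def fle_iff)
    have t_unique: "b' = b \<and> s' = code s1 \<and> s = code s2" if "task n b' s' s" for b' s' s
      using that by (auto simp: task_def n_def)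
    \<comment> \<open>Every radius is at least d(\<xi>, \<eta>) and so exceeds \<open>s2\<close>.
      This rules out both a radius lowered to \<open>s2\<close> and a radius already at most
      \<open>s2\<close>.\<close>
    have small: "s2 < qv (r n)" for n using radius[of n] s2(2) d_up not_less by blast
    let ?a = "a n" and ?r = "r n" and ?a' = "a (n + 1)" and ?r' = "r (n + 1)"
    have "dgt ?a b ?r' \<and> ?a' = ?a \<or> ?r' = code s2 \<or> fle ?r (code s2) \<or> phgt b (code s1)"
    proof -
      have "\<not> (\<forall>b\<le>n. \<forall>s'\<le>n. \<forall>s\<le>n. \<not> task n b s' s)" using t task_bound[OF t] by blast
      then obtain b' s' s where "task n b' s' s"
        and m: "israt ?r' \<and> phlt ?a ?r' \<and> qv ?r' < qv ?r \<and> dgt ?a b' ?r' \<and> ?a' = ?a \<or>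
           dlt ?a b' ?r \<and> phlt b' s \<and> qv s < qv ?r \<and> ?a' = b' \<and> ?r' = s \<or>
           (fle ?r s \<or> phgt b' s') \<and> ?a' = ?a \<and> ?r' = ?r"
        using ar(6)[of n] unfolding move_pair by blast
      then have "b' = b" "s' = code s1" "s = code s2" using t_unique by blast+
      with m show ?thesis by blast
    qed
    then show False
    proof (elim disjE)
      assume g: "dgt ?a b ?r' \<and> ?a' = ?a"
      \<comment> \<open>Both d(\<eta>, b) and d(\<xi>, \<eta>) are at most the new radius, and \<xi>
        lies in the new ball. Hence \<open>b\<close> lies in it as well and was not
        excluded.\<close>
      have "qv ?r' \<notin> d \<eta> (cp b)" using near small[of "n + 1"] s1 d_up by (meson less_imp_le
          less_trans)
      then have "qv ?r' \<notin> d \<xi> (cp b)" using radius[of "n + 1"] d_ultra_mem[OF \<xi> Pt_cp[OF b] \<eta>] by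
          blast
      moreover have "qv ?r' \<notin> d (cp ?a) \<xi>" using ball[of "n + 1"] g d_sym[OF f(1) fast_cp[OF X]]
          by metis
      ultimately have "qv ?r' \<notin> d (cp ?a) (cp b)" using d_ultra_mem[OF Pt_cp[OF X] Pt_cp[OF b] \<xi>]
          by blast
      then show False using g dgt_iff[OF X b] by blast
    next
      assume "?r' = code s2"
      then show False using small[of "n + 1"] by simp
    next
      assume "fle ?r (code s2)"
      then show False using small[of n] by (simp add: fle_iff)
    qed (use no in blast)
  qed
  then show thesis using that[OF \<xi> v] d_sym[OF f(1,2)] by simp
qed

text \<open>For distinct points some \<open>q\<close> would be at least the distance of the values
  and below that of the points, yet each value is at distance 0 from its point.\<close>

lemma fixed_point_unique:
  assumes \<xi>: "Pt \<xi>" "val \<xi> \<eta>" "0 \<notin> d \<eta> \<xi>" and \<xi>': "Pt \<xi>'" "val \<xi>' \<eta>'" "0 \<notin> d \<eta>' \<xi>'"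
  shows "0 \<notin> d \<xi>' \<xi>"
proof
  assume "0 \<in> d \<xi>' \<xi>"
  then obtain q where q: "q \<in> d \<xi>' \<xi>" "q \<notin> d \<eta>' \<eta>"
    using value_less[OF \<xi>'(1) \<xi>(1) \<xi>'(2) \<xi>(2)] by blast
  note P = val_Pt[OF \<xi>(2)] val_Pt[OF \<xi>'(2)]
  have "0 \<le> q" using q(2) d_nonneg P Pt_fast by blast
  then have "q \<notin> d \<eta>' \<xi>'" "q \<notin> d \<eta> \<xi>" using \<xi>(3) \<xi>'(3) d_up by blast+
  then show False
    using q d_ultra_mem[OF \<xi>'(1) \<xi>(1) P(1)] d_ultra_mem[OF \<xi>'(1) P(1) P(2)]
      d_sym[OF Pt_fast[OF P(2)] Pt_fast[OF \<xi>'(1)]] by blast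
qed

lemma h_fixed_point_iff:
  assumes "x \<in> sets"
  shows "h_fixed_point X D F x \<longleftrightarrow> (\<exists>\<xi> \<eta>. x = graph \<xi> \<and> Pt \<xi> \<and> val \<xi> \<eta> \<and> 0 \<notin> d \<eta> \<xi>)"
proof
  assume "h_fixed_point X D F x"
  then obtain y where y: "y \<in> sets" "h_point X D x" "h_is_value X D F x y" "h_point_eq D y x"
    unfolding h_fixed_point_def by blast
  obtain \<xi> where \<xi>: "Pt \<xi>" "x = graph \<xi>" using y(2) h_point_iff[OF assms] by blast
  have "h_point X D y" using y(3) by (simp add: h_is_value_def)
  then obtain \<eta> where \<eta>: "Pt \<eta>" "y = graph \<eta>" using h_point_iff[OF y(1)] by blast
  show "\<exists>\<xi> \<eta>. x = graph \<xi> \<and> Pt \<xi> \<and> val \<xi> \<eta> \<and> 0 \<notin> d \<eta> \<xi>"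
    using y(3,4) \<xi> \<eta> h_is_value_iff[OF \<xi>(1) \<eta>(1)] h_point_eq_iff[OF Pt_fast[OF \<eta>(1)] Pt_fast[OF
        \<xi>(1)]]
    by blast
next
  assume "\<exists>\<xi> \<eta>. x = graph \<xi> \<and> Pt \<xi> \<and> val \<xi> \<eta> \<and> 0 \<notin> d \<eta> \<xi>"
  then obtain \<xi> \<eta> where *: "x = graph \<xi>" "Pt \<xi>" "val \<xi> \<eta>" "0 \<notin> d \<eta> \<xi>" by blast
  have \<eta>: "Pt \<eta>" by (rule val_Pt[OF *(3)])
  then have "graph \<eta> \<in> sets" by (simp add: Pt_def cf_graph)
  moreover have "h_point X D x" using * h_point_iff[OF assms] by blast
  ultimately show "h_fixed_point X D F x"
    unfolding h_fixed_point_def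
    using * h_is_value_iff[OF *(2) \<eta>] h_point_eq_iff[OF Pt_fast[OF \<eta>] Pt_fast[OF *(2)]] by blast
qed

lemma unique_fixed_point:
  "\<exists>x\<in>sets. h_fixed_point X D F x \<and> (\<forall>y\<in>sets. h_fixed_point X D F y \<longrightarrow> h_point_eq D y x)"
proof -
  obtain \<xi> \<eta> where \<xi>: "Pt \<xi>" "val \<xi> \<eta>" "0 \<notin> d \<eta> \<xi>" by (rule fixed_point_exists)
  have s: "graph \<xi> \<in> sets" using \<xi>(1) by (simp add: Pt_def cf_graph)
  have "h_point_eq D y (graph \<xi>)" if y: "y \<in> sets" "h_fixed_point X D F y" for y
  proof -
    obtain \<xi>' \<eta>' where \<xi>': "y = graph \<xi>'" "Pt \<xi>'" "val \<xi>' \<eta>'" "0 \<notin> d \<eta>' \<xi>'"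
      using y h_fixed_point_iff by blast
    show ?thesis
      unfolding \<xi>'(1) h_point_eq_iff[OF Pt_fast[OF \<xi>'(2)] Pt_fast[OF \<xi>(1)]]
      by (rule fixed_point_unique[OF \<xi> \<xi>'(2-4)])
  qed
  moreover have "h_fixed_point X D F (graph \<xi>)" using \<xi> h_fixed_point_iff[OF s] by blast
  ultimately show ?thesis using s by blast
qed

end

theorem theorem4p1:
  shows "RCA0 \<turnstile> sentence
    (\<^bold>\<forall>\<^sub>S X D F.
       csm_space X D \<^bold>\<and> ultrametric X D \<^bold>\<and> spherically_complete X D \<^bold>\<and>
       continuous_code X D F \<^bold>\<and> total_function X D F \<^bold>\<and> strictly_contracting X D F \<^bold>\<longrightarrow>
       (\<^bold>\<exists>\<^sub>S x. fixed_point X D F x \<^bold>\<and> (\<^bold>\<forall>\<^sub>S y. fixed_point X D F y \<^bold>\<longrightarrow> point_eq D y x)))"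
  unfolding goal_def[symmetric]
proof (rule goal_reduction)
  fix X D F
  assume *: "X \<in> sets" "D \<in> sets" "F \<in> sets" "h_csm_space X D" "h_ultrametric X D"
    "h_spherically_complete X D" "h_continuous_code X D F" "h_total_function X D F"
    "h_strictly_contracting X D F"
  \<comment> \<open>Powers of 2 come from the given space, so the locale is interpreted only after
    the hypotheses on it are at hand.\<close>
  obtain ex where ex: "exponential ex" "\<And>k e. h_pow2 k e \<longleftrightarrow> ex k = e"
    by (rule exponential_exists[OF *(4)]) (rule that)
  interpret contraction ex X D F
    by (intro contraction.intro ultra_space.intro pow_space.intro pow_space_axioms.intro
        ultra_space_axioms.intro contraction_axioms.intro ex *)
  show "\<exists>x\<in>sets. h_fixed_point X D F x \<and> (\<forall>y\<in>sets. h_fixed_point X D F y \<longrightarrow> h_point_eq D y x)"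
    by (rule unique_fixed_point)
qed

end
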